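(* Let $\mu,\nu\in\mathcal P_2^{\rm ac}(\mathbb R^d)$, and assume that there is a convex function $\varphi\in C^2(\mathbb R^d)$ and constants $0<\sigma_m(\varphi)\le\sigma_M(\varphi)<\infty$ such that $(\nabla\varphi)_\#\mu=\nu$ and $\sigma_m(\varphi)I\preceq\nabla^2\varphi(y)\preceq\sigma_M(\varphi)I$ for all $y\in\mathbb R^d$. Assume moreover that $\mu,\nu\in\mathcal P_{2+\beta}(\mathbb R^d)$ for some $\beta>0$. Then $$\lim_{\varepsilon\to0^+}\frac{{\rm EOT}_\varepsilon(\mu,\nu)-{\rm OT}(\mu,\nu)+\frac d2\,\varepsilon\log(\pi\varepsilon)}{\varepsilon}=\mathcal K_{\rm EOT}(\mu,\nu)\in[-\infty,\infty).$$
   Context: For $q>0$, $\mathcal P_q(\mathbb R^d)$ is the set of Borel probability measures on $\mathbb R^d$ with finite $q$-th moment, and $\mathcal P_q^{\rm ac}(\mathbb R^d)$ the subset of those absolutely continuous with respect to Lebesgue measure; $f_\mu$ denotes the Lebesgue density of $\mu$. $\Pi(\mu,\nu)$ is the set of couplings of $\mu$ and $\nu$. Define $${\rm OT}(\mu,\nu)=\inf_{\pi\in\Pi(\mu,\nu)}\int\|x-y\|^2\,d\pi(x,y),\qquad {\rm EOT}_\varepsilon(\mu,\nu)=\inf_{\pi\in\Pi(\mu,\nu)}\left\{\int\|x-y\|^2\,d\pi(x,y)+\varepsilon\,{\rm KL}(\pi|\mu\otimes\nu)\right\},$$ where ${\rm KL}(\alpha|\beta)=\int\log\left(\frac{d\alpha}{d\beta}\right)d\alpha$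 if $\alpha\ll\beta$ and $+\infty$ otherwise. In $\log(\pi\varepsilon)$, $\pi$ is the number $3.14\ldots$. For $\alpha\in\mathcal P_2^{\rm ac}(\mathbb R^d)$ set ${\rm Ent}(\alpha)=\int\log f_\alpha\,d\alpha\in(-\infty,\infty]$, and define $$\mathcal K_{\rm EOT}(\mu,\nu)=-\frac12\int_{\mathbb R^d}\log\left[f_\mu(x)f_\nu(\nabla\varphi(x))\right]d\mu(x)=-\frac{{\rm Ent}(\mu)+{\rm Ent}(\nu)}{2}\in[-\infty,\infty).$$ The value $-\infty$ is allowed. *)

theory Defs
  imports "HOL-Probability.Probability"
begin

definition prob_moment :: "real \<Rightarrow> 'a::euclidean_space measure set" where
  "prob_moment q = {\<mu>. prob_space \<mu> \<and> sets \<mu> = sets borel \<and>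
     (\<integral>\<^sup>+ x. ennreal (norm x powr q) \<partial>\<mu>) < \<infinity>}"

definition prob_moment_ac :: "real \<Rightarrow> 'a::euclidean_space measure set" where
  "prob_moment_ac q = {\<mu> \<in> prob_moment q. absolutely_continuous lborel \<mu>}"

definition lebesgue_density :: "'a::euclidean_space measure \<Rightarrow> 'a \<Rightarrow> real" where
  "lebesgue_density \<mu> x = enn2real (RN_deriv lborel \<mu> x)"

(* Integral with values in the extended reals.  Since ennreal (f x) is 0 for negative f x, the two
   terms are the integrals of the positive and of the negative part of f; the value is meaningful
   when one of them is finite.  In the definitions below it is only used for logarithms of
   densities that are positive almost everywhere for the integrating measure, so the convention
   ln 0 = 0 has no influence. *)
definition ext_integral :: "'a measure \<Rightarrow> ('a \<Rightarrow> real) \<Rightarrow> ereal" where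
  "ext_integral M f =
     enn2ereal (\<integral>\<^sup>+ x. ennreal (f x) \<partial>M) - enn2ereal (\<integral>\<^sup>+ x. ennreal (- f x) \<partial>M)"

(* The library's KL_divergence is a real-valued Bochner integral, hence 0 where the divergence is
   infinite; here the value is infinite in that case and without absolute continuity. *)
definition KL :: "'a measure \<Rightarrow> 'a measure \<Rightarrow> ereal" where
  "KL \<alpha> \<beta> = (if sets \<alpha> = sets \<beta> \<and> absolutely_continuous \<beta> \<alpha>
     then ext_integral \<alpha> (\<lambda>x. ln (enn2real (RN_deriv \<beta> \<alpha> x))) else \<infinity>)"

definition Ent :: "'a::euclidean_space measure \<Rightarrow> ereal" where
  "Ent \<alpha> = ext_integral \<alpha> (\<lambda>x. ln (lebesgue_density \<alpha> x))"

definition couplings ::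
    "'a::euclidean_space measure \<Rightarrow> 'a measure \<Rightarrow> ('a \<times> 'a) measure set" where
  "couplings \<mu> \<nu> = {\<gamma>. prob_space \<gamma> \<and> sets \<gamma> = sets borel \<and>
     distr \<gamma> borel fst = \<mu> \<and> distr \<gamma> borel snd = \<nu>}"

definition quadratic_cost :: "('a::euclidean_space \<times> 'a) measure \<Rightarrow> ereal" where
  "quadratic_cost \<gamma> = enn2ereal (\<integral>\<^sup>+ z. ennreal ((norm (fst z - snd z))\<^sup>2) \<partial>\<gamma>)"

definition OT :: "'a::euclidean_space measure \<Rightarrow> 'a measure \<Rightarrow> ereal" where
  "OT \<mu> \<nu> = (INF \<gamma>\<in>couplings \<mu> \<nu>. quadratic_cost \<gamma>)"

definition EOT :: "real \<Rightarrow> 'a::euclidean_space measure \<Rightarrow> 'a measure \<Rightarrow> ereal" where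
  "EOT \<epsilon> \<mu> \<nu> =
     (INF \<gamma>\<in>couplings \<mu> \<nu>. quadratic_cost \<gamma> + ereal \<epsilon> * KL \<gamma> (\<mu> \<Otimes>\<^sub>M \<nu>))"

definition gradient :: "('a::real_inner \<Rightarrow> real) \<Rightarrow> 'a \<Rightarrow> 'a" where
  "gradient f x = (THE D. GDERIV f x :> D)"

definition hessian :: "(real ^ 'd \<Rightarrow> real) \<Rightarrow> real ^ 'd \<Rightarrow> real ^ 'd ^ 'd" where
  "hessian f x = jacobian (gradient f) (at x)"

definition C2 :: "(real ^ 'd \<Rightarrow> real) \<Rightarrow> bool" where
  "C2 f \<longleftrightarrow> f differentiable_on UNIV \<and> gradient f differentiable_on UNIV \<and>
     continuous_on UNIV (hessian f)"

definition loewner_le :: "real ^ 'd ^ 'd \<Rightarrow> real ^ 'd ^ 'd \<Rightarrow> bool" where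
  "loewner_le A B \<longleftrightarrow> (\<forall>v. v \<bullet> (A *v v) \<le> v \<bullet> (B *v v))"

definition K_EOT ::
    "('a::euclidean_space \<Rightarrow> real) \<Rightarrow> 'a measure \<Rightarrow> 'a measure \<Rightarrow> ereal" where
  "K_EOT \<phi> \<mu> \<nu> = ereal (- 1 / 2) *
     ext_integral \<mu> (\<lambda>x. ln (lebesgue_density \<mu> x * lebesgue_density \<nu> (gradient \<phi> x)))"

end

(* Write T for the gradient of the potential, B for its Bregman divergence, rho for the density of
   mu and H for the Hessian.  Pulling nu back along T, the excess cost of a coupling over OT becomes
   the integral of 2 B, so that EOT - OT is an entropic self-transport problem for mu with a cost
   that is quadratic near the diagonal.

   Lower bound: the Gibbs inequality is applied to potentials of the form
   -ln (rho (x) * Z (x)) / 2, where Z (x) is the integral of exp (-2 B / epsilon) in the other variable;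
   the Laplace method gives Z ~ sqrt ((pi epsilon)^d / det H).

   Upper bound: since only symmetric couplings are used, 2 B may be replaced by the symmetric cost
   S (x, z) = B (x, z) + B (z, x), and Z is built from S.  As in the Metropolis algorithm, the measure
   with density min ((rho / Z) (x), (rho / Z) (z)) * exp (-S (x, z) / epsilon) is symmetric with marginals at most mu;
   the missing mass tends to zero by continuity of translations in L^1 and is coupled to itself
   independently inside cubes of side sqrt epsilon, at negligible cost and entropy.  Truncating ln rho
   from above covers infinite entropy.  The two bounds match because
   rho_nu (T x) * det (H x) = rho (x). *)

theory Submission
  imports Defs
begin

text \<open>The density \<open>\<rho>\<close> is merely measurable, and \<open>ln \<rho>\<close> has
  only an integrable minorant. So \<open>\<rho>\<close> stays outside all Laplace integrals:
  \<open>Z\<close> depends on the cost alone, lies between two positive constants, and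
  \<open>ln Z\<close> converges boundedly. The factor 1/2 in the dual potentials makes the Gibbs
  weight a geometric mean of two kernels, one normalised in each variable. The same half returns in
  the upper bound because the logarithm of a minimum is at most the mean of the logarithms; the
  entropy of the kernel thus splits into functions of one variable. The obstacle is the entropy of
  the missing mass. Its part in a cell has no lower bound, so its logarithm is compared with that of
  the Gaussian mass of the cell by \<open>ln t \<le> t - 1\<close>: the weighted ratios sum to at
  most the total Gaussian mass, and the Gaussian logarithm is integrable by the second moment. The
  terms in \<open>ln \<epsilon>\<close> from the kernel and from the volume of the cells carry
  complementary weights and add up exactly; this is essential, since continuity of translations
  gives no rate.\<close>

section \<open>Change of variables in arbitrary finite dimension\<close>

text \<open>The library proves the change of variables only for well-ordered index types; a copy of the
  index type with an arbitrary well-order transfers it to all finite ones.\<close>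

datatype 'a wo_index = WO (unWO: 'a)

lemma bij_unWO: "bij unWO"
  by (metis bijI' wo_index.collapse wo_index.sel)

lemma bij_WO: "bij WO"
  by (metis bijI' wo_index.collapse wo_index.sel)

instance wo_index :: (finite) finite
  by standard (metis bij_WO bij_def finite finite_imageI)

instantiation wo_index :: (finite) wellorder
begin

definition less_eq_wo_index :: "'a wo_index \<Rightarrow> 'a wo_index \<Rightarrow> bool" where
  "x \<le> y \<longleftrightarrow> to_nat_on (UNIV :: 'a set) (unWO x) \<le> to_nat_on (UNIV :: 'a set) (unWO y)"

definition less_wo_index :: "'a wo_index \<Rightarrow> 'a wo_index \<Rightarrow> bool" where
  "x < y \<longleftrightarrow> to_nat_on (UNIV :: 'a set) (unWO x) < to_nat_on (UNIV :: 'a set) (unWO y)"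

instance
proof
  have inj: "inj (to_nat_on (UNIV :: 'a set))"
    by (intro inj_on_to_nat_on countable_finite finite)
  fix x y z :: "'a wo_index" and P
  show "(x < y) = (x \<le> y \<and> \<not> y \<le> x)" "x \<le> x" "x \<le> y \<or> y \<le> x"
    by (auto simp: less_eq_wo_index_def less_wo_index_def)
  show "x \<le> y \<Longrightarrow> y \<le> z \<Longrightarrow> x \<le> z"
    by (simp add: less_eq_wo_index_def)
  show "x \<le> y \<Longrightarrow> y \<le> x \<Longrightarrow> x = y"
    using inj by (metis injD less_eq_wo_index_def order_antisym wo_index.expand)
  show "P x" if step: "\<And>x. (\<And>y. y < x \<Longrightarrow> P y) \<Longrightarrow> P x"
  proof (induction "to_nat_on (UNIV :: 'a set) (unWO x)" arbitrary: x rule: less_induct)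
    case less
    show ?case by (rule step) (rule less, simp add: less_wo_index_def)
  qed
qed

end

lemma prod_Basis_cart:
  fixes f :: "real \<Rightarrow> real" and x :: "real ^ 'n"
  shows "(\<Prod>b\<in>Basis. f (x \<bullet> b)) = (\<Prod>i\<in>UNIV. f (x $ i))"
proof -
  have B: "Basis = range (\<lambda>i::'n. axis i (1::real))"
    by (auto simp: Basis_vec_def)
  have inj: "inj (\<lambda>i::'n. axis i (1::real))"
    by (simp add: inj_on_def axis_eq_axis)
  show ?thesis
    unfolding B by (subst prod.reindex[OF inj]) (simp add: inner_axis)
qed

definition reindex :: "real ^ 'n \<Rightarrow> real ^ 'n wo_index" where
  "reindex x = (\<chi> i. x $ unWO i)"

definition unreindex :: "real ^ 'n wo_index \<Rightarrow> real ^ 'n" where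
  "unreindex x = (\<chi> i. x $ WO i)"

lemma unreindex_reindex [simp]: "unreindex (reindex x) = x"
  by (simp add: reindex_def unreindex_def)

lemma reindex_unreindex [simp]: "reindex (unreindex x) = x"
  by (simp add: reindex_def unreindex_def)

lemma bounded_linear_reindex: "bounded_linear (reindex :: real ^ 'n \<Rightarrow> _)"
  unfolding linear_conv_bounded_linear[symmetric]
  by (intro linearI) (simp_all add: reindex_def vec_eq_iff)

lemma bounded_linear_unreindex: "bounded_linear (unreindex :: _ \<Rightarrow> real ^ 'n)"
  unfolding linear_conv_bounded_linear[symmetric]
  by (intro linearI) (simp_all add: unreindex_def vec_eq_iff)

lemma measurable_reindex [measurable]: "reindex \<in> borel_measurable borel"
  by (intro borel_measurable_continuous_onI linear_continuous_on bounded_linear_reindex)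

lemma measurable_unreindex [measurable]: "unreindex \<in> borel_measurable borel"
  by (intro borel_measurable_continuous_onI linear_continuous_on bounded_linear_unreindex)

text \<open>Relabelling coordinates maps boxes to boxes with the same side lengths, and the volumes
  of boxes determine Lebesgue measure.\<close>

lemma distr_lborel_reindex: "distr lborel borel (reindex :: real ^ 'n \<Rightarrow> _) = lborel"
proof (rule lborel_eqI[symmetric])
  fix l u :: "real ^ 'n wo_index"
  assume le: "\<And>b. b \<in> Basis \<Longrightarrow> l \<bullet> b \<le> u \<bullet> b"
  have le': "l $ i \<le> u $ i" for i
    using le[of "axis i 1"] by (simp add: cart_eq_inner_axis)
  have [simp]: "reindex -` box l u = box (unreindex l) (unreindex u)"
  proof -
    have "(\<forall>i. P i) \<longleftrightarrow> (\<forall>j::'n. P (WO j))" for P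
      by (metis wo_index.collapse)
    from this[of "\<lambda>i. l $ i < x $ unWO i \<and> x $ unWO i < u $ i" for x]
    show ?thesis
      by (simp add: set_eq_iff mem_box_cart reindex_def unreindex_def)
  qed
  have "emeasure (distr lborel borel (reindex :: real ^ 'n \<Rightarrow> _)) (box l u)
      = emeasure lborel (box (unreindex l) (unreindex u :: real ^ 'n))"
    by (subst emeasure_distr) auto
  also have "\<dots> = ennreal (\<Prod>b\<in>Basis. (unreindex u - unreindex l :: real ^ 'n) \<bullet> b)"
  proof (subst emeasure_lborel_box)
    fix b :: "real ^ 'n" assume "b \<in> Basis"
    then obtain i where "b = axis i 1" by (auto simp: Basis_vec_def)
    then show "unreindex l \<bullet> b \<le> unreindex u \<bullet> b"
      using le'[of "WO i"] by (simp add: inner_axis unreindex_def)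
  qed simp
  also have "(\<Prod>b\<in>Basis. (unreindex u - unreindex l :: real ^ 'n) \<bullet> b) = (\<Prod>i\<in>UNIV. (u - l) $ WO i)"
    using prod_Basis_cart[of "\<lambda>x. x" "unreindex u - unreindex l :: real ^ 'n"]
    by (simp add: unreindex_def)
  also have "\<dots> = (\<Prod>i\<in>UNIV. (u - l) $ i)"
    by (rule prod.reindex_bij_betw[OF bij_WO])
  also have "\<dots> = (\<Prod>b\<in>Basis. (u - l) \<bullet> b)"
    using prod_Basis_cart[of "\<lambda>x. x" "u - l"] by simp
  finally show "emeasure (distr lborel borel (reindex :: real ^ 'n \<Rightarrow> _)) (box l u)
    = ennreal (\<Prod>b\<in>Basis. (u - l) \<bullet> b)" .
qed simp

text \<open>Conjugation with \<open>WO\<close> is a bijection between the permutations of the two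
  index types that preserves signs, so the Leibniz expansions agree term by term.\<close>

lemma det_reindex:
  fixes A :: "real ^ 'n ^ 'n"
  shows "det (\<chi> i j. A $ unWO i $ unWO j) = det A"
proof -
  have inv: "inv_into UNIV (WO :: 'n \<Rightarrow> _) = unWO"
    by (rule inv_equality) simp_all
  have mp: "map_permutation UNIV (WO :: 'n \<Rightarrow> _) p = WO \<circ> p \<circ> unWO" for p
    using bij_WO by (auto simp: map_permutation_def inv restrict_id_def bij_def fun_eq_iff)
 have bij: "bij_betw (map_permutation UNIV (WO :: 'n \<Rightarrow> _))
      {p. p permutes UNIV} {p. p permutes UNIV}"
  proof (rule bij_betw_byWitness[where f' = "\<lambda>q. unWO \<circ> q \<circ> WO"])
    show "map_permutation UNIV WO ` {p. p permutes (UNIV :: 'n set)} \<subseteq> {p. p permutes UNIV}"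
      using map_permutation_permutes[OF bij_WO] by auto
    show "(\<lambda>q. unWO \<circ> q \<circ> WO) ` {p. p permutes UNIV} \<subseteq> {p. p permutes (UNIV :: 'n set)}"
      using permutes_bij bij_WO bij_unWO by (auto intro!: bij_imp_permutes bij_comp)
  qed (auto simp: mp fun_eq_iff)
  have "det (\<chi> i j. A $ unWO i $ unWO j)
      = (\<Sum>p\<in>{p. p permutes UNIV}. of_int (sign p) * (\<Prod>i\<in>UNIV. A $ unWO i $ unWO (p i)))"
    by (simp add: det_def)
  also have "\<dots> = (\<Sum>p\<in>{p. p permutes (UNIV :: 'n set)}. of_int (sign p) * (\<Prod>i\<in>UNIV. A $ i $ p i))"
  proof (subst sum.reindex_bij_betw[OF bij, symmetric], rule sum.cong[OF refl])
    fix p assume "p \<in> {p. p permutes (UNIV :: 'n set)}"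
    then have p: "p permutes UNIV" by simp
    have "(\<Prod>i\<in>UNIV. A $ unWO i $ unWO (map_permutation UNIV WO p i)) = (\<Prod>i\<in>UNIV. A $ i $ p i)"
      by (subst prod.reindex_bij_betw[OF bij_WO, symmetric]) (simp add: mp)
    moreover have "sign (map_permutation UNIV (WO :: 'n \<Rightarrow> _) p) = sign p"
      by (rule sign_map_permutation[OF _ p]) (use bij_WO bij_def in auto)
    ultimately show "of_int (sign (map_permutation UNIV WO p)) *
       (\<Prod>i\<in>UNIV. A $ unWO i $ unWO (map_permutation UNIV WO p i)) =
       of_int (sign p) * (\<Prod>i\<in>UNIV. A $ i $ p i)" by simp
  qed
  finally show ?thesis by (simp add: det_def)
qed

lemma lborel_change_of_variables_wo:
  fixes T :: "real ^ 'n :: {finite, wellorder} \<Rightarrow> real ^ 'n :: _" and f :: "real ^ 'n :: _ \<Rightarrow> real"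
  assumes der: "\<And>x. (T has_derivative (\<lambda>v. D x *v v)) (at x)"
    and T: "bij T"
    and [measurable]: "f \<in> borel_measurable borel" "(\<lambda>x. det (D x)) \<in> borel_measurable borel"
  shows "has_bochner_integral lborel (\<lambda>x. \<bar>det (D x)\<bar> * f (T x)) I \<longleftrightarrow>
         has_bochner_integral lborel f I"
proof -
  \<comment> \<open>The change of variables for absolutely integrable functions is vector valued; a
    scalar integrand is carried by the only axis of \<open>real ^ 1\<close>, and \<open>key\<close>
    translates between the two notions of integral.\<close>
  let ?e = "axis 1 1 :: real ^ 1"
  have [measurable]: "T \<in> borel_measurable borel"
    by (intro borel_measurable_continuous_onI continuous_at_imp_continuous_on ballI
        has_derivative_continuous[OF der])
  have key: "(g absolutely_integrable_on UNIV \<and> integral UNIV g = c *\<^sub>R ?e) \<longleftrightarrow>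
     has_bochner_integral lborel h c"
    if [measurable]: "h \<in> borel_measurable borel" and g: "g = (\<lambda>x. h x *\<^sub>R ?e)"
    for g :: "real ^ 'n :: _ \<Rightarrow> real ^ 1" and h c
  proof -
    have [simp]: "(\<lambda>v. v $ 1) \<circ> g = h"
      by (simp add: fun_eq_iff g axis_def)
    have 1: "g absolutely_integrable_on UNIV \<longleftrightarrow> integrable lborel h"
    proof
      assume "g absolutely_integrable_on UNIV"
      from absolutely_integrable_linear[OF this bounded_linear_vec_nth[of 1]]
      show "integrable lborel h"
        by (simp add: set_integrable_def integrable_completion)
    next
      assume "integrable lborel h"
      then have "h absolutely_integrable_on UNIV"
        by (simp add: set_integrable_def integrable_completion)
      from absolutely_integrable_linear[OF this bounded_linear_scaleR_left[of ?e]]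
      show "g absolutely_integrable_on UNIV" by (simp add: g o_def)
    qed
    have 2: "integral UNIV g = integral\<^sup>L lborel h *\<^sub>R ?e" if "integrable lborel h"
    proof -
      have "(h has_integral integral\<^sup>L lborel h) UNIV"
        using has_integral_integral_lborel[OF that] .
      from has_integral_linear[OF this bounded_linear_scaleR_left[of ?e]]
      show ?thesis by (simp add: g o_def integral_unique)
    qed
    have "a *\<^sub>R ?e = b *\<^sub>R ?e \<longleftrightarrow> a = b" for a b
      by (simp add: axis_def vec_eq_iff)
    with 1 2 show ?thesis
      by (auto simp: has_bochner_integral_iff)
  qed
  have "(\<lambda>x. \<bar>det (matrix ((*v) (D x)))\<bar> *\<^sub>R (f (T x) *\<^sub>R ?e)) absolutely_integrable_on UNIV \<and>
      integral UNIV (\<lambda>x. \<bar>det (matrix ((*v) (D x)))\<bar> *\<^sub>R (f (T x) *\<^sub>R ?e)) = I *\<^sub>R ?e \<longleftrightarrow>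
      (\<lambda>x. f x *\<^sub>R ?e) absolutely_integrable_on (T ` UNIV) \<and>
      integral (T ` UNIV) (\<lambda>x. f x *\<^sub>R ?e) = I *\<^sub>R ?e"
    using der T by (intro has_absolute_integral_change_of_variables) (auto simp: bij_def)
  moreover have "T ` UNIV = UNIV" using T by (simp add: bij_def)
  ultimately show ?thesis
    using key[where h = "\<lambda>x. \<bar>det (D x)\<bar> * f (T x)" and c = I, OF _ refl]
      key[where h = f and c = I, OF _ refl]
    by simp
qed

lemma has_bochner_integral_distr_iff:
  fixes f :: "'b \<Rightarrow> real"
  assumes [measurable]: "g \<in> measurable M N" "f \<in> borel_measurable N"
  shows "has_bochner_integral (distr M N g) f I \<longleftrightarrow> has_bochner_integral M (\<lambda>x. f (g x)) I"
  by (simp add: has_bochner_integral_iff integrable_distr_eq integral_distr)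

text \<open>Conjugating \<open>T\<close> with \<open>reindex\<close> alters neither Lebesgue measure
  nor the Jacobian determinant. The equivalence transports integrability together with the
  value.\<close>

theorem lborel_change_of_variables:
  fixes T :: "real ^ 'n \<Rightarrow> real ^ 'n" and f :: "real ^ 'n \<Rightarrow> real"
  assumes der: "\<And>x. (T has_derivative (\<lambda>v. D x *v v)) (at x)"
    and T: "bij T"
    and [measurable]: "f \<in> borel_measurable borel" "(\<lambda>x. det (D x)) \<in> borel_measurable borel"
  shows "has_bochner_integral lborel (\<lambda>x. \<bar>det (D x)\<bar> * f (T x)) I \<longleftrightarrow>
         has_bochner_integral lborel f I"
proof -
  have [measurable]: "T \<in> borel_measurable borel"
    by (intro borel_measurable_continuous_onI continuous_at_imp_continuous_on ballI
        has_derivative_continuous[OF der])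
  let ?T = "\<lambda>x. reindex (T (unreindex x))"
  let ?D = "\<lambda>x. \<chi> i j. D (unreindex x) $ unWO i $ unWO j"
  have D: "reindex (D (unreindex x) *v unreindex v) = ?D x *v v" for x v :: "real ^ 'n wo_index"
  proof -
    have "(\<Sum>j\<in>UNIV. D (unreindex x) $ unWO i $ unWO j * v $ j)
        = (\<Sum>j\<in>UNIV. D (unreindex x) $ unWO i $ j * v $ WO j)" for i
      by (subst sum.reindex_bij_betw[OF bij_WO, symmetric]) simp
    then show ?thesis
      by (simp add: reindex_def unreindex_def matrix_vector_mult_def vec_eq_iff)
  qed
  have 1: "(?T has_derivative (\<lambda>v. ?D x *v v)) (at x)" for x
  proof -
    have "(?T has_derivative (\<lambda>v. reindex (D (unreindex x) *v unreindex v))) (at x)"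
      by (intro bounded_linear.has_derivative[OF bounded_linear_reindex]
          has_derivative_compose[OF bounded_linear.has_derivative[OF bounded_linear_unreindex has_derivative_ident] der])
    then show ?thesis by (simp add: D)
  qed
  have 2: "bij ?T"
    by (rule bij_betw_byWitness[where f' = "\<lambda>x. reindex (inv T (unreindex x))"])
       (use T in \<open>auto simp: bij_def surj_f_inv_f\<close>)
  have 3: "det (?D x) = det (D (unreindex x))" for x by (rule det_reindex)
  have "has_bochner_integral lborel (\<lambda>x. \<bar>det (D x)\<bar> * f (T x)) I
     \<longleftrightarrow> has_bochner_integral lborel (\<lambda>x. \<bar>det (D (unreindex (reindex x)))\<bar>
             * f (unreindex (?T (reindex x)))) I"
    by simp
  also have "\<dots> \<longleftrightarrow> has_bochner_integral (distr lborel borel reindex)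
        (\<lambda>x. \<bar>det (?D x)\<bar> * f (unreindex (?T x))) I"
    unfolding 3 by (subst has_bochner_integral_distr_iff) simp_all
  also have "\<dots> \<longleftrightarrow> has_bochner_integral lborel (\<lambda>x. f (unreindex x)) I"
    unfolding distr_lborel_reindex
    by (rule lborel_change_of_variables_wo[OF 1 2]) (simp_all add: 3)
  also have "\<dots> \<longleftrightarrow> has_bochner_integral (distr lborel borel reindex) (\<lambda>x. f (unreindex x)) I"
    by (simp add: distr_lborel_reindex)
  also have "\<dots> \<longleftrightarrow> has_bochner_integral lborel f I"
    by (subst has_bochner_integral_distr_iff) simp_all
  finally show ?thesis .
qed

section \<open>Gaussian integrals\<close>

text \<open>The integrand is a product over the coordinates, which reduces the integral to a power
  of the one-dimensional one.\<close>

lemma has_bochner_integral_gaussian: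
  "has_bochner_integral lborel (\<lambda>w :: real ^ 'n. exp (- (w \<bullet> w))) (sqrt pi ^ CARD('n))"
proof -
  have 1: "has_bochner_integral lborel (\<lambda>x::real. exp (- x\<^sup>2)) (sqrt pi)"
    using has_bochner_integral_even_function[OF gaussian_moment_0] by simp
  have 2: "(\<integral>\<^sup>+x. ennreal (exp (- (x::real)\<^sup>2)) \<partial>lborel) = ennreal (sqrt pi)"
    using 1 by (simp add: has_bochner_integral_iff nn_integral_eq_integral)
  have "(\<integral>\<^sup>+w. ennreal (exp (- (w \<bullet> (w :: real ^ 'n)))) \<partial>lborel)
      = (\<integral>\<^sup>+w. (\<Prod>b\<in>(Basis :: (real ^ 'n) set). ennreal (exp (- (w \<bullet> b)\<^sup>2))) \<partial>lborel)"
    by (subst euclidean_inner)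
       (simp add: prod_ennreal exp_sum[symmetric] sum_negf power2_eq_square)
  also have "\<dots> = ennreal (sqrt pi) ^ CARD('n)"
    by (subst nn_integral_lborel_prod) (simp_all add: 2)
  finally show ?thesis
    by (intro has_bochner_integral_nn_integral) (simp_all add: ennreal_power)
qed

section \<open>Gaussian integrals of positive definite quadratic forms\<close>

definition symmetric_posdef :: "real ^ 'n ^ 'n \<Rightarrow> bool" where
  "symmetric_posdef A \<longleftrightarrow> transpose A = A \<and> (\<forall>v. v \<noteq> 0 \<longrightarrow> 0 < v \<bullet> (A *v v))"

lemma inner_transpose_matrix: "x \<bullet> (transpose A *v y) = (A *v x) \<bullet> (y :: real ^ 'n)"
  for A :: "real ^ 'm ^ 'n"
  by (metis dot_lmul_matrix inner_commute vector_transpose_matrix)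

lemma symmetric_matrix_inner:
  fixes A :: "real ^ 'n ^ 'n"
  assumes "transpose A = A"
  shows "x \<bullet> (A *v y) = y \<bullet> (A *v x)"
  by (metis assms dot_lmul_matrix inner_commute transpose_matrix_vector)

text \<open>Gram-Schmidt for the inner product \<open>x \<bullet> (A *v y)\<close>, by induction
  over the finite set of indices already treated.\<close>

lemma exists_orthonormalizing_family:
  fixes A :: "real ^ 'n ^ 'n"
  assumes A: "symmetric_posdef A" and "finite J"
  shows "\<exists>e :: 'n \<Rightarrow> real ^ 'n. \<forall>i\<in>J. \<forall>j\<in>J. e i \<bullet> (A *v e j) = (if i = j then 1 else 0)"
  using \<open>finite J\<close>
proof (induction J rule: finite_induct)
  case empty
  then show ?case by simp
next
  case (insert k J)
  have sym: "x \<bullet> (A *v y) = y \<bullet> (A *v x)" for x y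
    using A symmetric_matrix_inner by (auto simp: symmetric_posdef_def)
  from insert obtain e :: "'n \<Rightarrow> real ^ 'n"
    where e: "\<And>i j. i \<in> J \<Longrightarrow> j \<in> J \<Longrightarrow> e i \<bullet> (A *v e j) = (if i = j then 1 else 0)" by blast
  have "dim (e ` J) \<le> card (e ` J)"
    by (intro dim_le_card') (use insert in simp)
  also have "\<dots> \<le> card J" by (intro card_image_le insert)
  also have "\<dots> < CARD('n)"
    using insert by (intro psubset_card_mono) auto
  finally have "dim (span (e ` J)) < dim (UNIV :: (real ^ 'n) set)" by simp
  then obtain w where w: "w \<notin> span (e ` J)"
    by (metis UNIV_I less_irrefl subsetI dim_subset not_less)
  \<comment> \<open>\<open>w\<close> minus its projection onto the span for the form given by
    \<open>A\<close>; it is nonzero since \<open>w\<close> lies outside that span, whose dimension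
    is too small to fill the space.\<close>
  define u where "u = w - (\<Sum>j\<in>J. (w \<bullet> (A *v e j)) *\<^sub>R e j)"
  have "(\<Sum>j\<in>J. (w \<bullet> (A *v e j)) *\<^sub>R e j) \<in> span (e ` J)"
    by (intro span_sum span_scale span_base imageI)
  with w have "u \<noteq> 0" by (auto simp: u_def)
  then have c: "0 < u \<bullet> (A *v u)"
    using A by (auto simp: symmetric_posdef_def)
  have orth: "u \<bullet> (A *v e i) = 0" if "i \<in> J" for i
  proof -
    have "(\<Sum>j\<in>J. (w \<bullet> (A *v e j)) * (e j \<bullet> (A *v e i))) = (\<Sum>j\<in>J. if j = i then w \<bullet> (A *v e i) else 0)"
      by (intro sum.cong) (use that e in auto)
    then show ?thesis
      using that insert by (simp add: u_def inner_diff_left inner_sum_left)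
  qed
  let ?c = "1 / sqrt (u \<bullet> (A *v u))"
  have "(?c *\<^sub>R u) \<bullet> (A *v (?c *\<^sub>R u)) = 1"
    using c by (simp add: matrix_vector_mult_scaleR real_div_sqrt)
  moreover have "(?c *\<^sub>R u) \<bullet> (A *v e i) = 0" "e i \<bullet> (A *v (?c *\<^sub>R u)) = 0" if "i \<in> J" for i
    using orth[OF that] sym[of "e i" u] by (simp_all add: matrix_vector_mult_scaleR)
  ultimately have "\<forall>i\<in>insert k J. \<forall>j\<in>insert k J.
      (e(k := ?c *\<^sub>R u)) i \<bullet> (A *v (e(k := ?c *\<^sub>R u)) j) = (if i = j then 1 else 0)"
    using e insert.hyps by (auto simp del: inner_scaleR_left)
  then show ?case by blast
qed

text \<open>The columns of \<open>E\<close> are a basis that is orthonormal for the form of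
  \<open>A\<close>.\<close>

lemma symmetric_posdef_congruent_mat_1:
  fixes A :: "real ^ 'n ^ 'n"
  assumes A: "symmetric_posdef A"
  obtains E :: "real ^ 'n ^ 'n" where "transpose E ** A ** E = mat 1"
proof -
  obtain e :: "'n \<Rightarrow> real ^ 'n" where e: "\<And>i j. e i \<bullet> (A *v e j) = (if i = j then 1 else 0)"
    using exists_orthonormalizing_family[OF A finite, of UNIV] by auto
  let ?E = "\<chi> i j. e j $ i"
  have col: "?E *v axis j 1 = e j" for j
    by (simp add: matrix_vector_mult_basis column_def vec_eq_iff)
  have "(transpose ?E ** A ** ?E) $ i $ j = mat 1 $ i $ j" for i j
  proof -
    have "(transpose ?E ** A ** ?E) $ i $ j = axis i 1 \<bullet> ((transpose ?E ** A ** ?E) *v axis j 1)"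
      by (simp add: inner_axis' matrix_vector_mult_basis column_def)
    also have "\<dots> = (?E *v axis i 1) \<bullet> (A *v (?E *v axis j 1))"
      by (simp only: matrix_vector_mul_assoc[symmetric] inner_transpose_matrix)
    finally show ?thesis by (simp add: col e mat_def)
  qed
  then show ?thesis using that[of ?E] by (simp add: vec_eq_iff)
qed

text \<open>The substitution \<open>w = E *v x\<close> turns the form into
  \<open>x \<bullet> x\<close>. Taking determinants in \<open>transpose E ** A ** E = mat 1\<close>
  gives \<open>det A = 1 / (det E)\<^sup>2\<close>, which yields both the positivity of
  \<open>det A\<close> and the Jacobian factor.\<close>

theorem gaussian_integral_posdef:
  fixes A :: "real ^ 'n ^ 'n"
  assumes A: "symmetric_posdef A"
  shows "0 < det A"
    and "has_bochner_integral lborel (\<lambda>w. exp (- (w \<bullet> (A *v w)))) (sqrt (pi ^ CARD('n) / det A))"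
proof -
  obtain E :: "real ^ 'n ^ 'n" where E: "transpose E ** A ** E = mat 1"
    using symmetric_posdef_congruent_mat_1[OF A] by blast
  then have d: "det E * det A * det E = 1"
    by (metis det_I det_mul det_transpose)
  then have "det E \<noteq> 0" by auto
  with d have 1: "det A = 1 / (det E)\<^sup>2" "det E \<noteq> 0"
    by (simp_all add: eq_divide_eq power2_eq_square mult_ac)
  then show pos: "0 < det A" by simp
  have bij: "bij ((*v) E)"
  proof -
    have "inj ((*v) E)"
      using 1 det_nz_iff_inj[of "(*v) E"] by simp
    then show ?thesis
      by (simp add: bij_def linear_injective_imp_surjective)
  qed
  have q: "(E *v x) \<bullet> (A *v (E *v x)) = x \<bullet> x" for x
  proof -
    have "(E *v x) \<bullet> (A *v (E *v x)) = x \<bullet> ((transpose E ** A ** E) *v x)"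
      by (simp only: matrix_vector_mul_assoc[symmetric] inner_transpose_matrix)
    then show ?thesis by (simp add: E)
  qed
  have "has_bochner_integral lborel (\<lambda>x :: real ^ 'n. \<bar>det E\<bar> * exp (- (x \<bullet> x))) (\<bar>det E\<bar> * sqrt pi ^ CARD('n))"
    by (intro has_bochner_integral_mult_right has_bochner_integral_gaussian)
  then have "has_bochner_integral lborel (\<lambda>x. \<bar>det E\<bar> * exp (- ((E *v x) \<bullet> (A *v (E *v x)))))
      (\<bar>det E\<bar> * sqrt pi ^ CARD('n))"
    by (simp add: q)
  moreover have "\<bar>det E\<bar> * sqrt pi ^ CARD('n) = sqrt (pi ^ CARD('n) / det A)"
    using 1 by (simp add: real_sqrt_mult real_sqrt_power[of pi])
  ultimately show "has_bochner_integral lborel (\<lambda>w. exp (- (w \<bullet> (A *v w)))) (sqrt (pi ^ CARD('n) / det A))"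
    using lborel_change_of_variables[of "(*v) E" "\<lambda>_. E" "\<lambda>w. exp (- (w \<bullet> (A *v w)))"] bij
    by (simp add: bounded_linear_imp_has_derivative matrix_vector_mul_bounded_linear
      borel_measurable_continuous_onI continuous_intros matrix_vector_mult_linear_continuous_on)
qed

lemma symmetric_posdef_scaleR_mat_1: "0 < s \<Longrightarrow> symmetric_posdef (s *\<^sub>R mat 1 :: real ^ 'n ^ 'n)"
  by (simp add: symmetric_posdef_def transpose_mat scaleR_matrix_vector_assoc[symmetric])
     (simp add: transpose_def mat_def vec_eq_iff)

lemma gaussian_integral_scaled:
  fixes s :: real
  assumes "0 < s"
  shows "has_bochner_integral lborel (\<lambda>w :: real ^ 'n. exp (- (s * (w \<bullet> w)))) (sqrt ((pi / s) ^ CARD('n)))"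
proof -
  have "det (s *\<^sub>R mat 1 :: real ^ 'n ^ 'n) = s ^ CARD('n)"
    by (subst det_diagonal) (auto simp: mat_def)
  with gaussian_integral_posdef(2)[OF symmetric_posdef_scaleR_mat_1[OF assms, where 'n = 'n]] show ?thesis
    by (simp add: scaleR_matrix_vector_assoc[symmetric] power_divide)
qed

text \<open>Zooming in at \<open>x\<close>: with \<open>c = sqrt \<epsilon>\<close> a kernel
  concentrated at scale \<open>sqrt \<epsilon>\<close> becomes one of unit scale.\<close>

lemma nn_integral_lborel_affine:
  fixes f :: "'a::euclidean_space \<Rightarrow> ennreal"
  assumes [measurable]: "f \<in> borel_measurable borel" and "0 < c"
  shows "(\<integral>\<^sup>+z. f z \<partial>lborel) = ennreal (c ^ DIM('a)) * (\<integral>\<^sup>+w. f (x + c *\<^sub>R w) \<partial>lborel)"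
  using assms(2)
  by (subst lborel_affine[of c x])
     (simp_all add: nn_integral_density nn_integral_distr nn_integral_cmult)

section \<open>Strongly convex potentials with bounded Hessian\<close>

lemma has_bochner_integral_mono:
  fixes f g :: "'a \<Rightarrow> real"
  assumes "has_bochner_integral N f a" "has_bochner_integral N g b" "\<And>x. f x \<le> g x"
  shows "a \<le> b"
  using assms by (metis has_bochner_integral_iff integral_mono)

locale strongly_convex_potential =
  fixes \<phi> :: "real ^ 'd \<Rightarrow> real" and m M :: real
  assumes C2: "C2 \<phi>"
    and m_pos: "0 < m" and m_le_M: "m \<le> M"
    and hessian_ge: "\<And>y. loewner_le (m *\<^sub>R mat 1) (hessian \<phi> y)"
    and hessian_le: "\<And>y. loewner_le (hessian \<phi> y) (M *\<^sub>R mat 1)"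
begin

abbreviation "T \<equiv> gradient \<phi>"
abbreviation "H \<equiv> hessian \<phi>"

lemma M_pos: "0 < M"
  using m_pos m_le_M by simp

lemma has_derivative_potential [derivative_intros]: "(\<phi> has_derivative (\<lambda>v. v \<bullet> T x)) (at x)"
proof -
  from C2 have "\<phi> differentiable (at x)"
    by (simp add: C2_def differentiable_on_def)
  then obtain f' where f': "(\<phi> has_derivative f') (at x)"
    by (auto simp: differentiable_def)
  \<comment> \<open>The vector representing the functional \<open>f'\<close> is its adjoint applied
    to 1. Since \<open>gradient\<close> is a definite description, uniqueness is shown next to
    existence.\<close>
  have "f' = (\<lambda>v. v \<bullet> adjoint f' 1)"
    using adjoint_works[OF has_derivative_linear[OF f'], of _ 1] by (simp add: fun_eq_iff)
  with f' have g: "GDERIV \<phi> x :> adjoint f' 1"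
    by (simp add: gderiv_def)
  have "D = adjoint f' 1" if "GDERIV \<phi> x :> D" for D
  proof -
    have "(\<lambda>h. h \<bullet> D) = (\<lambda>h. h \<bullet> adjoint f' 1)"
      using that g unfolding gderiv_def by (rule has_derivative_unique)
    then show ?thesis by (simp add: fun_eq_iff vector_eq_ldot)
  qed
  with g have "GDERIV \<phi> x :> T x"
    unfolding gradient_def by (rule theI)
  then show ?thesis by (simp add: gderiv_def)
qed

lemma has_derivative_gradient [derivative_intros]: "(T has_derivative (\<lambda>v. H x *v v)) (at x)"
  using C2 by (simp add: C2_def differentiable_on_def hessian_def jacobian_works)

lemma continuous_hessian: "isCont H x"
  using C2 by (simp add: C2_def continuous_on_eq_continuous_at)

lemma continuous_potential [continuous_intros]: "continuous_on UNIV \<phi>"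
  by (intro continuous_at_imp_continuous_on ballI has_derivative_continuous[OF has_derivative_potential])

lemma continuous_gradient: "continuous_on UNIV T"
  by (intro continuous_at_imp_continuous_on ballI has_derivative_continuous[OF has_derivative_gradient])

lemma measurable_potential [measurable]: "\<phi> \<in> borel_measurable borel"
  by (intro borel_measurable_continuous_onI continuous_potential)

lemma measurable_gradient [measurable]: "T \<in> borel_measurable borel"
  by (intro borel_measurable_continuous_onI continuous_gradient)

lemma hessian_bounds: "m * (v \<bullet> v) \<le> v \<bullet> (H x *v v)" "v \<bullet> (H x *v v) \<le> M * (v \<bullet> v)"
  using hessian_ge[of x] hessian_le[of x]
  by (simp_all add: loewner_le_def scaleR_matrix_vector_assoc[symmetric])

lemma has_real_derivative_potential_line:
  "((\<lambda>t. \<phi> (z + t *\<^sub>R v)) has_real_derivative v \<bullet> T (z + t *\<^sub>R v)) (at t)"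
proof -
  have "((\<lambda>t. z + t *\<^sub>R v) has_derivative (\<lambda>h. h *\<^sub>R v)) (at t)"
    by (auto intro!: derivative_eq_intros)
  from has_derivative_compose[OF this has_derivative_potential] show ?thesis
    by (simp add: has_field_derivative_def mult_commute_abs)
qed

lemma has_real_derivative_gradient_line:
  "((\<lambda>t. u \<bullet> T (z + t *\<^sub>R v)) has_real_derivative u \<bullet> (H (z + t *\<^sub>R v) *v v)) (at t)"
proof -
  have "((\<lambda>t. z + t *\<^sub>R v) has_derivative (\<lambda>h. h *\<^sub>R v)) (at t)"
    by (auto intro!: derivative_eq_intros)
  from has_derivative_inner_right[OF has_derivative_compose[OF this has_derivative_gradient], of u]
  show ?thesis
    by (simp add: has_field_derivative_def mult_commute_abs matrix_vector_mult_scaleR)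
qed

text \<open>Two applications of the mean value theorem, first along \<open>u\<close>, then along
  \<open>v\<close>. The left side is symmetric in \<open>u\<close> and \<open>v\<close>, which is
  the source of the symmetry of the Hessian.\<close>

lemma second_difference:
  assumes "0 < s"
  shows "\<exists>a b. 0 \<le> a \<and> a \<le> s \<and> 0 \<le> b \<and> b \<le> s \<and>
    \<phi> (x + s *\<^sub>R u + s *\<^sub>R v) - \<phi> (x + s *\<^sub>R u) - \<phi> (x + s *\<^sub>R v) + \<phi> x
      = s\<^sup>2 * (u \<bullet> (H (x + a *\<^sub>R u + b *\<^sub>R v) *v v))"
proof -
  let ?g = "\<lambda>t. \<phi> ((x + s *\<^sub>R v) + t *\<^sub>R u) - \<phi> (x + t *\<^sub>R u)"
  have "\<exists>a. 0 < a \<and> a < s \<and> ?g s - ?g 0 =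
      (s - 0) * (u \<bullet> T ((x + s *\<^sub>R v) + a *\<^sub>R u) - u \<bullet> T (x + a *\<^sub>R u))"
    by (intro MVT2 assms DERIV_diff has_real_derivative_potential_line)
  then obtain a where a: "0 < a" "a < s"
    "?g s - ?g 0 = s * (u \<bullet> T ((x + s *\<^sub>R v) + a *\<^sub>R u) - u \<bullet> T (x + a *\<^sub>R u))"
    by auto
  let ?k = "\<lambda>t. u \<bullet> T ((x + a *\<^sub>R u) + t *\<^sub>R v)"
  have "\<exists>b. 0 < b \<and> b < s \<and> ?k s - ?k 0 = (s - 0) * (u \<bullet> (H ((x + a *\<^sub>R u) + b *\<^sub>R v) *v v))"
    by (intro MVT2 assms has_real_derivative_gradient_line)
  then obtain b where b: "0 < b" "b < s" "?k s - ?k 0 = s * (u \<bullet> (H ((x + a *\<^sub>R u) + b *\<^sub>R v) *v v))"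
    by auto
  show ?thesis
    using a b by (intro exI[of _ a] exI[of _ b]) (simp add: power2_eq_square algebra_simps)
qed

text \<open>Schwarz's theorem. Computing the same second difference in both orders gives equal mixed
  entries at two nearby points; both points tend to \<open>x\<close> with the step size, and
  \<open>H\<close> is continuous.\<close>

lemma symmetric_hessian: "transpose (H x) = H x"
proof -
  have "u \<bullet> (H x *v v) = v \<bullet> (H x *v u)" for u v
  proof -
    define s where "s n = inverse (real (Suc n))" for n
    have "\<exists>p q. norm (p - x) \<le> s n * (norm u + norm v) \<and> norm (q - x) \<le> s n * (norm u + norm v) \<and>
        u \<bullet> (H p *v v) = v \<bullet> (H q *v u)" for n
    proof -
      have s: "0 < s n" by (simp add: s_def)
      obtain a b where ab: "0 \<le> a" "a \<le> s n" "0 \<le> b" "b \<le> s n"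
        "\<phi> (x + s n *\<^sub>R u + s n *\<^sub>R v) - \<phi> (x + s n *\<^sub>R u) - \<phi> (x + s n *\<^sub>R v) + \<phi> x
          = (s n)\<^sup>2 * (u \<bullet> (H (x + a *\<^sub>R u + b *\<^sub>R v) *v v))"
        using second_difference[OF s, of x u v] by blast
      obtain c d where cd: "0 \<le> c" "c \<le> s n" "0 \<le> d" "d \<le> s n"
        "\<phi> (x + s n *\<^sub>R v + s n *\<^sub>R u) - \<phi> (x + s n *\<^sub>R v) - \<phi> (x + s n *\<^sub>R u) + \<phi> x
          = (s n)\<^sup>2 * (v \<bullet> (H (x + c *\<^sub>R v + d *\<^sub>R u) *v u))"
        using second_difference[OF s, of x v u] by blast
      have "x + s n *\<^sub>R v + s n *\<^sub>R u = x + s n *\<^sub>R u + s n *\<^sub>R v" by simp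
      then have "\<phi> (x + s n *\<^sub>R v + s n *\<^sub>R u) = \<phi> (x + s n *\<^sub>R u + s n *\<^sub>R v)" by (rule arg_cong)
      with ab(5) cd(5) have "(s n)\<^sup>2 * (u \<bullet> (H (x + a *\<^sub>R u + b *\<^sub>R v) *v v))
          = (s n)\<^sup>2 * (v \<bullet> (H (x + c *\<^sub>R v + d *\<^sub>R u) *v u))" by linarith
      then have eq: "u \<bullet> (H (x + a *\<^sub>R u + b *\<^sub>R v) *v v) = v \<bullet> (H (x + c *\<^sub>R v + d *\<^sub>R u) *v u)"
        using s by simp
      have "norm (a *\<^sub>R u + b *\<^sub>R v) \<le> a * norm u + b * norm v"
        using ab norm_triangle_ineq[of "a *\<^sub>R u" "b *\<^sub>R v"] by simp
      also have "\<dots> \<le> s n * norm u + s n * norm v"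
        by (intro add_mono mult_right_mono ab) simp_all
      finally have 1: "norm (a *\<^sub>R u + b *\<^sub>R v) \<le> s n * (norm u + norm v)"
        by (simp add: distrib_left)
      have "norm (c *\<^sub>R v + d *\<^sub>R u) \<le> c * norm v + d * norm u"
        using cd norm_triangle_ineq[of "c *\<^sub>R v" "d *\<^sub>R u"] by simp
      also have "\<dots> \<le> s n * norm v + s n * norm u"
        by (intro add_mono mult_right_mono cd) simp_all
      finally have 2: "norm (c *\<^sub>R v + d *\<^sub>R u) \<le> s n * (norm u + norm v)"
        by (simp add: distrib_left)
      show ?thesis
        using 1 2 eq
        by (intro exI[of _ "x + a *\<^sub>R u + b *\<^sub>R v"] exI[of _ "x + c *\<^sub>R v + d *\<^sub>R u"])
           (simp add: add.assoc)
    qed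
    then obtain p q where pq: "\<And>n. norm (p n - x) \<le> s n * (norm u + norm v)"
      "\<And>n. norm (q n - x) \<le> s n * (norm u + norm v)" "\<And>n. u \<bullet> (H (p n) *v v) = v \<bullet> (H (q n) *v u)"
      by metis
    have "(\<lambda>n. s n * (norm u + norm v)) \<longlonglongrightarrow> 0 * (norm u + norm v)"
      unfolding s_def by (intro tendsto_intros LIMSEQ_inverse_real_of_nat)
    then have s0: "(\<lambda>n. s n * (norm u + norm v)) \<longlonglongrightarrow> 0" by simp
    have "p \<longlonglongrightarrow> x" "q \<longlonglongrightarrow> x"
      using Lim_null_comparison[OF always_eventually s0, of "\<lambda>n. p n - x"]
        Lim_null_comparison[OF always_eventually s0, of "\<lambda>n. q n - x"] pq LIM_zero_cancel
      by blast+
    then have "(\<lambda>n. u \<bullet> (H (p n) *v v)) \<longlonglongrightarrow> u \<bullet> (H x *v v)"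
      "(\<lambda>n. v \<bullet> (H (q n) *v u)) \<longlonglongrightarrow> v \<bullet> (H x *v u)"
      by (auto intro!: tendsto_intros isCont_tendsto_compose[OF continuous_hessian]
          bounded_linear.tendsto[OF bounded_linear_inner_right]
          simp: matrix_vector_mult_def intro!: tendsto_vec_lambda tendsto_vec_nth)
    then show ?thesis
      using pq(3) LIMSEQ_unique by simp
  qed
  from this[of "axis i 1" "axis j 1" for i j] show ?thesis
    by (simp add: inner_axis' matrix_vector_mult_basis column_def vec_eq_iff transpose_def)
qed

lemma symmetric_posdef_hessian: "symmetric_posdef (H x)"
proof -
  have "0 < v \<bullet> (H x *v v)" if "v \<noteq> 0" for v
  proof -
    have "0 < m * (v \<bullet> v)" using that m_pos by simp
    with hessian_bounds(1)[of v x] show ?thesis by simp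
  qed
  then show ?thesis by (simp add: symmetric_posdef_def symmetric_hessian)
qed

lemma det_hessian_pos: "0 < det (H x)"
  by (rule gaussian_integral_posdef(1)[OF symmetric_posdef_hessian])

text \<open>The Gaussian integral decreases when the quadratic form grows, and here it equals
  \<open>sqrt (pi ^ CARD('d) / det (H x))\<close>; comparison with multiples of the identity
  therefore orders the determinants.\<close>

lemma det_hessian_bounds: "m ^ CARD('d) \<le> det (H x)" "det (H x) \<le> M ^ CARD('d)"
proof -
  let ?d = "CARD('d)"
  note g = gaussian_integral_posdef(2)[OF symmetric_posdef_hessian[of x]]
  have "sqrt (pi ^ ?d / det (H x)) \<le> sqrt ((pi / m) ^ ?d)"
    by (rule has_bochner_integral_mono[OF g gaussian_integral_scaled[OF m_pos]])
       (use hessian_bounds in auto)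
  moreover have "sqrt ((pi / M) ^ ?d) \<le> sqrt (pi ^ ?d / det (H x))"
    by (rule has_bochner_integral_mono[OF gaussian_integral_scaled[OF M_pos] g])
       (use hessian_bounds in auto)
  ultimately have "pi ^ ?d / det (H x) \<le> pi ^ ?d / m ^ ?d" "pi ^ ?d / M ^ ?d \<le> pi ^ ?d / det (H x)"
    by (simp_all add: power_divide)
  then show "m ^ ?d \<le> det (H x)" "det (H x) \<le> M ^ ?d"
    using det_hessian_pos[of x] m_pos M_pos by (simp_all add: field_simps)
qed

lemma measurable_det_hessian [measurable]: "(\<lambda>x. det (H x)) \<in> borel_measurable borel"
proof -
  have "continuous_on UNIV H" using C2 by (simp add: C2_def)
  then show ?thesis
    unfolding det_def by (intro borel_measurable_continuous_onI continuous_intros)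
qed

section \<open>Bregman divergence and its behaviour near the diagonal\<close>

definition bregman :: "real ^ 'd \<Rightarrow> real ^ 'd \<Rightarrow> real" where
  "bregman x z = \<phi> x - \<phi> z - (x - z) \<bullet> T z"

text \<open>Taylor's formula with Lagrange remainder on the segment from \<open>z\<close> to
  \<open>x\<close>. The intermediate point is located relative to both ends, because later limits
  keep either the first or the second argument fixed.\<close>

lemma bregman_Taylor:
  "\<exists>\<xi>. norm (\<xi> - z) \<le> norm (x - z) \<and> norm (\<xi> - x) \<le> norm (x - z) \<and>
    bregman x z = (x - z) \<bullet> (H \<xi> *v (x - z)) / 2"
proof -
  let ?v = "x - z"
  let ?diff = "\<lambda>k::nat. if k = 0 then (\<lambda>t. \<phi> (z + t *\<^sub>R ?v)) else
    if k = 1 then (\<lambda>t. ?v \<bullet> T (z + t *\<^sub>R ?v)) else (\<lambda>t. ?v \<bullet> (H (z + t *\<^sub>R ?v) *v ?v))"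
  have "\<exists>t. 0 < t \<and> t \<le> 1 \<and> \<phi> (z + 1 *\<^sub>R ?v) =
     (\<Sum>k<2. ?diff k 0 / fact k * 1 ^ k) + ?diff 2 t / fact 2 * 1 ^ 2"
  proof (rule Maclaurin2)
    show "\<forall>k t. k < 2 \<and> 0 \<le> t \<and> t \<le> 1 \<longrightarrow> (?diff k has_real_derivative ?diff (Suc k) t) (at t)"
      using has_real_derivative_potential_line has_real_derivative_gradient_line
      by (auto simp: less_2_cases_iff)
  qed simp_all
  then obtain t where t: "0 < t" "t \<le> 1"
    "\<phi> x = \<phi> z + ?v \<bullet> T z + ?v \<bullet> (H (z + t *\<^sub>R ?v) *v ?v) / 2"
    by (auto simp: numeral_2_eq_2)
  have "norm (t *\<^sub>R ?v) \<le> norm ?v"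
    using t by (simp add: mult_left_le_one_le)
  moreover have "z + t *\<^sub>R ?v - x = (1 - t) *\<^sub>R (z - x)"
    by (simp add: algebra_simps)
  then have "norm (z + t *\<^sub>R ?v - x) \<le> norm ?v"
    using t by (simp add: mult_left_le_one_le norm_minus_commute)
  ultimately show ?thesis
    using t(3) by (intro exI[of _ "z + t *\<^sub>R ?v"]) (simp add: bregman_def)
qed

lemma bregman_bounds:
  "m / 2 * (norm (x - z))\<^sup>2 \<le> bregman x z" "bregman x z \<le> M / 2 * (norm (x - z))\<^sup>2"
proof -
  obtain \<xi> where "bregman x z = (x - z) \<bullet> (H \<xi> *v (x - z)) / 2"
    using bregman_Taylor by blast
  then show "m / 2 * (norm (x - z))\<^sup>2 \<le> bregman x z" "bregman x z \<le> M / 2 * (norm (x - z))\<^sup>2"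
    using hessian_bounds[of "x - z" \<xi>] by (simp_all add: power2_norm_eq_inner)
qed

lemma bregman_nonneg: "0 \<le> bregman x z"
  using bregman_bounds(1)[of x z] m_pos by (smt (verit) zero_le_mult_iff zero_le_power2 divide_nonneg_pos)

lemma bregman_add: "bregman x z + bregman z x = (x - z) \<bullet> (T x - T z)"
  by (simp add: bregman_def algebra_simps)

lemma measurable_bregman [measurable]:
  "(\<lambda>p. bregman (fst p) (snd p)) \<in> borel_measurable borel"
proof -
  have "continuous_on UNIV (\<lambda>p. bregman (fst p) (snd p))"
    unfolding bregman_def
    by (intro continuous_intros continuous_on_compose2[OF continuous_potential]
        continuous_on_compose2[OF continuous_gradient]) auto
  then show ?thesis by (rule borel_measurable_continuous_onI)
qed

lemma tendsto_hessian_form: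
  assumes "p \<longlonglongrightarrow> x"
  shows "(\<lambda>n. w \<bullet> (H (p n) *v w)) \<longlonglongrightarrow> w \<bullet> (H x *v w)"
  using isCont_tendsto_compose[OF continuous_hessian assms]
  by (auto intro!: tendsto_intros simp: matrix_vector_mult_def)

text \<open>At distance \<open>sqrt (e n) * norm w\<close> the remainder in
  \<open>bregman_Taylor\<close> is \<open>e n / 2\<close> times the Hessian form at an intermediate
  point; the factor 2 and the division by \<open>e n\<close> leave exactly that form, and the point
  tends to \<open>x\<close>.\<close>

lemma tendsto_bregman_rescaled:
  fixes e :: "nat \<Rightarrow> real"
  assumes e: "\<And>n. 0 < e n" "e \<longlonglongrightarrow> 0"
  shows "(\<lambda>n. 2 * bregman x (x + sqrt (e n) *\<^sub>R w) / e n) \<longlonglongrightarrow> w \<bullet> (H x *v w)" (is ?thesis1)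
    and "(\<lambda>n. 2 * bregman (x + sqrt (e n) *\<^sub>R w) x / e n) \<longlonglongrightarrow> w \<bullet> (H x *v w)" (is ?thesis2)
proof -
  have "(\<lambda>n. sqrt (e n) * norm w) \<longlonglongrightarrow> sqrt 0 * norm w"
    by (intro tendsto_intros e)
  then have s0: "(\<lambda>n. sqrt (e n) * norm w) \<longlonglongrightarrow> 0" by simp
  have to_x: "p \<longlonglongrightarrow> x" if "\<And>n. norm (p n - x) \<le> sqrt (e n) * norm w" for p
    using Lim_null_comparison[OF always_eventually s0, of "\<lambda>n. p n - x"] that LIM_zero_cancel by blast
  have pos: "0 \<le> e n" "0 < e n" for n using e(1)[of n] by simp_all
  have sq: "sqrt (e n) * (sqrt (e n) * a) / e n = a" for n a
    using pos[of n] by (simp add: mult.assoc[symmetric])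
  have "\<exists>\<xi>. norm (\<xi> - x) \<le> sqrt (e n) * norm w \<and>
      2 * bregman x (x + sqrt (e n) *\<^sub>R w) / e n = w \<bullet> (H \<xi> *v w)" for n
  proof -
    obtain \<xi> where \<xi>: "norm (\<xi> - x) \<le> sqrt (e n) * norm w"
      "bregman x (x + sqrt (e n) *\<^sub>R w) * 2 = sqrt (e n) * (sqrt (e n) * (w \<bullet> (H \<xi> *v w)))"
      using bregman_Taylor[of "x + sqrt (e n) *\<^sub>R w" x] pos[of n]
      by (auto simp: matrix_vector_mult_scaleR linear_neg[OF matrix_vector_mul_linear])
    show ?thesis
      by (intro exI[of _ \<xi>] conjI \<xi>(1)) (subst mult.commute, simp only: \<xi>(2) sq)
  qed
  then obtain p where p: "\<And>n. norm (p n - x) \<le> sqrt (e n) * norm w"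
      "\<And>n. 2 * bregman x (x + sqrt (e n) *\<^sub>R w) / e n = w \<bullet> (H (p n) *v w)" by metis
  show ?thesis1
    unfolding p(2) by (rule tendsto_hessian_form[OF to_x[OF p(1)]])
  have "\<exists>\<xi>. norm (\<xi> - x) \<le> sqrt (e n) * norm w \<and>
      2 * bregman (x + sqrt (e n) *\<^sub>R w) x / e n = w \<bullet> (H \<xi> *v w)" for n
  proof -
    obtain \<xi> where \<xi>: "norm (\<xi> - x) \<le> sqrt (e n) * norm w"
      "bregman (x + sqrt (e n) *\<^sub>R w) x * 2 = sqrt (e n) * (sqrt (e n) * (w \<bullet> (H \<xi> *v w)))"
      using bregman_Taylor[of x "x + sqrt (e n) *\<^sub>R w"] pos[of n]
      by (auto simp: matrix_vector_mult_scaleR)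
    show ?thesis
      by (intro exI[of _ \<xi>] conjI \<xi>(1)) (subst mult.commute, simp only: \<xi>(2) sq)
  qed
  then obtain p where p: "\<And>n. norm (p n - x) \<le> sqrt (e n) * norm w"
      "\<And>n. 2 * bregman (x + sqrt (e n) *\<^sub>R w) x / e n = w \<bullet> (H (p n) *v w)" by metis
  show ?thesis2
    unfolding p(2) by (rule tendsto_hessian_form[OF to_x[OF p(1)]])
qed

section \<open>The gradient as a bijection\<close>

lemma gradient_strongly_monotone: "m * (norm (x - z))\<^sup>2 \<le> (x - z) \<bullet> (T x - T z)"
  using bregman_bounds(1)[of x z] bregman_bounds(1)[of z x]
  by (simp add: bregman_add[symmetric] norm_minus_commute)

lemma gradient_expanding: "m * norm (x - z) \<le> norm (T x - T z)"
proof (cases "x = z")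
  case False
  have "m * norm (x - z) * norm (x - z) \<le> norm (T x - T z) * norm (x - z)"
    using gradient_strongly_monotone[of x z] norm_cauchy_schwarz[of "x - z" "T x - T z"]
    by (simp add: power2_eq_square mult_ac)
  with False show ?thesis by simp
qed simp

lemma inj_gradient: "inj T"
  using gradient_expanding m_pos by (auto simp: inj_on_def) (smt (verit) mult_pos_pos zero_less_norm_iff eq_iff_diff_eq_0 norm_zero)

text \<open>A minimiser of \<open>\<phi> x - x \<bullet> y\<close> is a critical point, that is, a
  preimage of \<open>y\<close>. Strong convexity makes this function coercive, so its minimum over a
  large ball is global.\<close>

lemma surj_gradient: "surj T"
unfolding surj_def
proof
  fix y
  let ?f = "\<lambda>x. \<phi> x - x \<bullet> y"
  \<comment> \<open>Outside this radius the quadratic lower bound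
    \<open>m / 2 * (norm z)\<^sup>2\<close> absorbs the linear term
    \<open>z \<bullet> (T 0 - y)\<close>, so the value at 0 is not undercut.\<close>
  define R where "R = 2 * norm (T 0 - y) / m"
  have "0 \<le> R" using m_pos by (simp add: R_def)
  have "continuous_on (cball 0 R) ?f"
    by (intro continuous_intros continuous_on_subset[OF continuous_potential]) auto
  then obtain x where x: "x \<in> cball 0 R" "\<And>z. z \<in> cball 0 R \<Longrightarrow> ?f x \<le> ?f z"
    using continuous_attains_inf[of "cball 0 R" ?f] \<open>0 \<le> R\<close> by auto
  have "?f x \<le> ?f z" for z
  proof (cases "z \<in> cball 0 R")
    case False
    then have "R < norm z" by simp
    have "norm (T 0 - y) \<le> m / 2 * norm z"
      using \<open>R < norm z\<close> m_pos by (simp add: R_def field_simps)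
    then have "norm z * norm (T 0 - y) \<le> norm z * (m / 2 * norm z)"
      by (intro mult_left_mono) auto
    moreover have "- (norm z * norm (T 0 - y)) \<le> z \<bullet> (T 0 - y)"
      using Cauchy_Schwarz_ineq2[of z "T 0 - y"] by simp
    moreover have "m / 2 * (norm z)\<^sup>2 \<le> bregman z 0"
      using bregman_bounds(1)[of z 0] by simp
    ultimately have "?f 0 \<le> ?f z"
      by (simp add: bregman_def power2_eq_square algebra_simps)
    with x(2)[of 0] \<open>0 \<le> R\<close> show ?thesis by simp
  qed (use x in auto)
  moreover have "(?f has_derivative (\<lambda>v. v \<bullet> T x - v \<bullet> y)) (at x)"
    by (auto intro!: derivative_eq_intros)
  ultimately have "(\<lambda>v. v \<bullet> T x - v \<bullet> y) = (\<lambda>v. 0)"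
    by (intro has_derivative_local_min) (auto simp: eventually_at_topological)
  then have "T x = y" by (simp add: fun_eq_iff vector_eq_ldot)
  then show "\<exists>x. y = T x" by blast
qed

lemma bij_gradient: "bij T"
  using inj_gradient surj_gradient by (simp add: bij_def)

abbreviation "T' \<equiv> inv T"

lemma inv_gradient [simp]: "T' (T x) = x" "T (T' y) = y"
  using inj_gradient surj_gradient by (simp_all add: surj_f_inv_f)

lemma measurable_inv_gradient [measurable]: "T' \<in> borel_measurable borel"
proof -
  have "(1 / m)-lipschitz_on UNIV T'"
    using gradient_expanding[of "T' x" "T' y" for x y] m_pos
    by (intro lipschitz_onI) (simp_all add: dist_norm field_simps)
  then show ?thesis
    by (intro borel_measurable_continuous_onI lipschitz_on_continuous_on)
qed

end

section \<open>Extended integrals\<close>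

lemma ext_integral_mono_AE:
  assumes "AE x in M. f x \<le> g x"
  shows "ext_integral M f \<le> ext_integral M g"
  unfolding ext_integral_def
  by (intro ereal_minus_mono) (use assms in \<open>auto simp: less_eq_ennreal.rep_eq[symmetric] intro!: nn_integral_mono_AE ennreal_leI\<close>)

lemma ext_integral_cong_AE:
  assumes "AE x in M. f x = g x"
  shows "ext_integral M f = ext_integral M g"
  by (intro antisym ext_integral_mono_AE) (use assms in auto)

lemma ext_integral_integrable:
  assumes "integrable M f"
  shows "ext_integral M f = ereal (integral\<^sup>L M f)"
proof -
  have "(\<integral>\<^sup>+ x. ennreal (f x) \<partial>M) \<noteq> \<infinity>" "(\<integral>\<^sup>+ x. ennreal (- f x) \<partial>M) \<noteq> \<infinity>"
    using assms by (auto simp: real_integrable_def)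
  moreover from this obtain a b where "0 \<le> a" "0 \<le> b" "(\<integral>\<^sup>+ x. ennreal (f x) \<partial>M) = ennreal a"
      "(\<integral>\<^sup>+ x. ennreal (- f x) \<partial>M) = ennreal b"
    by (metis ennreal_cases infinity_ennreal_def)
  ultimately show ?thesis
    using assms by (simp add: ext_integral_def real_lebesgue_integral_def enn2ereal_ennreal)
qed

text \<open>The integrable minorant bounds the negative part, so a failure of integrability can only
  come from the positive part; the difference of two infinities is excluded.\<close>

lemma ext_integral_eq_PInfty:
  assumes [measurable]: "f \<in> borel_measurable M"
    and "integrable M g" "AE x in M. g x \<le> f x" and "\<not> integrable M f"
  shows "ext_integral M f = \<infinity>"
proof -
  have "(\<integral>\<^sup>+ x. ennreal (- f x) \<partial>M) \<le> (\<integral>\<^sup>+ x. ennreal (- g x) \<partial>M)"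
    by (intro nn_integral_mono_AE) (use assms(3) in \<open>auto elim!: eventually_mono intro!: ennreal_leI\<close>)
  moreover have "(\<integral>\<^sup>+ x. ennreal (- g x) \<partial>M) < \<infinity>"
    using assms by (auto simp: real_integrable_def top.not_eq_extremum)
  ultimately have n: "(\<integral>\<^sup>+ x. ennreal (- f x) \<partial>M) < \<infinity>"
    by (rule le_less_trans)
  then have "(\<integral>\<^sup>+ x. ennreal (f x) \<partial>M) = \<infinity>"
    using assms by (auto simp: real_integrable_def)
  moreover from n obtain b where "0 \<le> b" "(\<integral>\<^sup>+ x. ennreal (- f x) \<partial>M) = ennreal b"
    by (cases "\<integral>\<^sup>+ x. ennreal (- f x) \<partial>M") auto
  ultimately show ?thesis
    by (simp add: ext_integral_def enn2ereal_ennreal)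
qed

lemma ext_integral_distr:
  assumes [measurable]: "g \<in> measurable M N" "f \<in> borel_measurable N"
  shows "ext_integral (distr M N g) f = ext_integral M (\<lambda>x. f (g x))"
  by (simp add: ext_integral_def nn_integral_distr)

text \<open>The minorant \<open>l\<close> excludes the difference of two infinities, where
  additivity would break down. If \<open>f\<close> is not integrable, both sides are
  infinite.\<close>

lemma ext_integral_add_scaled:
  fixes f g :: "'a \<Rightarrow> real"
  assumes f [measurable]: "f \<in> borel_measurable M" and l: "integrable M l" "AE x in M. l x \<le> f x"
    and g: "integrable M g" and c: "0 < c"
  shows "ext_integral M (\<lambda>x. c * f x + g x) = ereal c * ext_integral M f + ereal (integral\<^sup>L M g)"
proof (cases "integrable M f")
  case True
  then show ?thesis
    using g by (simp add: ext_integral_integrable)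
next
  case False
  have [measurable]: "g \<in> borel_measurable M" using g by simp
  have "\<not> integrable M (\<lambda>x. c * f x + g x)"
  proof
    assume "integrable M (\<lambda>x. c * f x + g x)"
    from Bochner_Integration.integrable_diff[OF this g] have "integrable M (\<lambda>x. c * f x)" by simp
    with False c show False by simp
  qed
  moreover have "integrable M (\<lambda>x. c * l x + g x)" using l g by simp
  moreover have "AE x in M. c * l x + g x \<le> c * f x + g x"
    using l(2) c by (auto elim: eventually_mono)
  ultimately have "ext_integral M (\<lambda>x. c * f x + g x) = \<infinity>"
    by (intro ext_integral_eq_PInfty[where g = "\<lambda>x. c * l x + g x"]) auto
  moreover have "ext_integral M f = \<infinity>"
    using False l by (intro ext_integral_eq_PInfty[where g = l]) auto
  ultimately show ?thesis using c by simp
qed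

section \<open>Continuity of translations\<close>

text \<open>The embedding \<open>ennreal\<close> cuts negative differences to 0, so only the
  decrease of \<open>f\<close> along the shift is counted. The mass removed by the Metropolis
  minimum has just this form, and it is bounded with a Gaussian weight \<open>k\<close>.\<close>

definition translation_defect :: "('a::euclidean_space \<Rightarrow> real) \<Rightarrow> real \<Rightarrow> ('a \<Rightarrow> real) \<Rightarrow> ennreal" where
  "translation_defect k s f =
     (\<integral>\<^sup>+x. (\<integral>\<^sup>+w. ennreal (f x - f (x + s *\<^sub>R w)) * ennreal (k w) \<partial>lborel) \<partial>lborel)"

lemma nn_integral_lborel_translate:
  fixes f :: "'a::euclidean_space \<Rightarrow> ennreal"
  assumes [measurable]: "f \<in> borel_measurable borel"
  shows "(\<integral>\<^sup>+x. f (x + t) \<partial>lborel) = (\<integral>\<^sup>+x. f x \<partial>lborel)"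
proof -
  have "(\<integral>\<^sup>+x. f (x + t) \<partial>lborel) = (\<integral>\<^sup>+x. f x \<partial>distr lborel borel ((+) t))"
    by (subst nn_integral_distr) (auto simp: add.commute)
  then show ?thesis by (simp add: lborel_distr_plus)
qed

text \<open>Replacing \<open>f\<close> by \<open>g\<close> costs
  \<open>\<bar>f x - g x\<bar>\<close> once at \<open>x\<close> and once at the shifted point;
  translation invariance makes both contributions equal, whence the factor 2.\<close>

lemma translation_defect_perturb:
  fixes f g k :: "'a::euclidean_space \<Rightarrow> real"
  assumes [measurable]: "f \<in> borel_measurable borel" "g \<in> borel_measurable borel" "k \<in> borel_measurable borel"
  shows "translation_defect k s f \<le> translation_defect k s g +
    2 * (\<integral>\<^sup>+x. ennreal \<bar>f x - g x\<bar> \<partial>lborel) * (\<integral>\<^sup>+w. ennreal (k w) \<partial>lborel)"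
proof -
  let ?d = "\<lambda>x. ennreal \<bar>f x - g x\<bar>"
  have "translation_defect k s f \<le> (\<integral>\<^sup>+x. (\<integral>\<^sup>+w. ennreal (g x - g (x + s *\<^sub>R w)) * ennreal (k w)
      + ?d x * ennreal (k w) + ?d (x + s *\<^sub>R w) * ennreal (k w) \<partial>lborel) \<partial>lborel)"
    unfolding translation_defect_def
  proof (intro nn_integral_mono)
    fix x w
    have "ennreal (f x - f (x + s *\<^sub>R w)) \<le>
        ennreal (max 0 (g x - g (x + s *\<^sub>R w)) + \<bar>f x - g x\<bar> + \<bar>f (x + s *\<^sub>R w) - g (x + s *\<^sub>R w)\<bar>)"
      by (rule ennreal_leI) linarith
    also have "\<dots> = ennreal (g x - g (x + s *\<^sub>R w)) + ?d x + ?d (x + s *\<^sub>R w)"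
      by (simp add: ennreal_plus ennreal_neg max_def)
    finally show "ennreal (f x - f (x + s *\<^sub>R w)) * ennreal (k w) \<le>
        ennreal (g x - g (x + s *\<^sub>R w)) * ennreal (k w)
      + ?d x * ennreal (k w) + ?d (x + s *\<^sub>R w) * ennreal (k w)"
      by (simp add: distrib_right[symmetric] mult_right_mono)
  qed
  also have "\<dots> = translation_defect k s g
      + (\<integral>\<^sup>+x. (\<integral>\<^sup>+w. ?d x * ennreal (k w) \<partial>lborel) \<partial>lborel)
      + (\<integral>\<^sup>+x. (\<integral>\<^sup>+w. ?d (x + s *\<^sub>R w) * ennreal (k w) \<partial>lborel) \<partial>lborel)"
    by (simp add: nn_integral_add translation_defect_def)
  \<comment> \<open>For fixed \<open>w\<close> the shift disappears under the integral over
    \<open>x\<close>, so that integral is moved inside.\<close>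
  also have "(\<integral>\<^sup>+x. (\<integral>\<^sup>+w. ?d (x + s *\<^sub>R w) * ennreal (k w) \<partial>lborel) \<partial>lborel)
      = (\<integral>\<^sup>+w. (\<integral>\<^sup>+x. ?d (x + s *\<^sub>R w) * ennreal (k w) \<partial>lborel) \<partial>lborel)"
    by (rule lborel_pair.Fubini') simp
  also have "\<dots> = (\<integral>\<^sup>+w. (\<integral>\<^sup>+x. ?d x \<partial>lborel) * ennreal (k w) \<partial>lborel)"
    using nn_integral_lborel_translate[of ?d] by (simp add: nn_integral_multc)
  also have "\<dots> = (\<integral>\<^sup>+x. ?d x \<partial>lborel) * (\<integral>\<^sup>+w. ennreal (k w) \<partial>lborel)"
    by (simp add: nn_integral_cmult)
  also have "(\<integral>\<^sup>+x. (\<integral>\<^sup>+w. ?d x * ennreal (k w) \<partial>lborel) \<partial>lborel)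
      = (\<integral>\<^sup>+x. ?d x \<partial>lborel) * (\<integral>\<^sup>+w. ennreal (k w) \<partial>lborel)"
    by (simp add: nn_integral_cmult nn_integral_multc)
  finally show ?thesis
    by (simp add: mult_2 distrib_right add.assoc)
qed

lemma translation_defect_cmult:
  assumes "0 \<le> c" and [measurable]: "f \<in> borel_measurable borel" "k \<in> borel_measurable borel"
  shows "translation_defect k s (\<lambda>x. c * f x) = ennreal c * translation_defect k s f"
  using assms(1)
  by (simp add: translation_defect_def nn_integral_cmult[symmetric] right_diff_distrib[symmetric]
      ennreal_mult' mult.assoc)

lemma translation_defect_add:
  assumes [measurable]: "f \<in> borel_measurable borel" "g \<in> borel_measurable borel" "k \<in> borel_measurable borel"
  shows "translation_defect k s (\<lambda>x. f x + g x) \<le> translation_defect k s f + translation_defect k s g"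
proof -
  have "translation_defect k s (\<lambda>x. f x + g x) \<le>
      (\<integral>\<^sup>+x. (\<integral>\<^sup>+w. ennreal (f x - f (x + s *\<^sub>R w)) * ennreal (k w) +
         ennreal (g x - g (x + s *\<^sub>R w)) * ennreal (k w) \<partial>lborel) \<partial>lborel)"
    unfolding translation_defect_def
  proof (intro nn_integral_mono)
    fix x w
    have "ennreal (f x + g x - (f (x + s *\<^sub>R w) + g (x + s *\<^sub>R w))) \<le>
        ennreal (max 0 (f x - f (x + s *\<^sub>R w)) + max 0 (g x - g (x + s *\<^sub>R w)))"
      by (rule ennreal_leI) linarith
    also have "\<dots> = ennreal (f x - f (x + s *\<^sub>R w)) + ennreal (g x - g (x + s *\<^sub>R w))"
      by (simp add: ennreal_plus ennreal_neg max_def)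
    finally show "ennreal (f x + g x - (f (x + s *\<^sub>R w) + g (x + s *\<^sub>R w))) * ennreal (k w) \<le>
        ennreal (f x - f (x + s *\<^sub>R w)) * ennreal (k w) + ennreal (g x - g (x + s *\<^sub>R w)) * ennreal (k w)"
      by (simp add: distrib_right[symmetric] mult_right_mono)
  qed
  also have "\<dots> = translation_defect k s f + translation_defect k s g"
    by (simp add: nn_integral_add translation_defect_def)
  finally show ?thesis .
qed

text \<open>For an open set the defect at a point vanishes as soon as the translated point stays in the set.\<close>

lemma translation_defect_open:
  fixes U :: "'a::euclidean_space set"
  assumes "open U" "emeasure lborel U < \<infinity>"
    and [measurable]: "k \<in> borel_measurable borel" and k: "(\<integral>\<^sup>+w. ennreal (k w) \<partial>lborel) < \<infinity>"
    and s: "s \<longlonglongrightarrow> 0"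
  shows "(\<lambda>n. translation_defect k (s n) (indicator U)) \<longlonglongrightarrow> 0"
proof -
  have [measurable]: "U \<in> sets borel" using assms by simp
  let ?F = "\<lambda>n (x, w). ennreal (indicator U x - indicator U (x + s n *\<^sub>R w)) * ennreal (k w)"
  have "translation_defect k (s n) (indicator U) = integral\<^sup>N (lborel \<Otimes>\<^sub>M lborel) (?F n)" for n
    unfolding translation_defect_def
    by (subst lborel.nn_integral_fst[symmetric]) auto
  moreover have "(\<lambda>n. integral\<^sup>N (lborel \<Otimes>\<^sub>M lborel) (?F n)) \<longlonglongrightarrow> (\<integral>\<^sup>+z. 0 \<partial>(lborel \<Otimes>\<^sub>M lborel :: ('a \<times> 'a) measure))"
  proof (rule nn_integral_dominated_convergence[where u = ?F and u' = "\<lambda>_. 0" and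
        w = "\<lambda>(x, w). indicator U x * ennreal (k w)"])
    have "(\<integral>\<^sup>+z. (case z of (x, w) \<Rightarrow> indicator U x * ennreal (k w)) \<partial>(lborel \<Otimes>\<^sub>M lborel))
        = emeasure lborel U * (\<integral>\<^sup>+w. ennreal (k w) \<partial>lborel)"
      by (subst lborel.nn_integral_fst[symmetric])
         (auto simp: nn_integral_cmult nn_integral_multc)
    then show "(\<integral>\<^sup>+z. (case z of (x, w) \<Rightarrow> indicator U x * ennreal (k w)) \<partial>(lborel \<Otimes>\<^sub>M lborel)) < \<infinity>"
      using assms by (simp add: ennreal_mult_less_top)
    show "AE z in lborel \<Otimes>\<^sub>M lborel. ?F n z \<le> (case z of (x, w) \<Rightarrow> indicator U x * ennreal (k w))" for n
      by (intro AE_I2) (auto simp: indicator_def ennreal_neg)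
    show "AE z in lborel \<Otimes>\<^sub>M lborel. (\<lambda>n. ?F n z) \<longlonglongrightarrow> 0"
    proof (intro AE_I2, clarsimp)
      fix x w
      show "(\<lambda>n. ennreal (indicator U x - indicator U (x + s n *\<^sub>R w)) * ennreal (k w)) \<longlonglongrightarrow> 0"
      proof (cases "x \<in> U")
        case True
        have "(\<lambda>n. x + s n *\<^sub>R w) \<longlonglongrightarrow> x + 0 *\<^sub>R w"
          by (intro tendsto_intros s)
        with True \<open>open U\<close> have "\<forall>\<^sub>F n in sequentially. x + s n *\<^sub>R w \<in> U"
          by (intro topological_tendstoD[where l = x]) auto
        then have "\<forall>\<^sub>F n in sequentially. ennreal (indicator U x - indicator U (x + s n *\<^sub>R w)) * ennreal (k w) = 0"
          by eventually_elim (simp add: True)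
        then show ?thesis by (rule tendsto_eventually)
      qed (simp add: ennreal_neg)
    qed
  qed measurable
  ultimately show ?thesis by simp
qed

lemma tendsto_ennreal_0_le:
  fixes a b :: "nat \<Rightarrow> ennreal"
  assumes "b \<longlonglongrightarrow> 0" "\<And>n. a n \<le> b n"
  shows "a \<longlonglongrightarrow> 0"
  by (rule tendsto_sandwich[of "\<lambda>_. 0" a sequentially b]) (use assms in auto)

lemma tendsto_ennreal_0I:
  fixes a :: "nat \<Rightarrow> ennreal"
  assumes "\<And>r. 0 < r \<Longrightarrow> \<exists>b. b \<longlonglongrightarrow> 0 \<and> (\<forall>n. a n \<le> b n + ennreal r)"
  shows "a \<longlonglongrightarrow> 0"
proof (rule order_tendstoI)
  fix c :: ennreal assume "0 < c"
  then obtain r where r: "0 < r" "ennreal r < c"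
  proof (cases c)
    case (real x)
    with \<open>0 < c\<close> show ?thesis
      by (intro that[of "x / 2"]) (auto simp: ennreal_less_iff)
  next
    case top
    then show ?thesis by (intro that[of 1]) auto
  qed
  then obtain b where b: "b \<longlonglongrightarrow> 0" "\<And>n. a n \<le> b n + ennreal (r / 2)"
    using assms[of "r / 2"] by auto
  have "\<forall>\<^sub>F n in sequentially. b n < ennreal (r / 2)"
    using b(1) r by (intro order_tendstoD(2)) auto
  then show "\<forall>\<^sub>F n in sequentially. a n < c"
  proof eventually_elim
    case (elim n)
    have "a n \<le> ennreal (r / 2) + ennreal (r / 2)"
      using b(2)[of n] elim by (meson add_mono less_imp_le order_refl order_trans)
    also have "\<dots> = ennreal r" using r by (simp add: ennreal_plus[symmetric] del: ennreal_plus)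
    finally show ?case using r by simp
  qed
qed simp

text \<open>By \<open>translation_defect_perturb\<close> an error in L^1 changes the defect by an
  amount independent of the shift, so the functions with vanishing defect are closed under
  approximation in L^1.\<close>

lemma translation_defect_approx:
  fixes f k :: "'a::euclidean_space \<Rightarrow> real"
  assumes [measurable]: "f \<in> borel_measurable borel" "k \<in> borel_measurable borel"
    and k: "(\<integral>\<^sup>+w. ennreal (k w) \<partial>lborel) < \<infinity>"
    and approx: "\<And>r. 0 < r \<Longrightarrow> \<exists>g \<in> borel_measurable borel.
       (\<integral>\<^sup>+x. ennreal \<bar>f x - g x\<bar> \<partial>lborel) \<le> ennreal r \<and> (\<lambda>n. translation_defect k (s n) g) \<longlonglongrightarrow> 0"
  shows "(\<lambda>n. translation_defect k (s n) f) \<longlonglongrightarrow> 0"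
proof (rule tendsto_ennreal_0I)
  fix r :: real assume "0 < r"
  obtain K where K: "0 \<le> K" "(\<integral>\<^sup>+w. ennreal (k w) \<partial>lborel) = ennreal K"
    using k by (metis ennreal_cases infinity_ennreal_def less_irrefl)
  \<comment> \<open>An L^1 error costs \<open>2 * K\<close> times itself in the defect; the added 1
    keeps the quotient defined when \<open>K = 0\<close>.\<close>
  have "0 < r / (2 * (K + 1))" using K \<open>0 < r\<close> by simp
  from approx[OF this] obtain g where [measurable]: "g \<in> borel_measurable borel"
    and g: "(\<integral>\<^sup>+x. ennreal \<bar>f x - g x\<bar> \<partial>lborel) \<le> ennreal (r / (2 * (K + 1)))"
      "(\<lambda>n. translation_defect k (s n) g) \<longlonglongrightarrow> 0" by blast
  have "2 * (\<integral>\<^sup>+x. ennreal \<bar>f x - g x\<bar> \<partial>lborel) * ennreal K \<le> 2 * ennreal (r / (2 * (K + 1))) * ennreal K"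
    by (intro mult_left_mono mult_right_mono g) auto
  also have "\<dots> = ennreal (2 * (r / (2 * (K + 1))) * K)"
    using K \<open>0 < r\<close> by (simp add: ennreal_mult[symmetric] ennreal_numeral[symmetric] del: ennreal_numeral)
  also have "\<dots> \<le> ennreal r"
    using K \<open>0 < r\<close> by (intro ennreal_leI) (simp add: field_simps)
  finally have "translation_defect k (s n) f \<le> translation_defect k (s n) g + ennreal r" for n
    using translation_defect_perturb[of f g k "s n"] unfolding K(2)
    by (meson add_left_mono assms order_trans \<open>g \<in> borel_measurable borel\<close>)
  with g(2) show "\<exists>b. b \<longlonglongrightarrow> 0 \<and> (\<forall>n. translation_defect k (s n) f \<le> b n + ennreal r)" by blast
qed

text \<open>Induction over nonnegative measurable functions. Outer regularity reduces indicators to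
  open sets, where the integrand of the defect vanishes pointwise in the limit, and increasing
  limits converge in L^1.\<close>

theorem translation_defect_tendsto_0:
  fixes f k :: "'a::euclidean_space \<Rightarrow> real"
  assumes f: "integrable lborel f" "\<And>x. 0 \<le> f x"
    and [measurable]: "k \<in> borel_measurable borel" and k: "(\<integral>\<^sup>+w. ennreal (k w) \<partial>lborel) < \<infinity>"
    and s: "s \<longlonglongrightarrow> 0"
  shows "(\<lambda>n. translation_defect k (s n) f) \<longlonglongrightarrow> 0"
proof -
  have "f \<in> borel_measurable lborel" using f by simp
  from this f(2) f(1) show ?thesis
  proof (induction rule: borel_measurable_induct_real)
    case (set A)
    then have [measurable]: "A \<in> sets borel" by simp
    have A: "emeasure lborel A < \<infinity>"
      using set by (simp add: integrable_indicator_iff)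
    show ?case
    proof (rule translation_defect_approx[OF _ _ k])
      fix r :: real assume "0 < r"
      obtain U where U: "open U" "A \<subseteq> U" "emeasure lborel (U - A) < ennreal r"
        using outer_regular_lborel[of A r] \<open>0 < r\<close> by auto
      have "emeasure lborel U = emeasure lborel A + emeasure lborel (U - A)"
        using U by (subst plus_emeasure) (auto intro!: arg_cong[where f = "emeasure lborel"])
      then have "emeasure lborel U < \<infinity>"
        using A order.strict_trans[OF U(3) ennreal_less_top] by (simp add: ennreal_add_less_top)
      then have "(\<lambda>n. translation_defect k (s n) (indicator U)) \<longlonglongrightarrow> 0"
        by (intro translation_defect_open U k s) simp_all
      moreover have "(\<integral>\<^sup>+x. ennreal \<bar>indicator A x - indicator U x\<bar> \<partial>lborel) = (\<integral>\<^sup>+x. indicator (U - A) x \<partial>lborel)"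
        using U by (intro nn_integral_cong) (auto simp: indicator_def)
      ultimately show "\<exists>g\<in>borel_measurable borel.
          (\<integral>\<^sup>+x. ennreal \<bar>indicator A x - g x\<bar> \<partial>lborel) \<le> ennreal r \<and>
          (\<lambda>n. translation_defect k (s n) g) \<longlonglongrightarrow> 0"
        using U by (intro bexI[of _ "indicator U"]) auto
    qed simp_all
  next
    case (mult u c)
    show ?case
    proof (cases "c = 0")
      case False
      with mult have "integrable lborel u" by simp
      then have "(\<lambda>n. ennreal c * translation_defect k (s n) u) \<longlonglongrightarrow> ennreal c * 0"
        using mult by (intro ennreal_tendsto_cmult) auto
      then show ?thesis
        using mult by (simp add: translation_defect_cmult)
    qed (simp add: translation_defect_def)
  next
    case (add u v)
    have "integrable lborel u" "integrable lborel v"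
      using add by (auto intro: Bochner_Integration.integrable_bound[OF add.prems])
    then have "(\<lambda>n. translation_defect k (s n) u + translation_defect k (s n) v) \<longlonglongrightarrow> 0 + 0"
      using add by (intro tendsto_add) auto
    then have lim: "(\<lambda>n. translation_defect k (s n) u + translation_defect k (s n) v) \<longlonglongrightarrow> 0" by simp
    have "translation_defect k (s n) (\<lambda>x. v x + u x) \<le> translation_defect k (s n) u + translation_defect k (s n) v" for n
      using translation_defect_add[of v u k "s n"] add.hyps by (simp add: add.commute)
    with lim show ?case by (rule tendsto_ennreal_0_le)
  next
    case (seq U)
    have le: "U i x \<le> f x" for i x
      using seq(3,4) by (intro incseq_le[of "\<lambda>i. U i x"]) (auto simp: incseq_def le_fun_def)
    have int: "integrable lborel (U i)" for i
      using seq by (intro Bochner_Integration.integrable_bound[OF seq.prems])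
        (auto intro: order_trans[OF le abs_ge_self])
    have [measurable]: "f \<in> borel_measurable borel" using seq.prems by simp
    show ?case
    proof (rule translation_defect_approx[OF _ _ k])
      fix r :: real assume "0 < r"
      have "(\<lambda>i. \<integral>x. U i x \<partial>lborel) \<longlonglongrightarrow> (\<integral>x. f x \<partial>lborel)"
        by (rule integral_dominated_convergence[where w = f]) (use seq le in auto)
      then have "\<forall>\<^sub>F i in sequentially. (\<integral>x. f x \<partial>lborel) - r < (\<integral>x. U i x \<partial>lborel)"
        by (rule order_tendstoD) (use \<open>0 < r\<close> in simp)
      then obtain i where i: "(\<integral>x. f x \<partial>lborel) - r < (\<integral>x. U i x \<partial>lborel)"
        by (metis eventually_happens trivial_limit_sequentially)
      have "(\<integral>\<^sup>+x. ennreal \<bar>f x - U i x\<bar> \<partial>lborel) = ennreal (\<integral>x. \<bar>f x - U i x\<bar> \<partial>lborel)"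
        using seq.prems int by (intro nn_integral_eq_integral) auto
      also have "(\<integral>x. \<bar>f x - U i x\<bar> \<partial>lborel) = (\<integral>x. f x - U i x \<partial>lborel)"
        using le by (intro Bochner_Integration.integral_cong) auto
      also have "ennreal \<dots> \<le> ennreal r"
        using i seq.prems int by (intro ennreal_leI) simp
      finally show "\<exists>g\<in>borel_measurable borel.
          (\<integral>\<^sup>+x. ennreal \<bar>f x - g x\<bar> \<partial>lborel) \<le> ennreal r \<and> (\<lambda>n. translation_defect k (s n) g) \<longlonglongrightarrow> 0"
        using seq int by (intro bexI[of _ "U i"]) auto
    qed simp_all
  qed
qed

section \<open>Relative entropy of couplings\<close>

text \<open>This is \<open>ln a \<le> a - 1\<close> at \<open>a = t * u / p\<close>, multiplied by
  \<open>p\<close>. Summed over terms with a common \<open>u\<close>, the linear parts cancel if the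
  \<open>p\<close> add up to \<open>u\<close> and the \<open>t\<close> to 1.\<close>

lemma mult_ln_ge:
  fixes p t u :: real
  assumes "0 \<le> p" "0 < t" "0 < u"
  shows "p - t * u \<le> p * ln (p / t) - p * ln u"
proof (cases "p = 0")
  case False
  with assms have "0 < p" by simp
  have "ln (t * u / p) \<le> t * u / p - 1"
    using assms \<open>0 < p\<close> by (intro ln_le_minus_one) simp
  then have "p * ln (t * u / p) \<le> p * (t * u / p - 1)"
    using \<open>0 < p\<close> by (intro mult_left_mono) simp_all
  then show ?thesis
    using assms \<open>0 < p\<close> by (simp add: ln_div ln_mult right_diff_distrib distrib_left)
qed (use assms in simp)

text \<open>Convexity of \<open>p * ln p\<close> with weights \<open>1 - s\<close> and
  \<open>s\<close>: the entropy of a sum is split into its parts, and the first part pays only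
  \<open>- ln (1 - s)\<close> per unit mass.\<close>

lemma log_sum_two:
  fixes p q s :: real
  assumes "0 \<le> p" "0 \<le> q" "0 < s" "s < 1"
  shows "(p + q) * ln (p + q) \<le> p * ln (p / (1 - s)) + q * ln (q / s)"
proof (cases "p + q = 0")
  case False
  then have "0 < p + q" using assms by simp
  from mult_ln_ge[OF assms(1) _ this, of "1 - s"] mult_ln_ge[OF assms(2,3) this] show ?thesis
    using assms by (simp add: algebra_simps)
qed (use assms in \<open>simp add: add_nonneg_eq_0_iff\<close>)

text \<open>The easy half of the Donsker-Varadhan formula. With \<open>r\<close> the density of
  \<open>\<gamma>\<close>, the inequality \<open>ln a \<le> a - 1\<close> at
  \<open>a = exp h / r\<close> gives \<open>h + 1 - exp h / r \<le> ln r\<close>, and the quotient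
  has \<open>\<gamma>\<close>-integral at most 1.\<close>

theorem KL_ge_Gibbs:
  assumes R: "prob_space R" and \<gamma>: "prob_space \<gamma>" and sets: "sets \<gamma> = sets R"
    and [measurable]: "h \<in> borel_measurable R"
    and le1: "(\<integral>\<^sup>+x. ennreal (exp (h x)) \<partial>R) \<le> 1"
    and h: "integrable \<gamma> h"
  shows "ereal (integral\<^sup>L \<gamma> h) \<le> KL \<gamma> R"
proof (cases "absolutely_continuous R \<gamma>")
  case True
  interpret R: prob_space R by fact
  interpret \<gamma>: prob_space \<gamma> by fact
  let ?r = "RN_deriv R \<gamma>"
  have dens: "density R ?r = \<gamma>" using True sets by (rule R.density_RN_deriv)
  have fin: "AE x in R. ?r x \<noteq> \<infinity>"
    by (rule R.RN_deriv_finite) (use True sets \<gamma>.sigma_finite_measure_axioms in auto)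
  have AE\<gamma>: "AE x in \<gamma>. P x" if "AE x in R. 0 < ?r x \<longrightarrow> P x" for P
    using that by (subst dens[symmetric], subst AE_density) auto
  have [measurable]: "h \<in> borel_measurable \<gamma>" "?r \<in> borel_measurable \<gamma>"
    using sets by (simp_all cong: measurable_cong_sets)
  let ?e = "\<lambda>x. exp (h x) / enn2real (?r x)"
  have "(\<integral>\<^sup>+x. ennreal (?e x) \<partial>\<gamma>) = (\<integral>\<^sup>+x. ?r x * ennreal (?e x) \<partial>R)"
    by (rule R.RN_deriv_nn_integral) (use True sets in auto)
  \<comment> \<open>Only an inequality: where the density vanishes, the left integrand is 0.\<close>
  also have "\<dots> \<le> (\<integral>\<^sup>+x. ennreal (exp (h x)) \<partial>R)"
  proof (rule nn_integral_mono_AE, use fin in eventually_elim)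
    fix x assume x: "?r x \<noteq> \<infinity>"
    then obtain t where t: "0 \<le> t" "?r x = ennreal t"
      by (cases "?r x") auto
    then have "?r x * ennreal (?e x) = ennreal (t * (exp (h x) / t))"
      by (simp add: ennreal_mult'[symmetric] del: times_divide_eq_right)
    also have "\<dots> \<le> ennreal (exp (h x))" by (intro ennreal_leI) simp
    finally show "?r x * ennreal (?e x) \<le> ennreal (exp (h x))" .
  qed
  finally have e1: "(\<integral>\<^sup>+x. ennreal (?e x) \<partial>\<gamma>) \<le> 1" using le1 by simp
  then have e: "integrable \<gamma> ?e"
    by (intro integrableI_nonneg) (auto intro: le_less_trans)
  then have "ennreal (integral\<^sup>L \<gamma> ?e) \<le> 1"
    using e1 by (subst (asm) nn_integral_eq_integral) auto
  then have "integral\<^sup>L \<gamma> ?e \<le> 1" by simp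
  then have "ereal (integral\<^sup>L \<gamma> h) \<le> ereal (integral\<^sup>L \<gamma> (\<lambda>x. h x + 1 - ?e x))"
    using h e by (simp add: \<gamma>.prob_space)
  also have "\<dots> = ext_integral \<gamma> (\<lambda>x. h x + 1 - ?e x)"
    using h e by (intro ext_integral_integrable[symmetric]) simp
  also have "\<dots> \<le> ext_integral \<gamma> (\<lambda>x. ln (enn2real (?r x)))"
  proof (intro ext_integral_mono_AE AE\<gamma>, use fin in eventually_elim, intro impI)
    fix x assume "?r x \<noteq> \<infinity>" "0 < ?r x"
    then have pos: "0 < enn2real (?r x)"
      by (simp add: enn2real_positive_iff top.not_eq_extremum)
    then have "ln (?e x) \<le> ?e x - 1" by (intro ln_le_minus_one) simp
    then show "h x + 1 - ?e x \<le> ln (enn2real (?r x))"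
      using pos by (simp add: ln_div)
  qed
  finally show ?thesis using True sets by (simp add: KL_def)
qed (simp add: KL_def)

text \<open>An integrable majorant of \<open>r * ln r\<close> under \<open>R\<close> is enough,
  since \<open>ext_integral\<close> is monotone: where the density is positive its logarithm is at
  most \<open>B / r\<close>, which has a finite integral.\<close>

lemma KL_density_le:
  assumes R: "prob_space R" and [measurable]: "r \<in> borel_measurable R" and r: "\<And>x. 0 \<le> r x"
    and B: "integrable R B" and le: "AE x in R. r x * ln (r x) \<le> B x"
  shows "KL (density R (\<lambda>x. ennreal (r x))) R \<le> ereal (integral\<^sup>L R B)"
proof -
  interpret R: prob_space R by fact
  let ?\<gamma> = "density R (\<lambda>x. ennreal (r x))"
  have [measurable]: "B \<in> borel_measurable R" using B by simp
  have "AE x in R. ennreal (r x) = RN_deriv R ?\<gamma> x"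
    by (rule R.RN_deriv_unique) simp_all
  then have "AE x in ?\<gamma>. ln (enn2real (RN_deriv R ?\<gamma> x)) \<le> B x / r x"
    using le
  proof (subst AE_density, simp, eventually_elim, intro impI)
    fix x assume "ennreal (r x) = RN_deriv R ?\<gamma> x" "r x * ln (r x) \<le> B x" "0 < ennreal (r x)"
    then show "ln (enn2real (RN_deriv R ?\<gamma> x)) \<le> B x / r x"
      using r[of x] by (simp add: field_simps flip: \<open>ennreal (r x) = RN_deriv R ?\<gamma> x\<close>)
  qed
  then have "KL ?\<gamma> R \<le> ext_integral ?\<gamma> (\<lambda>x. B x / r x)"
    by (simp add: KL_def absolutely_continuousI_density ext_integral_mono_AE)
  also have int: "integrable R (\<lambda>x. r x * (B x / r x))"
    by (rule Bochner_Integration.integrable_bound[OF B]) auto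
  then have "ext_integral ?\<gamma> (\<lambda>x. B x / r x) = ereal (integral\<^sup>L R (\<lambda>x. r x * (B x / r x)))"
    using r by (subst ext_integral_integrable) (simp_all add: integrable_density integral_density)
  also have "\<dots> \<le> ereal (integral\<^sup>L R B)"
  proof -
    \<comment> \<open>Where \<open>r\<close> vanishes the left side is 0, and there the hypothesis
      reads \<open>0 \<le> B x\<close>.\<close>
    have "AE x in R. r x * (B x / r x) \<le> B x"
      using le by eventually_elim auto
    with int B show ?thesis by (simp add: integral_mono_AE)
  qed
  finally show ?thesis .
qed

section \<open>Completing a symmetric subkernel to a coupling\<close>

lemma (in sigma_finite_measure) symmetric_density_marginals:
  assumes [measurable]: "r \<in> borel_measurable (M \<Otimes>\<^sub>M M)" "k \<in> borel_measurable M"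
    and sym: "\<And>x y. r (x, y) = r (y, x)"
    and k: "AE x in M. (\<integral>\<^sup>+y. r (x, y) \<partial>M) = k x"
  shows "distr (density (M \<Otimes>\<^sub>M M) r) M fst = density M k"
    and "distr (density (M \<Otimes>\<^sub>M M) r) M snd = density M k"
proof -
  interpret P: pair_sigma_finite M M ..
  have *: "(\<integral>\<^sup>+x. (\<integral>\<^sup>+y. r (x, y) * indicator A x \<partial>M) \<partial>M) = emeasure (density M k) A"
    if [measurable]: "A \<in> sets M" for A
    unfolding emeasure_density[OF assms(2) that]
    using k by (intro nn_integral_cong_AE) (auto simp: nn_integral_multc elim!: eventually_mono)
  have "emeasure (distr (density (M \<Otimes>\<^sub>M M) r) M fst) A = emeasure (density M k) A"
    if [measurable]: "A \<in> sets M" for A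
  proof -
    have "emeasure (distr (density (M \<Otimes>\<^sub>M M) r) M fst) A
        = (\<integral>\<^sup>+z. r z * indicator A (fst z) \<partial>(M \<Otimes>\<^sub>M M))"
      by (simp add: emeasure_distr emeasure_density space_pair_measure)
         (intro nn_integral_cong, auto simp: indicator_def space_pair_measure)
    also have "\<dots> = (\<integral>\<^sup>+x. (\<integral>\<^sup>+y. r (x, y) * indicator A x \<partial>M) \<partial>M)"
      by (subst nn_integral_fst[symmetric]) simp_all
    finally show ?thesis using * by simp
  qed
  then show "distr (density (M \<Otimes>\<^sub>M M) r) M fst = density M k"
    by (intro measure_eqI) simp_all
  have "emeasure (distr (density (M \<Otimes>\<^sub>M M) r) M snd) A = emeasure (density M k) A"
    if [measurable]: "A \<in> sets M" for A
  proof -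
    have "emeasure (distr (density (M \<Otimes>\<^sub>M M) r) M snd) A
        = (\<integral>\<^sup>+z. r z * indicator A (snd z) \<partial>(M \<Otimes>\<^sub>M M))"
      by (simp add: emeasure_distr emeasure_density space_pair_measure)
         (intro nn_integral_cong, auto simp: indicator_def space_pair_measure)
    also have "\<dots> = (\<integral>\<^sup>+y. (\<integral>\<^sup>+x. r (x, y) * indicator A y \<partial>M) \<partial>M)"
      by (subst P.nn_integral_snd[symmetric]) simp_all
    also have "\<dots> = (\<integral>\<^sup>+x. (\<integral>\<^sup>+y. r (x, y) * indicator A x \<partial>M) \<partial>M)"
      by (intro nn_integral_cong arg_cong2[where f = "(*)"] sym refl)
    finally show ?thesis using * by simp
  qed
  then show "distr (density (M \<Otimes>\<^sub>M M) r) M snd = density M k"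
    by (intro measure_eqI) simp_all
qed

text \<open>Abstract form of the completion step: \<open>r\<^sub>1\<close> is the density of a
  symmetric measure with marginals at most \<open>M\<close>, and the fibres of \<open>q\<close> are
  the cells within which the missing mass is placed.\<close>

locale symmetric_subkernel = prob_space M for M :: "'a measure" +
  fixes r\<^sub>1 :: "'a \<times> 'a \<Rightarrow> real" and q :: "'a \<Rightarrow> 'c::countable"
  assumes r1_measurable [measurable]: "r\<^sub>1 \<in> borel_measurable (M \<Otimes>\<^sub>M M)"
    and r1_nonneg: "\<And>z. 0 \<le> r\<^sub>1 z"
    and r1_sym: "\<And>x y. r\<^sub>1 (x, y) = r\<^sub>1 (y, x)"
    and r1_le: "\<And>x. (\<integral>\<^sup>+y. ennreal (r\<^sub>1 (x, y)) \<partial>M) \<le> 1"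
    and q_measurable [measurable]: "q \<in> measurable M (count_space UNIV)"
begin

definition deficit :: "'a \<Rightarrow> real" where
  "deficit x = 1 - enn2real (\<integral>\<^sup>+y. ennreal (r\<^sub>1 (x, y)) \<partial>M)"

definition cell_mass :: "'a \<Rightarrow> real" where
  "cell_mass x = enn2real (\<integral>\<^sup>+y. ennreal (if q x = q y then deficit y else 0) \<partial>M)"

text \<open>Within each cell the missing mass is coupled independently to itself.\<close>

definition r\<^sub>2 :: "'a \<times> 'a \<Rightarrow> real" where
  "r\<^sub>2 z = (if q (fst z) = q (snd z) then deficit (fst z) * deficit (snd z) / cell_mass (fst z) else 0)"

lemma pred_same_cell [measurable]:
  assumes [measurable]: "f \<in> measurable N M" "g \<in> measurable N M"
  shows "Measurable.pred N (\<lambda>x. q (f x) = q (g x))"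
proof -
  have "(\<lambda>x. q (f x) = q (g x)) = (\<lambda>x. \<exists>c. q (f x) = c \<and> q (g x) = c)" by auto
  then show ?thesis by simp
qed

lemma nn_integral_r1: "(\<integral>\<^sup>+y. ennreal (r\<^sub>1 (x, y)) \<partial>M) = ennreal (1 - deficit x)"
  using r1_le[of x] by (simp add: deficit_def ennreal_enn2real le_less_trans)

lemma deficit_measurable [measurable]: "deficit \<in> borel_measurable M"
  unfolding deficit_def by measurable

lemma deficit_nonneg: "0 \<le> deficit x" and deficit_le: "deficit x \<le> 1"
  using enn2real_mono[OF r1_le[of x]] by (simp_all add: deficit_def)

lemma cell_mass_measurable [measurable]: "cell_mass \<in> borel_measurable M"
  unfolding cell_mass_def by measurable

lemma cell_mass_nonneg: "0 \<le> cell_mass x"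
  by (simp add: cell_mass_def)

lemma nn_integral_cell_le: "(\<integral>\<^sup>+y. ennreal (if q x = q y then deficit y else 0) \<partial>M) \<le> 1"
proof -
  have "(\<integral>\<^sup>+y. ennreal (if q x = q y then deficit y else 0) \<partial>M) \<le> (\<integral>\<^sup>+y. 1 \<partial>M)"
    by (intro nn_integral_mono) (use deficit_le in auto)
  then show ?thesis by (simp add: emeasure_space_1)
qed

lemma nn_integral_cell: "(\<integral>\<^sup>+y. ennreal (if q x = q y then deficit y else 0) \<partial>M) = ennreal (cell_mass x)"
  unfolding cell_mass_def
  using nn_integral_cell_le[of x] by (subst ennreal_enn2real) (auto intro: le_less_trans)

lemma cell_mass_cong: "q x = q y \<Longrightarrow> cell_mass x = cell_mass y"
  by (simp add: cell_mass_def)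

text \<open>Countably many cells allow the exceptional null sets to be united. The purpose is that
  the division by \<open>cell_mass\<close> in \<open>r\<^sub>2\<close> loses no mass.\<close>

lemma AE_deficit_eq_0: "AE x in M. cell_mass x = 0 \<longrightarrow> deficit x = 0"
proof -
  have "AE x in M. \<forall>c. (\<integral>\<^sup>+y. ennreal (if c = q y then deficit y else 0) \<partial>M) = 0 \<longrightarrow> c = q x \<longrightarrow> deficit x = 0"
    unfolding AE_all_countable
  proof
    fix c
    show "AE x in M. (\<integral>\<^sup>+y. ennreal (if c = q y then deficit y else 0) \<partial>M) = 0 \<longrightarrow> c = q x \<longrightarrow> deficit x = 0"
    proof (cases "(\<integral>\<^sup>+y. ennreal (if c = q y then deficit y else 0) \<partial>M) = 0")
      case True
      then have "AE x in M. ennreal (if c = q x then deficit x else 0) = 0"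
        by (subst (asm) nn_integral_0_iff_AE) auto
      then show ?thesis
        by eventually_elim (use deficit_nonneg in \<open>auto simp: ennreal_eq_0_iff intro: antisym\<close>)
    qed simp
  qed
  then show ?thesis
    by eventually_elim (simp add: nn_integral_cell)
qed

lemma r2_measurable [measurable]: "r\<^sub>2 \<in> borel_measurable (M \<Otimes>\<^sub>M M)"
  unfolding r\<^sub>2_def by measurable

lemma r2_nonneg: "0 \<le> r\<^sub>2 z"
  by (simp add: r\<^sub>2_def deficit_nonneg cell_mass_nonneg)

lemma r2_sym: "r\<^sub>2 (x, y) = r\<^sub>2 (y, x)"
  using cell_mass_cong[of x y] by (auto simp: r\<^sub>2_def mult.commute)

lemma nn_integral_r2: "AE x in M. (\<integral>\<^sup>+y. ennreal (r\<^sub>2 (x, y)) \<partial>M) = ennreal (deficit x)"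
  using AE_deficit_eq_0
proof eventually_elim
  fix x assume x: "cell_mass x = 0 \<longrightarrow> deficit x = 0"
  have "(\<integral>\<^sup>+y. ennreal (r\<^sub>2 (x, y)) \<partial>M)
      = (\<integral>\<^sup>+y. ennreal (deficit x / cell_mass x) * ennreal (if q x = q y then deficit y else 0) \<partial>M)"
    by (intro nn_integral_cong)
       (simp add: r\<^sub>2_def ennreal_mult[symmetric] deficit_nonneg cell_mass_nonneg)
  also have "\<dots> = ennreal (deficit x / cell_mass x) * ennreal (cell_mass x)"
    by (simp add: nn_integral_cmult nn_integral_cell)
  also have "\<dots> = ennreal (deficit x)"
    using x by (simp add: ennreal_mult[symmetric] deficit_nonneg cell_mass_nonneg)
  finally show "(\<integral>\<^sup>+y. ennreal (r\<^sub>2 (x, y)) \<partial>M) = ennreal (deficit x)" .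
qed

definition completion_coupling :: "('a \<times> 'a) measure" where
  "completion_coupling = density (M \<Otimes>\<^sub>M M) (\<lambda>z. ennreal (r\<^sub>1 z + r\<^sub>2 z))"

lemma nn_integral_r12: "AE x in M. (\<integral>\<^sup>+y. ennreal (r\<^sub>1 (x, y) + r\<^sub>2 (x, y)) \<partial>M) = 1"
  using nn_integral_r2 AE_space
proof eventually_elim
  fix x assume r2: "(\<integral>\<^sup>+y. ennreal (r\<^sub>2 (x, y)) \<partial>M) = ennreal (deficit x)" and x: "x \<in> space M"
  note [measurable] = measurable_compose[OF measurable_Pair1'[OF x] r1_measurable]
    measurable_compose[OF measurable_Pair1'[OF x] r2_measurable]
  have "(\<integral>\<^sup>+y. ennreal (r\<^sub>1 (x, y) + r\<^sub>2 (x, y)) \<partial>M)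
      = (\<integral>\<^sup>+y. ennreal (r\<^sub>1 (x, y)) + ennreal (r\<^sub>2 (x, y)) \<partial>M)"
    by (simp add: ennreal_plus r1_nonneg r2_nonneg)
  also have "\<dots> = ennreal (1 - deficit x) + ennreal (deficit x)"
    by (subst nn_integral_add) (simp_all add: nn_integral_r1 r2)
  also have "\<dots> = 1"
    using deficit_nonneg[of x] deficit_le[of x] by (simp add: ennreal_plus[symmetric] del: ennreal_plus)
  finally show "(\<integral>\<^sup>+y. ennreal (r\<^sub>1 (x, y) + r\<^sub>2 (x, y)) \<partial>M) = 1" .
qed

lemma ennreal_r_sym:
  "ennreal (r\<^sub>1 (x, y)) = ennreal (r\<^sub>1 (y, x))" "ennreal (r\<^sub>2 (x, y)) = ennreal (r\<^sub>2 (y, x))"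
  "ennreal (r\<^sub>1 (x, y) + r\<^sub>2 (x, y)) = ennreal (r\<^sub>1 (y, x) + r\<^sub>2 (y, x))"
  by (rule arg_cong[where f = ennreal] arg_cong2[where f = "(+)"] r1_sym r2_sym)+

lemma completion_coupling_marginals:
  "distr completion_coupling M fst = M" "distr completion_coupling M snd = M"
  using symmetric_density_marginals[where r = "\<lambda>z. ennreal (r\<^sub>1 z + r\<^sub>2 z)" and k = "\<lambda>_. 1", OF _ _ ennreal_r_sym(3)] nn_integral_r12
  by (simp_all add: completion_coupling_def density_1)

text \<open>Summing over the cells, each point of \<open>N\<close> is counted with total weight at most one.\<close>

lemma nn_integral_deficit_cell:
  assumes N: "finite_measure N" and [measurable_cong]: "sets N = sets M"
  shows "(\<integral>\<^sup>+x. ennreal (deficit x * (measure N {y \<in> space M. q x = q y} / cell_mass x)) \<partial>M)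
    \<le> emeasure N (space N)"
proof -
  interpret N: finite_measure N by fact
  interpret P: pair_sigma_finite M N ..
  let ?f = "\<lambda>(x, y). ennreal (if q x = q y then deficit x / cell_mass x else 0)"
  have [measurable]: "(\<lambda>x. x) \<in> measurable N M" by (simp add: assms measurable_ident_sets)
  have [measurable]: "?f \<in> borel_measurable (M \<Otimes>\<^sub>M N)" by measurable
  have sp: "space N = space M" using assms by (simp cong: sets_eq_imp_space_eq)
  have "(\<integral>\<^sup>+x. ennreal (deficit x * (measure N {y \<in> space M. q x = q y} / cell_mass x)) \<partial>M)
      = (\<integral>\<^sup>+x. (\<integral>\<^sup>+y. ?f (x, y) \<partial>N) \<partial>M)"
  proof (intro nn_integral_cong)
    fix x
    have [measurable]: "{y \<in> space M. q x = q y} \<in> sets N"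
      using assms by simp
    have "(\<integral>\<^sup>+y. ?f (x, y) \<partial>N)
        = (\<integral>\<^sup>+y. ennreal (deficit x / cell_mass x) * indicator {y \<in> space M. q x = q y} y \<partial>N)"
      by (intro nn_integral_cong) (auto simp: sp)
    also have "\<dots> = ennreal (deficit x / cell_mass x) * emeasure N {y \<in> space M. q x = q y}"
      by (simp add: nn_integral_cmult)
    finally show "ennreal (deficit x * (measure N {y \<in> space M. q x = q y} / cell_mass x)) = (\<integral>\<^sup>+y. ?f (x, y) \<partial>N)"
      by (simp add: N.emeasure_eq_measure ennreal_mult[symmetric] deficit_nonneg cell_mass_nonneg)
  qed
  also have "\<dots> = (\<integral>\<^sup>+y. (\<integral>\<^sup>+x. ?f (x, y) \<partial>M) \<partial>N)"
    by (rule P.Fubini'[symmetric]) simp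
  also have "\<dots> \<le> (\<integral>\<^sup>+y. 1 \<partial>N)"
  proof (intro nn_integral_mono)
    fix y assume "y \<in> space N"
    have "(\<integral>\<^sup>+x. ?f (x, y) \<partial>M)
        = (\<integral>\<^sup>+x. ennreal (1 / cell_mass y) * ennreal (if q y = q x then deficit x else 0) \<partial>M)"
      by (intro nn_integral_cong)
         (auto simp: ennreal_mult[symmetric] deficit_nonneg cell_mass_nonneg dest: cell_mass_cong)
    also have "\<dots> = ennreal (1 / cell_mass y * cell_mass y)"
      by (simp add: nn_integral_cmult nn_integral_cell ennreal_mult[symmetric] cell_mass_nonneg)
    \<comment> \<open>The product is 1, or 0 in a cell without missing mass.\<close>
    also have "\<dots> \<le> 1" by simp
    finally show "(\<integral>\<^sup>+x. ?f (x, y) \<partial>M) \<le> 1" .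
  qed
  finally show ?thesis by simp
qed

text \<open>Both marginals of the measure with density \<open>r\<^sub>1\<close> are \<open>M\<close>
  weighted by \<open>1 - deficit\<close>, so the symmetric average integrates like a function of one
  variable.\<close>

lemma integral_r1:
  assumes F: "integrable M F"
  shows "has_bochner_integral (M \<Otimes>\<^sub>M M) (\<lambda>z. r\<^sub>1 z * ((F (fst z) + F (snd z)) / 2))
    (integral\<^sup>L M (\<lambda>x. (1 - deficit x) * F x))"
proof -
  let ?G = "density (M \<Otimes>\<^sub>M M) (\<lambda>z. ennreal (r\<^sub>1 z))"
  let ?D = "density M (\<lambda>x. ennreal (1 - deficit x))"
  have [measurable]: "F \<in> borel_measurable M" using F by simp
  have marg: "distr ?G M fst = ?D" "distr ?G M snd = ?D"
    using symmetric_density_marginals[where r = "\<lambda>z. ennreal (r\<^sub>1 z)" and k = "\<lambda>x. ennreal (1 - deficit x)", OF _ _ ennreal_r_sym(1)]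
    by (simp_all add: nn_integral_r1)
  have "integrable M (\<lambda>x. (1 - deficit x) * F x)"
    using deficit_nonneg deficit_le
    by (intro Bochner_Integration.integrable_bound[OF F]) (auto simp: abs_mult intro!: mult_left_le_one_le)
  then have D: "integrable ?D F" "integral\<^sup>L ?D F = integral\<^sup>L M (\<lambda>x. (1 - deficit x) * F x)"
    using deficit_le by (simp_all add: integrable_density integral_density)
  have "has_bochner_integral ?G (\<lambda>z. F (fst z)) (integral\<^sup>L ?D F)"
    using D(1) unfolding marg(1)[symmetric]
    by (simp add: has_bochner_integral_iff integrable_distr_eq integral_distr)
  moreover have "has_bochner_integral ?G (\<lambda>z. F (snd z)) (integral\<^sup>L ?D F)"
    using D(1) unfolding marg(2)[symmetric]
    by (simp add: has_bochner_integral_iff integrable_distr_eq integral_distr)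
  ultimately have "has_bochner_integral ?G (\<lambda>z. (F (fst z) + F (snd z)) / 2) ((integral\<^sup>L ?D F + integral\<^sup>L ?D F) / 2)"
    by (intro has_bochner_integral_divide_zero has_bochner_integral_add)
  then show ?thesis
    using r1_nonneg D(2)
    by (simp add: has_bochner_integral_iff integrable_density integral_density)
qed

lemma integral_r2:
  assumes [measurable]: "W \<in> borel_measurable M" and W: "integrable M (\<lambda>x. deficit x * W x)"
  shows "has_bochner_integral (M \<Otimes>\<^sub>M M) (\<lambda>z. r\<^sub>2 z * W (fst z)) (integral\<^sup>L M (\<lambda>x. deficit x * W x))"
proof -
  let ?G = "density (M \<Otimes>\<^sub>M M) (\<lambda>z. ennreal (r\<^sub>2 z))"
  let ?D = "density M (\<lambda>x. ennreal (deficit x))"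
  have marg: "distr ?G M fst = ?D"
    using symmetric_density_marginals(1)[where r = "\<lambda>z. ennreal (r\<^sub>2 z)" and k = "\<lambda>x. ennreal (deficit x)", OF _ _ ennreal_r_sym(2)] nn_integral_r2
    by simp
  have D: "integrable ?D W" "integral\<^sup>L ?D W = integral\<^sup>L M (\<lambda>x. deficit x * W x)"
    using W deficit_nonneg by (simp_all add: integrable_density integral_density)
  have "has_bochner_integral ?G (\<lambda>z. W (fst z)) (integral\<^sup>L ?D W)"
    using D(1) unfolding marg[symmetric]
    by (simp add: has_bochner_integral_iff integrable_distr_eq integral_distr)
  then show ?thesis
    using r2_nonneg D(2)
    by (simp add: has_bochner_integral_iff integrable_density integral_density)
qed

lemma completion_coupling_prob: "prob_space completion_coupling"
proof
  have "emeasure completion_coupling (space completion_coupling)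
      = emeasure (distr completion_coupling M fst) (space M)"
    by (subst emeasure_distr)
       (auto simp: completion_coupling_def space_pair_measure intro!: arg_cong[where f = "emeasure _"])
  then show "emeasure completion_coupling (space completion_coupling) = 1"
    by (simp add: completion_coupling_marginals emeasure_space_1)
qed

text \<open>The parameter \<open>s\<close> splits the relative entropy of \<open>r\<^sub>1 + r\<^sub>2\<close>
  and linearises the logarithm of the cell mass.\<close>

theorem completion_coupling_bound:
  fixes c :: "'a \<times> 'a \<Rightarrow> real" and F V :: "'a \<Rightarrow> real"
  assumes s: "0 < s" "s < 1"
    and F: "integrable M F" and V: "integrable M V"
    and c: "integrable completion_coupling c"
    and r1: "\<And>x y. r\<^sub>1 (x, y) * (ln (r\<^sub>1 (x, y)) + c (x, y)) \<le> r\<^sub>1 (x, y) * ((F x + F y) / 2)"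
    and c_le: "\<And>x y. q x = q y \<Longrightarrow> c (x, y) \<le> D"
    and N: "finite_measure N" and sets_N: "sets N = sets M"
    and V_ge: "\<And>x. 0 < measure N {y \<in> space M. q x = q y}"
      "\<And>x. - ln (measure N {y \<in> space M. q x = q y}) \<le> V x"
  shows "KL completion_coupling (M \<Otimes>\<^sub>M M) + ereal (integral\<^sup>L completion_coupling c) \<le>
    ereal (integral\<^sup>L M (\<lambda>x. (1 - deficit x) * F x) - ln (1 - s) + s * measure N (space N)
      + integral\<^sup>L M (\<lambda>x. deficit x * (V x + D - 2 * ln s)))"
proof -
  interpret N: finite_measure N by fact
  interpret P: pair_prob_space M M ..
  let ?R = "M \<Otimes>\<^sub>M M" and ?r = "\<lambda>z. r\<^sub>1 z + r\<^sub>2 z"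
  let ?G = "\<lambda>x. measure N {y \<in> space M. q x = q y}"
  let ?g = "\<lambda>x. ?G x / cell_mass x"
  let ?F = "\<lambda>x. F x - ln (1 - s)"
  \<comment> \<open>On the \<open>r\<^sub>2\<close> part the logarithm of
    \<open>1 / cell_mass\<close> is linearised by \<open>ln t \<le> t - 1\<close> at
    \<open>t = s * ?g x\<close>. This yields \<open>s * ?g x\<close>, the term \<open>V x\<close>
    and one \<open>- ln s\<close>; the other \<open>- ln s\<close> comes from
    \<open>log_sum_two\<close>, and \<open>D\<close> pays for the cost.\<close>
  let ?W = "\<lambda>x. s * ?g x + (V x + D - 2 * ln s)"
  have [measurable]: "F \<in> borel_measurable M" "V \<in> borel_measurable M" using F V by simp_all
  have [measurable]: "c \<in> borel_measurable ?R"
    using c by (simp add: completion_coupling_def)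
  have G_measurable [measurable]: "?G \<in> borel_measurable M"
  proof -
    have "{y \<in> space M. q x = q y} = {y \<in> space N. q y = q x}" for x
      using sets_eq_imp_space_eq[OF sets_N] by auto
    then have "?G = (\<lambda>x. (\<lambda>c. measure N {y \<in> space N. q y = c}) (q x))" by simp
    moreover have "(\<lambda>x. (\<lambda>c. measure N {y \<in> space N. q y = c}) (q x)) \<in> borel_measurable M"
      by (rule measurable_compose[OF q_measurable]) simp
    ultimately show ?thesis by metis
  qed
  have g: "integrable M (\<lambda>x. deficit x * ?g x)" "integral\<^sup>L M (\<lambda>x. deficit x * ?g x) \<le> measure N (space N)"
  proof -
    note le = nn_integral_deficit_cell[OF N sets_N, unfolded N.emeasure_eq_measure]
    then show i: "integrable M (\<lambda>x. deficit x * ?g x)"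
      by (intro integrableI_nonneg) (auto intro: le_less_trans simp: deficit_nonneg cell_mass_nonneg)
    from le show "integral\<^sup>L M (\<lambda>x. deficit x * ?g x) \<le> measure N (space N)"
      by (subst (asm) nn_integral_eq_integral[OF i]) (auto simp: deficit_nonneg cell_mass_nonneg)
  qed
  have dV: "integrable M (\<lambda>x. deficit x * (V x + D - 2 * ln s))"
    by (rule Bochner_Integration.integrable_bound[of M "\<lambda>x. \<bar>V x + D - 2 * ln s\<bar>"])
       (use V deficit_nonneg deficit_le in \<open>auto simp: abs_mult intro!: mult_left_le_one_le\<close>)
  have dW: "integrable M (\<lambda>x. deficit x * ?W x)"
    "integral\<^sup>L M (\<lambda>x. deficit x * ?W x) \<le> s * measure N (space N) + integral\<^sup>L M (\<lambda>x. deficit x * (V x + D - 2 * ln s))"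
  proof -
    have eq: "(\<lambda>x. deficit x * ?W x) = (\<lambda>x. s * (deficit x * ?g x) + deficit x * (V x + D - 2 * ln s))"
      by (simp add: algebra_simps)
    have i: "integrable M (\<lambda>x. s * (deficit x * ?g x))"
      by (intro integrable_mult_right g)
    show "integrable M (\<lambda>x. deficit x * ?W x)"
      unfolding eq by (intro Bochner_Integration.integrable_add i dV)
    have "s * integral\<^sup>L M (\<lambda>x. deficit x * ?g x) \<le> s * measure N (space N)"
      using s g by (intro mult_left_mono) auto
    then show "integral\<^sup>L M (\<lambda>x. deficit x * ?W x) \<le> s * measure N (space N) + integral\<^sup>L M (\<lambda>x. deficit x * (V x + D - 2 * ln s))"
      unfolding eq Bochner_Integration.integral_add[OF i dV] integral_mult_right_zero
      by (rule add_right_mono)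
  qed
  have kF: "integrable M (\<lambda>x. (1 - deficit x) * F x)"
    by (rule Bochner_Integration.integrable_bound[OF F])
       (use deficit_nonneg deficit_le in \<open>auto simp: abs_mult intro!: mult_left_le_one_le\<close>)
  have d: "integrable M (\<lambda>x. 1 - deficit x)"
    by (rule Bochner_Integration.integrable_bound[of M "\<lambda>x. 1 :: real"])
       (use deficit_nonneg deficit_le in auto)
  have "integral\<^sup>L M (\<lambda>x. (1 - deficit x) * ?F x)
      = integral\<^sup>L M (\<lambda>x. (1 - deficit x) * F x + (1 - deficit x) * - ln (1 - s))"
    by (simp add: algebra_simps)
  also have "\<dots> = integral\<^sup>L M (\<lambda>x. (1 - deficit x) * F x) + integral\<^sup>L M (\<lambda>x. 1 - deficit x) * - ln (1 - s)"
    using kF d by (subst Bochner_Integration.integral_add) (simp_all only: integrable_mult_left integral_mult_left_zero)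
  also have "integral\<^sup>L M (\<lambda>x. 1 - deficit x) * - ln (1 - s) \<le> 1 * - ln (1 - s)"
  proof (rule mult_right_mono)
    have "integral\<^sup>L M (\<lambda>x. 1 - deficit x) \<le> integral\<^sup>L M (\<lambda>x. 1)"
      using d deficit_nonneg by (intro integral_mono) auto
    then show "integral\<^sup>L M (\<lambda>x. 1 - deficit x) \<le> 1" by (simp add: prob_space)
    show "0 \<le> - ln (1 - s)" using s by simp
  qed
  finally have I1: "integral\<^sup>L M (\<lambda>x. (1 - deficit x) * ?F x) \<le> integral\<^sup>L M (\<lambda>x. (1 - deficit x) * F x) - ln (1 - s)"
    by simp
  have b1: "has_bochner_integral ?R (\<lambda>z. r\<^sub>1 z * ((?F (fst z) + ?F (snd z)) / 2)) (integral\<^sup>L M (\<lambda>x. (1 - deficit x) * ?F x))"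
    by (rule integral_r1) (use F in simp)
  have b2: "has_bochner_integral ?R (\<lambda>z. r\<^sub>2 z * ?W (fst z)) (integral\<^sup>L M (\<lambda>x. deficit x * ?W x))"
    by (rule integral_r2) (use dW in simp_all)
  have b3: "has_bochner_integral ?R (\<lambda>z. ?r z * c z) (integral\<^sup>L completion_coupling c)"
    using c r1_nonneg r2_nonneg
    by (simp add: completion_coupling_def has_bochner_integral_iff integrable_density integral_density
        del: ennreal_plus)
  \<comment> \<open>Subtracting the cost inside the majorant lets it reappear next to
    \<open>KL\<close> at the end, so entropy and cost are bounded together.\<close>
  let ?B = "\<lambda>z. r\<^sub>1 z * ((?F (fst z) + ?F (snd z)) / 2) + r\<^sub>2 z * ?W (fst z) - ?r z * c z"
  have B: "has_bochner_integral ?R ?B (integral\<^sup>L M (\<lambda>x. (1 - deficit x) * ?F x)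
      + integral\<^sup>L M (\<lambda>x. deficit x * ?W x) - integral\<^sup>L completion_coupling c)"
    by (intro has_bochner_integral_diff has_bochner_integral_add b1 b2 b3)
  have le: "?r z * ln (?r z) \<le> ?B z" for z
  proof -
    obtain x y where z: "z = (x, y)" by (cases z)
    have "?r z * ln (?r z) \<le> r\<^sub>1 z * ln (r\<^sub>1 z / (1 - s)) + r\<^sub>2 z * ln (r\<^sub>2 z / s)"
      by (intro log_sum_two r1_nonneg r2_nonneg s)
    moreover have "r\<^sub>1 z * ln (r\<^sub>1 z / (1 - s)) \<le> r\<^sub>1 z * ((?F x + ?F y) / 2) - r\<^sub>1 z * c z"
    proof (cases "r\<^sub>1 z = 0")
      case False
      then have "0 < r\<^sub>1 z" using r1_nonneg[of z] by simp
      then show ?thesis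
        using r1[of x y] s by (simp add: z ln_div algebra_simps)
    qed simp
    moreover have "r\<^sub>2 z * ln (r\<^sub>2 z / s) \<le> r\<^sub>2 z * (?W x - c z)"
    proof (cases "r\<^sub>2 z = 0")
      case False
      then have r2: "0 < r\<^sub>2 z" using r2_nonneg[of z] by simp
      from False have q: "q x = q y" and cm: "cell_mass x \<noteq> 0"
        by (auto simp: z r\<^sub>2_def split: if_splits)
      have cm: "0 < cell_mass x" using cm cell_mass_nonneg[of x] by simp
      \<comment> \<open>The numerator is at most 1, so only the cell mass enters the
        entropy.\<close>
      have "r\<^sub>2 z = deficit x * deficit y / cell_mass x" using q by (simp add: z r\<^sub>2_def)
      also have "\<dots> \<le> 1 / cell_mass x"
        using cm by (intro divide_right_mono mult_le_one deficit_le deficit_nonneg) simp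
      finally have "ln (r\<^sub>2 z) \<le> ln (1 / cell_mass x)" using r2 cm by (subst ln_le_cancel_iff) auto
      then have 1: "ln (r\<^sub>2 z) \<le> - ln (cell_mass x)" using cm by (simp add: ln_div)
      have gp: "0 < ?G x" by (rule V_ge)
      have "ln (s * ?g x) \<le> s * ?g x - 1"
        using s cm gp by (intro ln_le_minus_one) simp
      then have "- ln (cell_mass x) \<le> s * ?g x - 1 - ln s - ln (?G x)"
        using s cm gp by (simp add: ln_mult ln_div)
      with 1 V_ge(2)[of x] c_le[OF q] have "ln (r\<^sub>2 z / s) \<le> ?W x - c z"
        using r2 s by (simp add: ln_div z)
      then show ?thesis using r2 by simp
    qed simp
    ultimately show ?thesis by (simp add: z distrib_right right_diff_distrib)
  qed
  have "KL completion_coupling ?R \<le> ereal (integral\<^sup>L ?R ?B)"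
    unfolding completion_coupling_def
    using B le r1_nonneg r2_nonneg
    by (intro KL_density_le P.prob_space_axioms) (auto simp: has_bochner_integral_iff)
  also have "integral\<^sup>L ?R ?B = integral\<^sup>L M (\<lambda>x. (1 - deficit x) * ?F x)
      + integral\<^sup>L M (\<lambda>x. deficit x * ?W x) - integral\<^sup>L completion_coupling c"
    using B by (rule has_bochner_integral_integral_eq)
  finally have "KL completion_coupling ?R + ereal (integral\<^sup>L completion_coupling c)
      \<le> ereal (integral\<^sup>L M (\<lambda>x. (1 - deficit x) * ?F x)
      + integral\<^sup>L M (\<lambda>x. deficit x * ?W x) - integral\<^sup>L completion_coupling c)
      + ereal (integral\<^sup>L completion_coupling c)"
    by (rule add_right_mono)
  also have "\<dots> \<le> ereal (integral\<^sup>L M (\<lambda>x. (1 - deficit x) * F x) - ln (1 - s) + s * measure N (space N)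
      + integral\<^sup>L M (\<lambda>x. deficit x * (V x + D - 2 * ln s)))"
    using I1 dW(2) by simp
  finally show ?thesis .
qed

end

section \<open>The optimal coupling and the entropies\<close>

lemma (in strongly_convex_potential) bregman_measurable_compose [measurable (raw)]:
  assumes [measurable]: "f \<in> borel_measurable N" "g \<in> borel_measurable N"
  shows "(\<lambda>z. bregman (f z) (g z)) \<in> borel_measurable N"
proof -
  have "(\<lambda>z. (f z, g z)) \<in> borel_measurable N" by measurable
  from measurable_compose[OF this measurable_bregman] show ?thesis by simp
qed

lemma couplings_borel:
  assumes "\<gamma> \<in> couplings \<alpha> \<beta>"
  shows "prob_space \<gamma>" "sets \<gamma> = sets borel" "fst \<in> borel_measurable \<gamma>" "snd \<in> borel_measurable \<gamma>"
proof -
  show "prob_space \<gamma>" and s: "sets \<gamma> = sets borel"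
    using assms by (auto simp: couplings_def)
  show "fst \<in> borel_measurable \<gamma>" "snd \<in> borel_measurable \<gamma>"
    unfolding measurable_cong_sets[OF s refl] borel_prod[symmetric] by measurable
qed

lemma coupling_marginal_integral:
  fixes f :: "'a::euclidean_space \<Rightarrow> real"
  assumes \<gamma>: "\<gamma> \<in> couplings \<alpha> \<beta>" and [measurable]: "f \<in> borel_measurable borel"
  shows "has_bochner_integral \<gamma> (\<lambda>z. f (fst z)) I \<longleftrightarrow> has_bochner_integral \<alpha> f I"
    and "has_bochner_integral \<gamma> (\<lambda>z. f (snd z)) I \<longleftrightarrow> has_bochner_integral \<beta> f I"
proof -
  note [measurable] = couplings_borel(3,4)[OF \<gamma>]
  from \<gamma> have "distr \<gamma> borel fst = \<alpha>" "distr \<gamma> borel snd = \<beta>"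
    by (auto simp: couplings_def)
  then show "has_bochner_integral \<gamma> (\<lambda>z. f (fst z)) I \<longleftrightarrow> has_bochner_integral \<alpha> f I"
    "has_bochner_integral \<gamma> (\<lambda>z. f (snd z)) I \<longleftrightarrow> has_bochner_integral \<beta> f I"
    by (auto simp: has_bochner_integral_distr_iff)
qed

locale density_with_moment =
  fixes \<mu> :: "'a::euclidean_space measure"
  assumes ac_moment: "\<mu> \<in> prob_moment_ac 2"
begin

lemma prob: "prob_space \<mu>" and sets_eq [measurable_cong, simp]: "sets \<mu> = sets borel"
  using ac_moment by (auto simp: prob_moment_ac_def prob_moment_def)

lemma space_eq [simp]: "space \<mu> = UNIV"
  using sets_eq_imp_space_eq[OF sets_eq] by simp

abbreviation "\<rho> \<equiv> lebesgue_density \<mu>"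

lemma density_measurable [measurable]: "\<rho> \<in> borel_measurable borel"
  unfolding lebesgue_density_def using borel_measurable_RN_deriv[of lborel \<mu>] by measurable

lemma lebesgue_density_nonneg: "0 \<le> \<rho> x"
  by (simp add: lebesgue_density_def)

lemma density_lborel_eq: "density lborel (\<lambda>x. ennreal (\<rho> x)) = \<mu>"
proof -
  interpret prob_space \<mu> by (rule prob)
  have ac: "absolutely_continuous lborel \<mu>" using ac_moment by (simp add: prob_moment_ac_def)
  have "AE x in lborel. RN_deriv lborel \<mu> x \<noteq> \<infinity>"
    by (rule sigma_finite_measure.RN_deriv_finite[OF sigma_finite_lborel]) (use ac sigma_finite_measure_axioms in auto)
  then have "density lborel (\<lambda>x. ennreal (\<rho> x)) = density lborel (RN_deriv lborel \<mu>)"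
    by (intro density_cong) (auto simp: lebesgue_density_def top.not_eq_extremum)
  also have "\<dots> = \<mu>" using ac by (intro sigma_finite_measure.density_RN_deriv[OF sigma_finite_lborel]) auto
  finally show ?thesis .
qed

lemma nn_integral_eq:
  assumes [measurable]: "f \<in> borel_measurable borel"
  shows "(\<integral>\<^sup>+x. f x \<partial>\<mu>) = (\<integral>\<^sup>+x. ennreal (\<rho> x) * f x \<partial>lborel)"
  by (subst density_lborel_eq[symmetric]) (simp add: nn_integral_density)

lemma nn_integral_density_eq: "(\<integral>\<^sup>+x. ennreal (\<rho> x) \<partial>lborel) = 1"
  using nn_integral_eq[of "\<lambda>_. 1"] prob_space.emeasure_space_1[OF prob] by simp

lemma integrable_density_lborel: "integrable lborel \<rho>"
  by (rule integrableI_nonneg) (auto simp: lebesgue_density_nonneg nn_integral_density_eq)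

lemma AE_density_pos: "AE x in \<mu>. 0 < \<rho> x"
  by (subst density_lborel_eq[symmetric], subst AE_density) auto

lemma integrable_norm_sq: "integrable \<mu> (\<lambda>x. (norm x)\<^sup>2)"
  using ac_moment by (intro integrableI_nonneg) (auto simp: prob_moment_ac_def prob_moment_def powr_numeral)

lemma finite_measure: "finite_measure \<mu>"
  using prob by (rule prob_space.finite_measure)

lemma integrable_norm: "integrable \<mu> (\<lambda>x. norm x)"
proof -
  interpret prob_space \<mu> by (rule prob)
  have "norm x \<le> 1 + (norm x)\<^sup>2" for x :: 'a
    using zero_le_power2[of "norm x - 1/2"] by (simp add: power2_eq_square algebra_simps)
  then have "norm (norm x) \<le> norm (1 + (norm x)\<^sup>2)" for x :: 'a
    by simp
  then show ?thesis
    by (intro Bochner_Integration.integrable_bound[of _ "\<lambda>x. 1 + (norm x)\<^sup>2" "\<lambda>x. norm x"] AE_I2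
        Bochner_Integration.integrable_add integrable_norm_sq integrable_const) simp_all
qed

text \<open>Obtained from \<open>ln a \<le> a - 1\<close> at the ratio \<open>a\<close> of
  \<open>exp (- (x \<bullet> x))\<close> to the density.\<close>

definition ln_density_minorant :: "'a \<Rightarrow> real" where
  "ln_density_minorant x = 1 - exp (- (x \<bullet> x)) / \<rho> x - (norm x)\<^sup>2"

end

text \<open>Under \<open>\<mu>\<close> the ratio integrates to at most the Gaussian integral, and
  the quadratic term is a second moment; hence the entropy cannot be minus infinity. The Gaussian
  integral is a hypothesis because the type is an arbitrary Euclidean space, while it was computed
  on \<open>real ^ 'n\<close>.\<close>

lemma (in density_with_moment) ln_density_minorant:
  assumes G: "integrable lborel (\<lambda>x :: 'a. exp (- (x \<bullet> x)))"
  shows "integrable \<mu> ln_density_minorant" "AE x in \<mu>. ln_density_minorant x \<le> ln (\<rho> x)"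
proof -
  interpret prob_space \<mu> by (rule prob)
  have "(\<integral>\<^sup>+x. ennreal (exp (- (x \<bullet> x)) / \<rho> x) \<partial>\<mu>) \<le> (\<integral>\<^sup>+x. ennreal (exp (- (x \<bullet> x))) \<partial>(lborel :: 'a measure))"
  proof (subst nn_integral_eq, simp, intro nn_integral_mono)
    fix x :: 'a
    have "ennreal (\<rho> x) * ennreal (exp (- (x \<bullet> x)) / \<rho> x) = ennreal (\<rho> x * (exp (- (x \<bullet> x)) / \<rho> x))"
      by (rule ennreal_mult'[symmetric, OF lebesgue_density_nonneg])
    also have "\<dots> \<le> ennreal (exp (- (x \<bullet> x)))" by (intro ennreal_leI) simp
    finally show "ennreal (\<rho> x) * ennreal (exp (- (x \<bullet> x)) / \<rho> x) \<le> ennreal (exp (- (x \<bullet> x)))" .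
  qed
  also have "\<dots> < \<infinity>"
    using G by (simp add: nn_integral_eq_integral)
  finally have "integrable \<mu> (\<lambda>x. exp (- (x \<bullet> x)) / \<rho> x)"
    by (intro integrableI_nonneg) (auto simp: lebesgue_density_nonneg)
  then show "integrable \<mu> ln_density_minorant"
    unfolding ln_density_minorant_def
    by (intro Bochner_Integration.integrable_diff integrable_norm_sq) auto
  show "AE x in \<mu>. ln_density_minorant x \<le> ln (\<rho> x)"
    using AE_density_pos
  proof eventually_elim
    fix x assume x: "0 < \<rho> x"
    have "ln (exp (- (x \<bullet> x)) / \<rho> x) \<le> exp (- (x \<bullet> x)) / \<rho> x - 1"
      using x by (intro ln_le_minus_one) simp
    then show "ln_density_minorant x \<le> ln (\<rho> x)"
      using x by (simp add: ln_density_minorant_def ln_div power2_norm_eq_inner)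
  qed
qed

locale brenier_setting = strongly_convex_potential \<phi> m M + density_with_moment \<mu>
  for \<phi> :: "real ^ 'd \<Rightarrow> real" and m M and \<mu> :: "(real ^ 'd) measure" +
  fixes \<nu> :: "(real ^ 'd) measure"
  assumes nu_ac_moment: "\<nu> \<in> prob_moment_ac 2"
    and push: "distr \<mu> borel T = \<nu>"
begin

sublocale nu: density_with_moment \<nu>
  by standard (rule nu_ac_moment)

sublocale prob_space \<mu>
  by (rule prob)

lemma ln_density_bound:
  "integrable \<mu> ln_density_minorant" "AE x in \<mu>. ln_density_minorant x \<le> ln (\<rho> x)"
  using ln_density_minorant has_bochner_integral_gaussian[where 'n = 'd]
  by (auto simp: has_bochner_integral_iff)

lemma det_hessian_nonzero [simp]: "det (H x) \<noteq> 0"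
  using det_hessian_pos[of x] by simp

lemma nu_has_bochner_integral:
  fixes f :: "real ^ 'd \<Rightarrow> real"
  assumes [measurable]: "f \<in> borel_measurable borel"
  shows "has_bochner_integral \<nu> f I \<longleftrightarrow> has_bochner_integral \<mu> (\<lambda>x. f (T x)) I"
  unfolding push[symmetric] by (simp add: has_bochner_integral_distr_iff)

text \<open>Monge-Ampere equation for the push-forward: the Jacobian of \<open>T\<close> is
  \<open>det (H x)\<close>, so the change of variables with the integrand
  \<open>\<rho> / det H\<close> taken at \<open>T' y\<close> reproduces the mass of each
  set.\<close>

lemma nu_density_eq: "\<nu> = density lborel (\<lambda>y. ennreal (\<rho> (T' y) / det (H (T' y))))"
proof (rule measure_eqI)
  fix A assume "A \<in> sets \<nu>"
  then have [measurable]: "A \<in> sets borel" by simp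
  let ?g = "\<lambda>y. \<rho> (T' y) / det (H (T' y))"
  have g: "0 \<le> ?g y" for y
    by (intro divide_nonneg_pos lebesgue_density_nonneg det_hessian_pos)
  have "has_bochner_integral \<nu> (indicator A) (measure \<nu> A)"
    using finite_measure.emeasure_finite[OF nu.finite_measure]
    by (intro has_bochner_integral_real_indicator) (auto simp: top.not_eq_extremum)
  then have "has_bochner_integral \<mu> (\<lambda>x. indicator A (T x)) (measure \<nu> A)"
    by (simp add: nu_has_bochner_integral)
  then have "has_bochner_integral lborel (\<lambda>x. \<rho> x * indicator A (T x)) (measure \<nu> A)"
    by (subst (asm) density_lborel_eq[symmetric])
       (simp add: has_bochner_integral_iff integrable_density integral_density lebesgue_density_nonneg)
  also have "(\<lambda>x. \<rho> x * indicator A (T x)) = (\<lambda>x. \<bar>det (H x)\<bar> * (?g (T x) * indicator A (T x)))"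
    using det_hessian_pos by (simp add: fun_eq_iff less_imp_neq[symmetric] abs_of_pos)
  finally have *: "has_bochner_integral lborel (\<lambda>y. ?g y * indicator A y) (measure \<nu> A)"
    by (subst (asm) lborel_change_of_variables[OF has_derivative_gradient bij_gradient]) simp_all
  have "emeasure (density lborel (\<lambda>y. ennreal (?g y))) A = (\<integral>\<^sup>+y. ennreal (?g y * indicator A y) \<partial>lborel)"
    by (auto simp: emeasure_density intro!: nn_integral_cong split: split_indicator)
  also have "\<dots> = ennreal (measure \<nu> A)"
    using * nn_integral_eq_integral[of lborel "\<lambda>y. ?g y * indicator A y"] mult_nonneg_nonneg[OF g]
    by (simp add: has_bochner_integral_iff)
  finally show "emeasure \<nu> A = emeasure (density lborel (\<lambda>y. ennreal (?g y))) A"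
    using nu.finite_measure by (simp add: finite_measure.emeasure_eq_measure)
qed simp

text \<open>Uniqueness of densities holds almost everywhere for Lebesgue measure, hence for
  \<open>\<nu>\<close>; the push-forward turns this into a statement along \<open>T\<close> for
  \<open>\<mu>\<close>.\<close>

lemma nu_density_gradient: "AE x in \<mu>. lebesgue_density \<nu> (T x) = \<rho> x / det (H x)"
proof -
  let ?g = "\<lambda>y. \<rho> (T' y) / det (H (T' y))"
  have g: "0 \<le> ?g y" for y
    by (intro divide_nonneg_pos lebesgue_density_nonneg det_hessian_pos)
  have "AE y in lborel. ennreal (?g y) = RN_deriv lborel \<nu> y"
    by (rule sigma_finite_measure.RN_deriv_unique[OF sigma_finite_lborel]) (simp_all add: nu_density_eq[symmetric])
  then have "AE y in lborel. lebesgue_density \<nu> y = ?g y"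
  proof eventually_elim
    fix y assume *: "ennreal (?g y) = RN_deriv lborel \<nu> y"
    have "lebesgue_density \<nu> y = enn2real (RN_deriv lborel \<nu> y)"
      by (rule lebesgue_density_def)
    also have "\<dots> = enn2real (ennreal (?g y))"
      by (rule arg_cong[OF *[symmetric]])
    also have "\<dots> = ?g y" by (rule enn2real_ennreal[OF g])
    finally show "lebesgue_density \<nu> y = ?g y" .
  qed
  then have "AE y in \<nu>. lebesgue_density \<nu> y = ?g y"
    by (subst nu_density_eq, subst AE_density) (auto elim: eventually_mono)
  then have "AE y in distr \<mu> borel T. lebesgue_density \<nu> y = ?g y"
    unfolding push .
  then show ?thesis
    by (subst (asm) AE_distr_iff) auto
qed

definition mean_log_det :: real where
  "mean_log_det = integral\<^sup>L \<mu> (\<lambda>x. ln (det (H x)))"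

lemma integrable_ln_det: "integrable \<mu> (\<lambda>x. ln (det (H x)))"
proof (rule integrable_const_bound[of _ "\<bar>ln (m ^ CARD('d))\<bar> + \<bar>ln (M ^ CARD('d))\<bar>"])
  have "\<bar>ln (det (H x))\<bar> \<le> \<bar>ln (m ^ CARD('d))\<bar> + \<bar>ln (M ^ CARD('d))\<bar>" for x
  proof -
    have "ln (m ^ CARD('d)) \<le> ln (det (H x))" "ln (det (H x)) \<le> ln (M ^ CARD('d))"
      using det_hessian_bounds[of x] det_hessian_pos[of x] m_pos M_pos
      by (simp_all only: ln_le_cancel_iff zero_less_power)
    then show ?thesis by linarith
  qed
  then show "AE x in \<mu>. norm (ln (det (H x))) \<le> \<bar>ln (m ^ CARD('d))\<bar> + \<bar>ln (M ^ CARD('d))\<bar>"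
    by simp
qed simp

text \<open>The logarithm of the Monge-Ampere equation, integrated. The Hessian term is bounded, so
  it is a finite shift even when the entropy is infinite.\<close>

lemma Ent_nu: "Ent \<nu> = Ent \<mu> - ereal mean_log_det"
proof -
  have "Ent \<nu> = ext_integral (distr \<mu> borel T) (\<lambda>y. ln (lebesgue_density \<nu> y))"
    by (simp add: Ent_def push)
  also have "\<dots> = ext_integral \<mu> (\<lambda>x. ln (lebesgue_density \<nu> (T x)))"
    by (rule ext_integral_distr) simp_all
  also have "\<dots> = ext_integral \<mu> (\<lambda>x. 1 * ln (\<rho> x) + - ln (det (H x)))"
    using nu_density_gradient AE_density_pos
    by (intro ext_integral_cong_AE, eventually_elim) (simp add: ln_div)
  also have "\<dots> = ereal 1 * Ent \<mu> + ereal (integral\<^sup>L \<mu> (\<lambda>x. - ln (det (H x))))"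
    unfolding Ent_def
    by (rule ext_integral_add_scaled[OF _ ln_density_bound]) (use integrable_ln_det in auto)
  finally show ?thesis
    by (simp add: mean_log_det_def minus_ereal_def one_ereal_def[symmetric])
qed

lemma K_EOT_eq: "K_EOT \<phi> \<mu> \<nu> = ereal (- 1 / 2) * (2 * Ent \<mu> - ereal mean_log_det)"
proof -
  have "ext_integral \<mu> (\<lambda>x. ln (\<rho> x * lebesgue_density \<nu> (T x)))
      = ext_integral \<mu> (\<lambda>x. 2 * ln (\<rho> x) + - ln (det (H x)))"
    using nu_density_gradient AE_density_pos
    by (intro ext_integral_cong_AE, eventually_elim) (simp add: ln_div ln_mult)
  also have "\<dots> = ereal 2 * Ent \<mu> + ereal (integral\<^sup>L \<mu> (\<lambda>x. - ln (det (H x))))"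
    unfolding Ent_def
    by (rule ext_integral_add_scaled[OF _ ln_density_bound]) (use integrable_ln_det in auto)
  finally show ?thesis
    by (simp add: K_EOT_def mean_log_det_def minus_ereal_def)
qed

lemma Ent_cases:
  obtains (finite) "integrable \<mu> (\<lambda>x. ln (\<rho> x))" "Ent \<mu> = ereal (integral\<^sup>L \<mu> (\<lambda>x. ln (\<rho> x)))"
  | (infinite) "\<not> integrable \<mu> (\<lambda>x. ln (\<rho> x))" "Ent \<mu> = \<infinity>"
proof (cases "integrable \<mu> (\<lambda>x. ln (\<rho> x))")
  case True
  then show ?thesis by (intro finite) (simp_all add: Ent_def ext_integral_integrable)
next
  case False
  then show ?thesis
    by (intro infinite) (simp_all add: Ent_def ext_integral_eq_PInfty[OF _ ln_density_bound])
qed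

lemma K_EOT_Ent: "K_EOT \<phi> \<mu> \<nu> = - (Ent \<mu> + Ent \<nu>) / 2" "K_EOT \<phi> \<mu> \<nu> < \<infinity>"
  unfolding K_EOT_eq Ent_nu
  by (cases rule: Ent_cases; simp add: field_simps)+

section \<open>Excess cost and the optimal coupling\<close>

definition OT_value :: real where
  "OT_value = integral\<^sup>L \<mu> (\<lambda>x. (norm (x - T x))\<^sup>2)"

lemma integrable_norm_gradient_sq: "integrable \<mu> (\<lambda>x. (norm (T x))\<^sup>2)"
  using nu.integrable_norm_sq nu_has_bochner_integral[of "\<lambda>x. (norm x)\<^sup>2"]
  by (auto simp: has_bochner_integral_iff)

lemma integrable_inner_gradient: "integrable \<mu> (\<lambda>x. x \<bullet> T x)"
proof (rule Bochner_Integration.integrable_bound[of _ "\<lambda>x. (norm x)\<^sup>2 + (norm (T x))\<^sup>2"])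
  have "\<bar>x \<bullet> T x\<bar> \<le> (norm x)\<^sup>2 + (norm (T x))\<^sup>2" for x
  proof -
    have "2 * (norm x * norm (T x)) \<le> (norm x)\<^sup>2 + (norm (T x))\<^sup>2"
      using sum_squares_bound[of "norm x" "norm (T x)"] by (simp add: mult.assoc)
    moreover have "0 \<le> norm x * norm (T x)" by simp
    ultimately show ?thesis
      using Cauchy_Schwarz_ineq2[of x "T x"] by linarith
  qed
  then show "AE x in \<mu>. norm (x \<bullet> T x) \<le> norm ((norm x)\<^sup>2 + (norm (T x))\<^sup>2)" by simp
qed (auto intro: integrable_norm_sq integrable_norm_gradient_sq)

text \<open>By the Bregman bounds at 0 the potential grows at most quadratically.\<close>

lemma integrable_potential: "integrable \<mu> \<phi>"
proof (rule Bochner_Integration.integrable_bound[of _ "\<lambda>x. \<bar>\<phi> 0\<bar> + norm x * norm (T 0) + M / 2 * (norm x)\<^sup>2"])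
  show "integrable \<mu> (\<lambda>x. \<bar>\<phi> 0\<bar> + norm x * norm (T 0) + M / 2 * (norm x)\<^sup>2)"
    by (intro Bochner_Integration.integrable_add integrable_mult_left integrable_mult_right
        integrable_norm integrable_norm_sq integrable_const)
  have "\<bar>\<phi> x\<bar> \<le> \<bar>\<phi> 0\<bar> + norm x * norm (T 0) + M / 2 * (norm x)\<^sup>2" for x
    using bregman_bounds(2)[of x 0] bregman_nonneg[of x 0] Cauchy_Schwarz_ineq2[of x "T 0"]
    by (simp add: bregman_def)
  then show "AE x in \<mu>. norm (\<phi> x) \<le> norm (\<bar>\<phi> 0\<bar> + norm x * norm (T 0) + M / 2 * (norm x)\<^sup>2)"
    by (intro AE_I2) (simp add: order_trans[OF _ abs_ge_self])
qed simp

text \<open>\<open>T' y \<bullet> y - \<phi> (T' y)\<close> is the Legendre conjugate of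
  \<open>\<phi>\<close> at \<open>y\<close>, and the Bregman divergence is the gap in the
  Fenchel-Young inequality. The identity thus displays the dual potentials of the quadratic
  cost.\<close>

lemma cost_identity:
  "(norm (x - y))\<^sup>2 = ((norm x)\<^sup>2 - 2 * \<phi> x)
     + ((norm y)\<^sup>2 - 2 * (T' y \<bullet> y - \<phi> (T' y))) + 2 * bregman x (T' y)"
  by (simp add: bregman_def power2_norm_eq_inner inner_diff_left inner_diff_right inner_commute)

text \<open>The first two brackets of \<open>cost_identity\<close> depend on one variable each, so
  every coupling gives them the same integral.\<close>

lemma quadratic_cost_coupling:
  assumes \<gamma>: "\<gamma> \<in> couplings \<mu> \<nu>"
  shows "integrable \<gamma> (\<lambda>z. bregman (fst z) (T' (snd z)))"
    and "quadratic_cost \<gamma> = ereal (OT_value + 2 * integral\<^sup>L \<gamma> (\<lambda>z. bregman (fst z) (T' (snd z))))"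
proof -
  note [measurable] = couplings_borel(3,4)[OF \<gamma>]
  let ?u = "\<lambda>x. (norm x)\<^sup>2 - 2 * \<phi> x" and ?v = "\<lambda>y. (norm y)\<^sup>2 - 2 * (T' y \<bullet> y - \<phi> (T' y))"
  have iu: "integrable \<mu> ?u"
    by (intro Bochner_Integration.integrable_diff integrable_mult_right integrable_norm_sq integrable_potential)
  have iv: "integrable \<mu> (\<lambda>x. ?v (T x))"
    using integrable_norm_gradient_sq integrable_inner_gradient integrable_potential by simp
  have u: "has_bochner_integral \<gamma> (\<lambda>z. ?u (fst z)) (integral\<^sup>L \<mu> ?u)"
    using iu by (subst coupling_marginal_integral(1)[OF \<gamma>]) (auto simp: has_bochner_integral_iff)
  have v: "has_bochner_integral \<gamma> (\<lambda>z. ?v (snd z)) (integral\<^sup>L \<mu> (\<lambda>x. ?v (T x)))"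
    using iv by (subst coupling_marginal_integral(2)[OF \<gamma>], simp, subst nu_has_bochner_integral)
      (auto simp: has_bochner_integral_iff)
  \<comment> \<open>The common value is computed on the graph of \<open>T\<close>, where the Bregman
    term is zero.\<close>
  have "integral\<^sup>L \<mu> ?u + integral\<^sup>L \<mu> (\<lambda>x. ?v (T x)) = integral\<^sup>L \<mu> (\<lambda>x. ?u x + ?v (T x))"
    using iu iv by (rule Bochner_Integration.integral_add[symmetric])
  also have "\<dots> = OT_value"
    unfolding OT_value_def by (intro Bochner_Integration.integral_cong refl) (subst cost_identity, simp add: bregman_def)
  finally have J: "integral\<^sup>L \<mu> ?u + integral\<^sup>L \<mu> (\<lambda>x. ?v (T x)) = OT_value" .
  have n1: "integrable \<gamma> (\<lambda>z. (norm (fst z))\<^sup>2)"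
    using coupling_marginal_integral(1)[OF \<gamma>, of "\<lambda>x. (norm x)\<^sup>2"] integrable_norm_sq
    by (auto simp: has_bochner_integral_iff)
  have n2: "integrable \<gamma> (\<lambda>z. (norm (snd z))\<^sup>2)"
    using coupling_marginal_integral(2)[OF \<gamma>, of "\<lambda>x. (norm x)\<^sup>2"] nu.integrable_norm_sq
    by (auto simp: has_bochner_integral_iff)
  have c: "integrable \<gamma> (\<lambda>z. (norm (fst z - snd z))\<^sup>2)"
  proof (rule Bochner_Integration.integrable_bound[of _ "\<lambda>z. 2 * (norm (fst z))\<^sup>2 + 2 * (norm (snd z))\<^sup>2"])
    have "(norm (x - y))\<^sup>2 \<le> 2 * (norm x)\<^sup>2 + 2 * (norm y)\<^sup>2" for x y :: "real ^ 'd"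
    proof -
      have "(norm (x - y))\<^sup>2 + (norm (x + y))\<^sup>2 = 2 * (norm x)\<^sup>2 + 2 * (norm y)\<^sup>2"
        by (simp add: power2_norm_eq_inner inner_simps inner_commute)
      then show ?thesis using zero_le_power2[of "norm (x + y)"] by linarith
    qed
    then show "AE z in \<gamma>. norm ((norm (fst z - snd z))\<^sup>2) \<le> norm (2 * (norm (fst z))\<^sup>2 + 2 * (norm (snd z))\<^sup>2)"
      by simp
  qed (use n1 n2 in auto)
  have "(\<lambda>z. bregman (fst z) (T' (snd z))) = (\<lambda>z. ((norm (fst z - snd z))\<^sup>2 - (?u (fst z) + ?v (snd z))) / 2)"
    by (subst cost_identity) simp
  then show B: "integrable \<gamma> (\<lambda>z. bregman (fst z) (T' (snd z)))"
    using c u v by (auto simp: has_bochner_integral_iff)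
  have "integral\<^sup>L \<gamma> (\<lambda>z. (norm (fst z - snd z))\<^sup>2)
      = integral\<^sup>L \<gamma> (\<lambda>z. ?u (fst z) + ?v (snd z) + 2 * bregman (fst z) (T' (snd z)))"
    by (subst cost_identity) simp
  also have "\<dots> = OT_value + 2 * integral\<^sup>L \<gamma> (\<lambda>z. bregman (fst z) (T' (snd z)))"
    using u v B unfolding J[symmetric] has_bochner_integral_iff by simp
  finally have E: "integral\<^sup>L \<gamma> (\<lambda>z. (norm (fst z - snd z))\<^sup>2)
      = OT_value + 2 * integral\<^sup>L \<gamma> (\<lambda>z. bregman (fst z) (T' (snd z)))" .
  have "quadratic_cost \<gamma> = ereal (integral\<^sup>L \<gamma> (\<lambda>z. (norm (fst z - snd z))\<^sup>2))"
    using c by (simp add: quadratic_cost_def nn_integral_eq_integral enn2ereal_ennreal)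
  with E show "quadratic_cost \<gamma> = ereal (OT_value + 2 * integral\<^sup>L \<gamma> (\<lambda>z. bregman (fst z) (T' (snd z))))"
    by simp
qed

lemma gradient_coupling: "distr \<mu> borel (\<lambda>x. (x, T x)) \<in> couplings \<mu> \<nu>"
proof -
  have [measurable]: "(\<lambda>x. (x, T x)) \<in> measurable \<mu> borel"
    unfolding borel_prod[symmetric] by measurable
  have "distr \<mu> borel (\<lambda>x. x) = \<mu>" by (rule distr_id2) simp
  then show ?thesis
    using push unfolding couplings_def
    by (auto intro!: prob_space_distr simp: distr_distr comp_def borel_prod[symmetric])
qed

text \<open>The Bregman excess is nonnegative and vanishes on the graph of \<open>T\<close>.\<close>

lemma OT_eq: "OT \<mu> \<nu> = ereal OT_value"
proof (rule antisym)
  let ?\<gamma> = "distr \<mu> borel (\<lambda>x. (x, T x))"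
  have [measurable]: "(\<lambda>x. (x, T x)) \<in> measurable \<mu> borel"
    unfolding borel_prod[symmetric] by measurable
  have [measurable]: "(\<lambda>z :: (real ^ 'd) \<times> (real ^ 'd). bregman (fst z) (T' (snd z))) \<in> borel_measurable borel"
    unfolding borel_prod[symmetric] by measurable
  have "integral\<^sup>L ?\<gamma> (\<lambda>z. bregman (fst z) (T' (snd z))) = integral\<^sup>L \<mu> (\<lambda>x. bregman x x)"
    by (subst integral_distr) simp_all
  then have 0: "integral\<^sup>L ?\<gamma> (\<lambda>z. bregman (fst z) (T' (snd z))) = 0"
    by (simp add: bregman_def)
  have "OT \<mu> \<nu> \<le> quadratic_cost ?\<gamma>"
    unfolding OT_def by (rule INF_lower[OF gradient_coupling])
  also have "quadratic_cost ?\<gamma> = ereal OT_value"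
    by (simp add: quadratic_cost_coupling(2)[OF gradient_coupling] 0)
  finally show "OT \<mu> \<nu> \<le> ereal OT_value" .
  show "ereal OT_value \<le> OT \<mu> \<nu>"
    unfolding OT_def
    by (intro INF_greatest) (simp add: quadratic_cost_coupling(2) integral_nonneg_AE bregman_nonneg)
qed

end

section \<open>The lower bound\<close>

lemma mult_exp_half_ln:
  fixes r t :: real
  assumes "0 < r" "0 < t"
  shows "r * exp (- (ln r + ln t) / 2) = sqrt (r / t)"
proof -
  have "sqrt (r / t) = exp (ln (sqrt (r / t)))" using assms by simp
  also have "ln (sqrt (r / t)) = ln r + - (ln r + ln t) / 2"
    using assms by (simp add: ln_sqrt ln_div field_simps)
  finally show ?thesis using assms by (simp only: exp_add exp_ln)
qed

section \<open>Laplace asymptotics of the normalisers\<close>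

context strongly_convex_potential
begin

text \<open>The integral of \<open>exp (- (c x z / e))\<close> over \<open>z\<close>, in the
  variable \<open>w\<close> with \<open>z = x + sqrt e *\<^sub>R w\<close> and stripped of the
  Jacobian \<open>sqrt e ^ CARD('d)\<close>, so that it has a limit.\<close>

definition normaliser :: "(real ^ 'd \<Rightarrow> real ^ 'd \<Rightarrow> real) \<Rightarrow> real \<Rightarrow> real ^ 'd \<Rightarrow> real" where
  "normaliser c e x = integral\<^sup>L lborel (\<lambda>w. exp (- (c x (x + sqrt e *\<^sub>R w) / e)))"

text \<open>What the Laplace method asks of a cost: the quadratic bounds give an integrable majorant
  and two-sided bounds on the normaliser, the last clause the Gaussian limit. The Bregman cost, its
  transpose and the symmetric cost all qualify and therefore share their asymptotics.\<close>

definition hessian_like :: "(real ^ 'd \<Rightarrow> real ^ 'd \<Rightarrow> real) \<Rightarrow> bool" where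
  "hessian_like c \<longleftrightarrow> (\<lambda>p. c (fst p) (snd p)) \<in> borel_measurable borel \<and>
     (\<forall>x z. m * (norm (x - z))\<^sup>2 \<le> c x z \<and> c x z \<le> M * (norm (x - z))\<^sup>2) \<and>
     (\<forall>x w e. (\<forall>n. 0 < e n) \<longrightarrow> e \<longlonglongrightarrow> 0 \<longrightarrow>
        (\<lambda>n. c x (x + sqrt (e n) *\<^sub>R w) / e n) \<longlonglongrightarrow> w \<bullet> (H x *v w))"

lemma double_bregman_bounds:
  "m * (norm (x - z))\<^sup>2 \<le> 2 * bregman x z" "2 * bregman x z \<le> M * (norm (x - z))\<^sup>2"
  using bregman_bounds[of x z] by linarith+

lemma hessian_like_bregman: "hessian_like (\<lambda>x z. 2 * bregman x z)"
  unfolding hessian_like_def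
  using double_bregman_bounds tendsto_bregman_rescaled(1) by auto

lemma hessian_like_bregman_swap: "hessian_like (\<lambda>x z. 2 * bregman z x)"
proof -
  have "(\<lambda>p :: (real ^ 'd) \<times> (real ^ 'd). 2 * bregman (snd p) (fst p)) \<in> borel_measurable borel"
    unfolding borel_prod[symmetric] by measurable
  moreover have "m * (norm (x - z))\<^sup>2 \<le> 2 * bregman z x" "2 * bregman z x \<le> M * (norm (x - z))\<^sup>2" for x z
    using double_bregman_bounds[of z x] by (simp_all only: norm_minus_commute[of x z])
  ultimately show ?thesis
    unfolding hessian_like_def using tendsto_bregman_rescaled(2) by blast
qed

definition symmetric_cost :: "real ^ 'd \<Rightarrow> real ^ 'd \<Rightarrow> real" where
  "symmetric_cost x z = bregman x z + bregman z x"

lemma hessian_like_symmetric_cost: "hessian_like symmetric_cost"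
  unfolding hessian_like_def
proof (intro conjI allI impI)
  show "(\<lambda>p. symmetric_cost (fst p) (snd p)) \<in> borel_measurable borel"
    unfolding borel_prod[symmetric] symmetric_cost_def by measurable
  fix x z
  show "m * (norm (x - z))\<^sup>2 \<le> symmetric_cost x z" "symmetric_cost x z \<le> M * (norm (x - z))\<^sup>2"
    using bregman_bounds[of x z] bregman_bounds[of z x]
    by (simp_all add: symmetric_cost_def norm_minus_commute)
next
  fix x w and e :: "nat \<Rightarrow> real"
  assume e: "\<forall>n. 0 < e n" "e \<longlonglongrightarrow> 0"
  have "(\<lambda>n. (2 * bregman x (x + sqrt (e n) *\<^sub>R w) / e n + 2 * bregman (x + sqrt (e n) *\<^sub>R w) x / e n) / 2)
    \<longlonglongrightarrow> (w \<bullet> (H x *v w) + w \<bullet> (H x *v w)) / 2"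
    using e by (intro tendsto_intros tendsto_bregman_rescaled) auto
  then show "(\<lambda>n. symmetric_cost x (x + sqrt (e n) *\<^sub>R w) / e n) \<longlonglongrightarrow> w \<bullet> (H x *v w)"
    by (simp add: symmetric_cost_def add_divide_distrib)
qed

lemma hessian_like_measurable:
  assumes "hessian_like c" and [measurable]: "f \<in> borel_measurable N" "g \<in> borel_measurable N"
  shows "(\<lambda>z. c (f z) (g z)) \<in> borel_measurable N"
proof -
  have "(\<lambda>z. (f z, g z)) \<in> borel_measurable N" by measurable
  from measurable_compose[OF this, of "\<lambda>p. c (fst p) (snd p)"] assms show ?thesis
    by (simp add: hessian_like_def)
qed

lemma hessian_like_rescaled_bounds:
  assumes "hessian_like c" "0 < e"
  shows "m * (w \<bullet> w) \<le> c x (x + sqrt e *\<^sub>R w) / e" "c x (x + sqrt e *\<^sub>R w) / e \<le> M * (w \<bullet> w)"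
proof -
  have "(norm (x - (x + sqrt e *\<^sub>R w)))\<^sup>2 = e * (w \<bullet> w)"
    using assms(2) by (simp add: power_mult_distrib power2_norm_eq_inner)
  then have "m * (e * (w \<bullet> w)) \<le> c x (x + sqrt e *\<^sub>R w)" "c x (x + sqrt e *\<^sub>R w) \<le> M * (e * (w \<bullet> w))"
    using assms(1) unfolding hessian_like_def by metis+
  then show "m * (w \<bullet> w) \<le> c x (x + sqrt e *\<^sub>R w) / e" "c x (x + sqrt e *\<^sub>R w) / e \<le> M * (w \<bullet> w)"
    using assms(2) by (simp_all add: field_simps)
qed

definition "Z_min = sqrt ((pi / M) ^ CARD('d))"
definition "Z_max = sqrt ((pi / m) ^ CARD('d))"

lemma Z_min_pos: "0 < Z_min" and Z_max_pos: "0 < Z_max"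
  using m_pos M_pos by (simp_all add: Z_min_def Z_max_def)

lemma gaussian_m: "has_bochner_integral lborel (\<lambda>w :: real ^ 'd. exp (- (m * (w \<bullet> w)))) Z_max"
  unfolding Z_max_def by (rule gaussian_integral_scaled[OF m_pos])

lemma gaussian_M: "has_bochner_integral lborel (\<lambda>w :: real ^ 'd. exp (- (M * (w \<bullet> w)))) Z_min"
  unfolding Z_min_def by (rule gaussian_integral_scaled[OF M_pos])

lemma normaliser_integrable:
  assumes c: "hessian_like c" and e: "0 < e"
  shows "integrable lborel (\<lambda>w. exp (- (c x (x + sqrt e *\<^sub>R w) / e)))"
proof (rule Bochner_Integration.integrable_bound)
  show "integrable lborel (\<lambda>w :: real ^ 'd. exp (- (m * (w \<bullet> w))))"
    using gaussian_m by (simp add: has_bochner_integral_iff)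
  show "AE w in lborel. norm (exp (- (c x (x + sqrt e *\<^sub>R w) / e))) \<le> norm (exp (- (m * (w \<bullet> w))))"
    using hessian_like_rescaled_bounds(1)[OF c e] by simp
  note [measurable] = hessian_like_measurable[OF c]
  show "(\<lambda>w. exp (- (c x (x + sqrt e *\<^sub>R w) / e))) \<in> borel_measurable lborel"
    by measurable
qed

lemma normaliser_bounds:
  assumes c: "hessian_like c" and e: "0 < e"
  shows "Z_min \<le> normaliser c e x" "normaliser c e x \<le> Z_max" "0 < normaliser c e x"
proof -
  have n: "has_bochner_integral lborel (\<lambda>w. exp (- (c x (x + sqrt e *\<^sub>R w) / e))) (normaliser c e x)"
    using normaliser_integrable[OF c e] by (simp add: has_bochner_integral_iff normaliser_def)
  show 1: "Z_min \<le> normaliser c e x"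
    by (rule has_bochner_integral_mono[OF gaussian_M n])
       (use hessian_like_rescaled_bounds(2)[OF c e] in simp)
  show "normaliser c e x \<le> Z_max"
    by (rule has_bochner_integral_mono[OF n gaussian_m])
       (use hessian_like_rescaled_bounds(1)[OF c e] in simp)
  show "0 < normaliser c e x" using 1 Z_min_pos by simp
qed

lemma normaliser_measurable:
  assumes c: "hessian_like c"
  shows "normaliser c e \<in> borel_measurable borel"
proof -
  note [measurable] = hessian_like_measurable[OF c]
  show ?thesis unfolding normaliser_def by measurable
qed

lemma nn_integral_exp_cost:
  assumes c: "hessian_like c" and e: "0 < e"
  shows "(\<integral>\<^sup>+z. ennreal (exp (- (c x z / e))) \<partial>lborel) = ennreal (sqrt e ^ CARD('d) * normaliser c e x)"
proof -
  note [measurable] = hessian_like_measurable[OF c]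
  have "(\<integral>\<^sup>+z. ennreal (exp (- (c x z / e))) \<partial>lborel)
      = ennreal (sqrt e ^ CARD('d)) * (\<integral>\<^sup>+w. ennreal (exp (- (c x (x + sqrt e *\<^sub>R w) / e))) \<partial>lborel)"
    using e by (subst nn_integral_lborel_affine[of _ "sqrt e" x]) simp_all
  also have "(\<integral>\<^sup>+w. ennreal (exp (- (c x (x + sqrt e *\<^sub>R w) / e))) \<partial>lborel) = ennreal (normaliser c e x)"
    unfolding normaliser_def by (intro nn_integral_eq_integral normaliser_integrable[OF c e]) simp
  finally show ?thesis
    using e normaliser_bounds(3)[OF c e, of x] by (simp add: ennreal_mult)
qed

text \<open>Dominated convergence with the majorant \<open>exp (- (m * (w \<bullet> w)))\<close>;
  the pointwise limit is the Gaussian of the Hessian at \<open>x\<close>.\<close>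

lemma normaliser_tendsto:
  assumes c: "hessian_like c" and e: "\<And>n. 0 < e n" "e \<longlonglongrightarrow> 0"
  shows "(\<lambda>n. normaliser c (e n) x) \<longlonglongrightarrow> sqrt (pi ^ CARD('d) / det (H x))"
proof -
  note [measurable] = hessian_like_measurable[OF c]
  note g = gaussian_integral_posdef(2)[OF symmetric_posdef_hessian[of x]]
  have "(\<lambda>n. normaliser c (e n) x) \<longlonglongrightarrow> integral\<^sup>L lborel (\<lambda>w. exp (- (w \<bullet> (H x *v w))))"
    unfolding normaliser_def
  proof (rule integral_dominated_convergence)
    show "(\<lambda>w. exp (- (w \<bullet> (H x *v w)))) \<in> borel_measurable lborel"
      using g by (auto simp: has_bochner_integral_iff)
    show "integrable lborel (\<lambda>w :: real ^ 'd. exp (- (m * (w \<bullet> w))))"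
      using gaussian_m by (simp add: has_bochner_integral_iff)
    show "AE w in lborel. (\<lambda>n. exp (- (c x (x + sqrt (e n) *\<^sub>R w) / e n))) \<longlonglongrightarrow> exp (- (w \<bullet> (H x *v w)))"
      using c e by (intro AE_I2 tendsto_exp tendsto_minus) (auto simp: hessian_like_def)
    show "AE w in lborel. norm (exp (- (c x (x + sqrt (e n) *\<^sub>R w) / e n))) \<le> exp (- (m * (w \<bullet> w)))" for n
      using hessian_like_rescaled_bounds(1)[OF c e(1)] by simp
  qed measurable
  with g show ?thesis by (simp add: has_bochner_integral_iff)
qed

definition ln_normaliser_limit :: "real ^ 'd \<Rightarrow> real" where
  "ln_normaliser_limit x = (CARD('d) * ln pi - ln (det (H x))) / 2"

lemma ln_normaliser_tendsto:
  assumes c: "hessian_like c" and e: "\<And>n. 0 < e n" "e \<longlonglongrightarrow> 0"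
  shows "(\<lambda>n. ln (normaliser c (e n) x)) \<longlonglongrightarrow> ln_normaliser_limit x"
proof -
  have pos: "0 < pi ^ CARD('d) / det (H x)" using det_hessian_pos by simp
  have nz: "det (H x) \<noteq> 0" using det_hessian_pos[of x] by simp
  have "(\<lambda>n. ln (normaliser c (e n) x)) \<longlonglongrightarrow> ln (sqrt (pi ^ CARD('d) / det (H x)))"
    using pos by (intro tendsto_ln normaliser_tendsto assms) (simp_all add: nz)
  also have "ln (sqrt (pi ^ CARD('d) / det (H x))) = ln_normaliser_limit x"
    using pos by (simp add: nz ln_sqrt ln_div ln_realpow ln_normaliser_limit_def)
  finally show ?thesis .
qed

definition "ln_Z_bound = \<bar>ln Z_min\<bar> + \<bar>ln Z_max\<bar>"

lemma ln_normaliser_bound: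
  assumes "hessian_like c" "0 < e"
  shows "\<bar>ln (normaliser c e x)\<bar> \<le> ln_Z_bound"
proof -
  have "ln Z_min \<le> ln (normaliser c e x)" "ln (normaliser c e x) \<le> ln Z_max"
    using normaliser_bounds[OF assms, of x] Z_min_pos Z_max_pos by simp_all
  then show ?thesis unfolding ln_Z_bound_def by linarith
qed

end

section \<open>Integrated normalisers and dual potentials\<close>

context brenier_setting
begin

lemma prob_UNIV: "prob UNIV = 1"
  using prob_space by simp

lemma integrable_ln_normaliser:
  assumes "hessian_like c" "0 < e"
  shows "integrable \<mu> (\<lambda>x. ln (normaliser c e x))"
  using normaliser_measurable[OF assms(1), of e] ln_normaliser_bound[OF assms]
  by (intro integrable_const_bound[of _ ln_Z_bound]) auto

lemma integral_ln_normaliser_tendsto: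
  assumes c: "hessian_like c" and e: "\<And>n. 0 < e n" "e \<longlonglongrightarrow> 0"
  shows "(\<lambda>n. integral\<^sup>L \<mu> (\<lambda>x. ln (normaliser c (e n) x))) \<longlonglongrightarrow> integral\<^sup>L \<mu> ln_normaliser_limit"
proof (rule integral_dominated_convergence[where w = "\<lambda>_. ln_Z_bound"])
  show "ln_normaliser_limit \<in> borel_measurable \<mu>"
    unfolding ln_normaliser_limit_def by measurable
  show "(\<lambda>x. ln (normaliser c (e n) x)) \<in> borel_measurable \<mu>" for n
    using normaliser_measurable[OF c, of "e n"] by measurable
qed (use ln_normaliser_tendsto[OF c e] ln_normaliser_bound[OF c e(1)] in auto)

lemma integral_ln_normaliser_limit:
  "integral\<^sup>L \<mu> ln_normaliser_limit = (CARD('d) * ln pi - mean_log_det) / 2"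
  using integrable_ln_det by (simp add: ln_normaliser_limit_def[abs_def] mean_log_det_def prob_UNIV)

abbreviation "c\<^sub>1 \<equiv> \<lambda>x z. 2 * bregman x z"
abbreviation "c\<^sub>2 \<equiv> \<lambda>x z. 2 * bregman z x"

text \<open>The Bregman divergence is in general not symmetric, so each potential has its own
  normaliser: with \<open>c\<^sub>1\<close> the second argument of \<open>bregman\<close> is
  integrated out, with \<open>c\<^sub>2\<close> the first.\<close>

definition dual\<^sub>1 :: "real \<Rightarrow> real ^ 'd \<Rightarrow> real" where
  "dual\<^sub>1 e x = - (ln (\<rho> x) + ln (sqrt e ^ CARD('d) * normaliser c\<^sub>1 e x)) / 2"

definition dual\<^sub>2 :: "real \<Rightarrow> real ^ 'd \<Rightarrow> real" where
  "dual\<^sub>2 e z = - (ln (\<rho> z) + ln (sqrt e ^ CARD('d) * normaliser c\<^sub>2 e z)) / 2"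

lemmas normaliser_12_measurable [measurable] =
  normaliser_measurable[OF hessian_like_bregman] normaliser_measurable[OF hessian_like_bregman_swap]

lemma dual_measurable [measurable]:
  "dual\<^sub>1 e \<in> borel_measurable borel" "dual\<^sub>2 e \<in> borel_measurable borel"
  unfolding dual\<^sub>1_def dual\<^sub>2_def by measurable

text \<open>By the arithmetic-geometric mean inequality the Gibbs weight is dominated by the average of
  two kernels, each of which is normalised in one of the two variables.\<close>

lemma nn_integral_dual_le_1:
  assumes e: "0 < e"
  shows "(\<integral>\<^sup>+p. ennreal (exp (dual\<^sub>1 e (fst p) + dual\<^sub>2 e (T' (snd p)) - 2 * bregman (fst p) (T' (snd p)) / e))
      \<partial>(\<mu> \<Otimes>\<^sub>M \<nu>)) \<le> 1"
proof -
  let ?s = "sqrt e ^ CARD('d)"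
  let ?Z1 = "normaliser c\<^sub>1 e" and ?Z2 = "normaliser c\<^sub>2 e"
  let ?a = "\<lambda>x. \<rho> x / (?s * ?Z1 x)" and ?b = "\<lambda>z. \<rho> z / (?s * ?Z2 z)"
  let ?h = "\<lambda>x z. dual\<^sub>1 e x + dual\<^sub>2 e z - 2 * bregman x z / e"
  have s: "0 < ?s" using e by simp
  have Z: "0 < ?Z1 x" "0 < ?Z2 x" for x
    using normaliser_bounds(3)[OF hessian_like_bregman e] normaliser_bounds(3)[OF hessian_like_bregman_swap e] by auto
  have ab: "0 \<le> ?a x" "0 \<le> ?b x" for x
    using s Z[of x] lebesgue_density_nonneg[of x] by simp_all
  interpret nu: prob_space \<nu> by (rule nu.prob)
  have pw: "\<rho> x * (\<rho> z * exp (?h x z)) \<le> (?a x * exp (- (2 * bregman x z / e)) + ?b z * exp (- (2 * bregman x z / e))) / 2"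
    for x z
  proof (cases "\<rho> x = 0 \<or> \<rho> z = 0")
    case False
    then have pos: "0 < \<rho> x" "0 < \<rho> z"
      using lebesgue_density_nonneg[of x] lebesgue_density_nonneg[of z] by auto
    have "\<rho> x * exp (dual\<^sub>1 e x) = sqrt (?a x)" "\<rho> z * exp (dual\<^sub>2 e z) = sqrt (?b z)"
      using pos s Z[of x] Z[of z] by (simp_all only: dual\<^sub>1_def dual\<^sub>2_def mult_exp_half_ln mult_pos_pos)
    moreover have "\<rho> x * (\<rho> z * exp (?h x z))
        = (\<rho> x * exp (dual\<^sub>1 e x)) * (\<rho> z * exp (dual\<^sub>2 e z)) * exp (- (2 * bregman x z / e))"
      by (simp add: exp_add exp_diff exp_minus field_simps)
    moreover have "sqrt (?a x) * sqrt (?b z) \<le> (?a x + ?b z) / 2"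
      using arith_geo_mean_sqrt[OF ab(1)[of x] ab(2)[of z]] by (simp only: real_sqrt_mult)
    ultimately have "\<rho> x * (\<rho> z * exp (?h x z)) \<le> (?a x + ?b z) / 2 * exp (- (2 * bregman x z / e))"
      by (simp only: mult_right_mono exp_ge_zero)
    also have "\<dots> = (?a x * exp (- (2 * bregman x z / e)) + ?b z * exp (- (2 * bregman x z / e))) / 2"
      by (simp only: distrib_right times_divide_eq_left)
    finally show ?thesis .
  next
    case True
    have "0 \<le> ?a x * exp (- (2 * bregman x z / e))" "0 \<le> ?b z * exp (- (2 * bregman x z / e))"
      by (rule mult_nonneg_nonneg[OF ab(1) exp_ge_zero] mult_nonneg_nonneg[OF ab(2) exp_ge_zero])+
    then have "0 \<le> (?a x * exp (- (2 * bregman x z / e)) + ?b z * exp (- (2 * bregman x z / e))) / 2"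
      by (intro divide_nonneg_nonneg add_nonneg_nonneg) simp_all
    with True show ?thesis by (auto simp del: times_divide_eq_left)
  qed
  have A: "(\<integral>\<^sup>+z. ennreal (?a x * exp (- (2 * bregman x z / e))) \<partial>lborel) = ennreal (\<rho> x)" for x
  proof -
    have "(\<integral>\<^sup>+z. ennreal (?a x * exp (- (2 * bregman x z / e))) \<partial>lborel)
        = ennreal (?a x) * (\<integral>\<^sup>+z. ennreal (exp (- (2 * bregman x z / e))) \<partial>lborel)"
      by (simp only: ennreal_mult'[OF ab(1)]) (simp add: nn_integral_cmult)
    also have "\<dots> = ennreal (?a x * (?s * ?Z1 x))"
      using nn_integral_exp_cost[OF hessian_like_bregman e, of x] s Z[of x] ab[of x]
      by (simp only: ennreal_mult[symmetric] mult_nonneg_nonneg less_imp_le)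
    also have "?a x * (?s * ?Z1 x) = \<rho> x"
      using mult_pos_pos[OF s Z(1)[of x]] by (intro nonzero_eq_divide_eq[THEN iffD1, OF _ refl]) linarith
    finally show ?thesis .
  qed
  have B: "(\<integral>\<^sup>+x. ennreal (?b z * exp (- (2 * bregman x z / e))) \<partial>lborel) = ennreal (\<rho> z)" for z
  proof -
    have "(\<integral>\<^sup>+x. ennreal (?b z * exp (- (2 * bregman x z / e))) \<partial>lborel)
        = ennreal (?b z) * (\<integral>\<^sup>+x. ennreal (exp (- (2 * bregman x z / e))) \<partial>lborel)"
      by (simp only: ennreal_mult'[OF ab(2)]) (simp add: nn_integral_cmult)
    also have "\<dots> = ennreal (?b z * (?s * ?Z2 z))"
      using nn_integral_exp_cost[OF hessian_like_bregman_swap e, of z] s Z[of z] ab[of z]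
      by (simp only: ennreal_mult[symmetric] mult_nonneg_nonneg less_imp_le)
    also have "?b z * (?s * ?Z2 z) = \<rho> z"
      using mult_pos_pos[OF s Z(2)[of z]] by (intro nonzero_eq_divide_eq[THEN iffD1, OF _ refl]) linarith
    finally show ?thesis .
  qed
  have "(\<integral>\<^sup>+p. ennreal (exp (dual\<^sub>1 e (fst p) + dual\<^sub>2 e (T' (snd p)) - 2 * bregman (fst p) (T' (snd p)) / e))
      \<partial>(\<mu> \<Otimes>\<^sub>M \<nu>)) = (\<integral>\<^sup>+x. (\<integral>\<^sup>+y. ennreal (exp (?h x (T' y))) \<partial>\<nu>) \<partial>\<mu>)"
    by (subst nu.nn_integral_fst[symmetric]) simp_all
  \<comment> \<open>The push-forward along \<open>T\<close> cancels \<open>T'\<close>, so both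
    variables are distributed according to \<open>\<mu>\<close>.\<close>
  also have "\<dots> = (\<integral>\<^sup>+x. (\<integral>\<^sup>+z. ennreal (exp (?h x z)) \<partial>\<mu>) \<partial>\<mu>)"
    by (subst push[symmetric]) (simp add: nn_integral_distr)
  also have "\<dots> = (\<integral>\<^sup>+x. (\<integral>\<^sup>+z. ennreal (\<rho> x * (\<rho> z * exp (?h x z))) \<partial>lborel) \<partial>lborel)"
    by (simp add: nn_integral_eq nn_integral_cmult[symmetric] ennreal_mult lebesgue_density_nonneg)
  also have "\<dots> \<le> (\<integral>\<^sup>+x. (\<integral>\<^sup>+z. ennreal (1 / 2) * (ennreal (?a x * exp (- (2 * bregman x z / e)))
      + ennreal (?b z * exp (- (2 * bregman x z / e)))) \<partial>lborel) \<partial>lborel)"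
  proof (intro nn_integral_mono)
    fix x z
    have half: "0 \<le> 1 / (2 :: real)" by simp
    have "ennreal (\<rho> x * (\<rho> z * exp (?h x z)))
        \<le> ennreal (1 / 2 * (?a x * exp (- (2 * bregman x z / e)) + ?b z * exp (- (2 * bregman x z / e))))"
      using pw[of x z] by (intro ennreal_leI) simp
    also have "\<dots> = ennreal (1 / 2) * (ennreal (?a x * exp (- (2 * bregman x z / e)))
      + ennreal (?b z * exp (- (2 * bregman x z / e))))"
      by (simp only: ennreal_plus[OF mult_nonneg_nonneg[OF ab(1) exp_ge_zero] mult_nonneg_nonneg[OF ab(2) exp_ge_zero]]
          ennreal_mult'[OF half])
    finally show "ennreal (\<rho> x * (\<rho> z * exp (?h x z))) \<le> ennreal (1 / 2) * (ennreal (?a x * exp (- (2 * bregman x z / e)))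
      + ennreal (?b z * exp (- (2 * bregman x z / e))))" .
  qed
  also have "\<dots> = ennreal (1 / 2) * ((\<integral>\<^sup>+x. (\<integral>\<^sup>+z. ennreal (?a x * exp (- (2 * bregman x z / e))) \<partial>lborel) \<partial>lborel)
      + (\<integral>\<^sup>+x. (\<integral>\<^sup>+z. ennreal (?b z * exp (- (2 * bregman x z / e))) \<partial>lborel) \<partial>lborel))"
    by (simp add: nn_integral_cmult nn_integral_add)
  also have "(\<integral>\<^sup>+x. (\<integral>\<^sup>+z. ennreal (?b z * exp (- (2 * bregman x z / e))) \<partial>lborel) \<partial>lborel)
      = (\<integral>\<^sup>+z. (\<integral>\<^sup>+x. ennreal (?b z * exp (- (2 * bregman x z / e))) \<partial>lborel) \<partial>lborel)"
    by (rule lborel_pair.Fubini') simp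
  also have "ennreal (1 / 2) * ((\<integral>\<^sup>+x. (\<integral>\<^sup>+z. ennreal (?a x * exp (- (2 * bregman x z / e))) \<partial>lborel) \<partial>lborel) + \<dots>) = ennreal (1 / 2) * (1 + 1)"
    by (simp only: A B nn_integral_density_eq)
  also have "\<dots> = ennreal (1 / 2) * ennreal 2" by simp
  also have "\<dots> = ennreal (1 / 2 * 2)" by (rule ennreal_mult'[symmetric]) simp
  finally show ?thesis by simp
qed

definition lower_value :: "real \<Rightarrow> real" where
  "lower_value e = - integral\<^sup>L \<mu> (\<lambda>x. ln (\<rho> x)) - CARD('d) / 2 * ln e
     - integral\<^sup>L \<mu> (\<lambda>x. ln (normaliser c\<^sub>1 e x)) / 2 - integral\<^sup>L \<mu> (\<lambda>x. ln (normaliser c\<^sub>2 e x)) / 2"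

text \<open>The Bregman term in the exponent cancels, after multiplication by \<open>e\<close>, the
  excess cost of the coupling; what remains is a bound common to all couplings.\<close>

theorem EOT_lower_bound:
  assumes e: "0 < e" and ent: "integrable \<mu> (\<lambda>x. ln (\<rho> x))"
  shows "ereal (OT_value + e * lower_value e) \<le> EOT e \<mu> \<nu>"
  unfolding EOT_def
proof (rule INF_greatest)
  fix \<gamma> assume \<gamma>: "\<gamma> \<in> couplings \<mu> \<nu>"
  note [measurable] = couplings_borel(3,4)[OF \<gamma>]
  interpret nu: prob_space \<nu> by (rule nu.prob)
  interpret P: pair_prob_space \<mu> \<nu> ..
  let ?B = "integral\<^sup>L \<gamma> (\<lambda>z. bregman (fst z) (T' (snd z)))"
  let ?h = "\<lambda>p. dual\<^sub>1 e (fst p) + dual\<^sub>2 e (T' (snd p)) - 2 * bregman (fst p) (T' (snd p)) / e"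
  have ln_s: "ln (sqrt e ^ CARD('d)) = CARD('d) / 2 * ln e"
    using e by (simp add: ln_realpow ln_sqrt)
  have d1: "dual\<^sub>1 e = (\<lambda>x. - (ln (\<rho> x) + (CARD('d) / 2 * ln e + ln (normaliser c\<^sub>1 e x))) / 2)"
    using e less_imp_neq[OF normaliser_bounds(3)[OF hessian_like_bregman e]]
    by (simp add: fun_eq_iff dual\<^sub>1_def ln_mult ln_s less_imp_neq[symmetric])
  have d2: "dual\<^sub>2 e = (\<lambda>x. - (ln (\<rho> x) + (CARD('d) / 2 * ln e + ln (normaliser c\<^sub>2 e x))) / 2)"
    using e less_imp_neq[OF normaliser_bounds(3)[OF hessian_like_bregman_swap e]]
    by (simp add: fun_eq_iff dual\<^sub>2_def ln_mult ln_s less_imp_neq[symmetric])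
  note ints = ent integrable_ln_normaliser[OF hessian_like_bregman e] integrable_ln_normaliser[OF hessian_like_bregman_swap e]
  have i: "integrable \<mu> (dual\<^sub>1 e)" "integrable \<mu> (dual\<^sub>2 e)"
    using ints unfolding d1 d2 by auto
  have sum: "integral\<^sup>L \<mu> (dual\<^sub>1 e) + integral\<^sup>L \<mu> (dual\<^sub>2 e) = lower_value e"
    using ints unfolding d1 d2 lower_value_def by (simp add: prob_UNIV field_simps)
  have h1: "has_bochner_integral \<gamma> (\<lambda>p. dual\<^sub>1 e (fst p)) (integral\<^sup>L \<mu> (dual\<^sub>1 e))"
    using i by (subst coupling_marginal_integral(1)[OF \<gamma>]) (auto simp: has_bochner_integral_iff)
  have h2: "has_bochner_integral \<gamma> (\<lambda>p. dual\<^sub>2 e (T' (snd p))) (integral\<^sup>L \<mu> (dual\<^sub>2 e))"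
    using i by (subst coupling_marginal_integral(2)[OF \<gamma>, of "\<lambda>y. dual\<^sub>2 e (T' y)"], simp, subst nu_has_bochner_integral)
      (auto simp: has_bochner_integral_iff)
  have h3: "has_bochner_integral \<gamma> (\<lambda>p. 2 * bregman (fst p) (T' (snd p)) / e) (2 * ?B / e)"
    using quadratic_cost_coupling(1)[OF \<gamma>] by (simp add: has_bochner_integral_iff)
  have h: "has_bochner_integral \<gamma> ?h (lower_value e - 2 * ?B / e)"
    unfolding sum[symmetric] by (intro has_bochner_integral_diff has_bochner_integral_add h1 h2 h3)
  have "ereal (integral\<^sup>L \<gamma> ?h) \<le> KL \<gamma> (\<mu> \<Otimes>\<^sub>M \<nu>)"
  proof (rule KL_ge_Gibbs[OF P.prob_space_axioms couplings_borel(1)[OF \<gamma>]])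
    have "sets (\<mu> \<Otimes>\<^sub>M \<nu>) = sets (borel :: ((real ^ 'd) \<times> (real ^ 'd)) measure)"
      unfolding borel_prod[symmetric] by (intro sets_pair_measure_cong) simp_all
    then show "sets \<gamma> = sets (\<mu> \<Otimes>\<^sub>M \<nu>)"
      by (simp only: couplings_borel(2)[OF \<gamma>])
    show "?h \<in> borel_measurable (\<mu> \<Otimes>\<^sub>M \<nu>)" by measurable
  qed (use nn_integral_dual_le_1[OF e] h in \<open>auto simp: has_bochner_integral_iff\<close>)
  also have "integral\<^sup>L \<gamma> ?h = lower_value e - 2 * ?B / e"
    using h by (rule has_bochner_integral_integral_eq)
  finally have "ereal e * ereal (lower_value e - 2 * ?B / e) \<le> ereal e * KL \<gamma> (\<mu> \<Otimes>\<^sub>M \<nu>)"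
    using e by (intro ereal_mult_left_mono) auto
  then have "ereal (OT_value + 2 * ?B) + ereal (e * (lower_value e - 2 * ?B / e))
      \<le> quadratic_cost \<gamma> + ereal e * KL \<gamma> (\<mu> \<Otimes>\<^sub>M \<nu>)"
    unfolding quadratic_cost_coupling(2)[OF \<gamma>] by (intro add_left_mono) simp
  then show "ereal (OT_value + e * lower_value e) \<le> quadratic_cost \<gamma> + ereal e * KL \<gamma> (\<mu> \<Otimes>\<^sub>M \<nu>)"
    using e by (simp add: right_diff_distrib)
qed

end

section \<open>The upper bound\<close>

text \<open>The left inverse \<open>\<Psi>\<close> makes the two densities agree along
  \<open>\<Phi>\<close>, so the entropies coincide. This moves the entropy of a self-coupling of
  \<open>\<mu>\<close> to a coupling of \<open>\<mu>\<close> and \<open>\<nu>\<close>.\<close>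

lemma KL_distr:
  assumes R: "sigma_finite_measure R" and \<Phi>: "\<Phi> \<in> measurable R N" and \<Psi>: "\<Psi> \<in> measurable N R"
    and inv: "\<And>x. x \<in> space R \<Longrightarrow> \<Psi> (\<Phi> x) = x"
    and ac: "absolutely_continuous R \<gamma>" and sets: "sets \<gamma> = sets R"
  shows "KL (distr \<gamma> N \<Phi>) (distr R N \<Phi>) = KL \<gamma> R"
proof -
  have \<Phi>': "\<Phi> \<in> measurable \<gamma> N" using \<Phi> by (simp add: measurable_cong_sets[OF sets refl])
  have sp: "space \<gamma> = space R" by (rule sets_eq_imp_space_eq[OF sets])
  have ac': "absolutely_continuous (distr R N \<Phi>) (distr \<gamma> N \<Phi>)"
    unfolding absolutely_continuous_def
  proof
    fix A assume "A \<in> null_sets (distr R N \<Phi>)"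
    then have A: "A \<in> sets N" "\<Phi> -` A \<inter> space R \<in> null_sets R"
      using \<Phi> by (auto simp: null_sets_distr_iff)
    with ac have "\<Phi> -` A \<inter> space \<gamma> \<in> null_sets \<gamma>"
      by (auto simp: absolutely_continuous_def sp)
    with A \<Phi>' show "A \<in> null_sets (distr \<gamma> N \<Phi>)"
      by (simp add: null_sets_distr_iff)
  qed
  have "AE x in R. RN_deriv (distr R N \<Phi>) (distr \<gamma> N \<Phi>) (\<Phi> x) = RN_deriv R \<gamma> x"
    using sigma_finite_measure.RN_deriv_distr[OF R \<Phi> \<Psi> _ ac' sets] inv by blast
  then have AE: "AE x in \<gamma>. RN_deriv (distr R N \<Phi>) (distr \<gamma> N \<Phi>) (\<Phi> x) = RN_deriv R \<gamma> x"
    by (rule absolutely_continuous_AE[OF sets ac])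
  have "ext_integral (distr \<gamma> N \<Phi>) (\<lambda>x. ln (enn2real (RN_deriv (distr R N \<Phi>) (distr \<gamma> N \<Phi>) x)))
      = ext_integral \<gamma> (\<lambda>x. ln (enn2real (RN_deriv (distr R N \<Phi>) (distr \<gamma> N \<Phi>) (\<Phi> x))))"
  proof (rule ext_integral_distr[OF \<Phi>'])
    have [measurable]: "RN_deriv (distr R N \<Phi>) (distr \<gamma> N \<Phi>) \<in> borel_measurable N"
      using borel_measurable_RN_deriv[of "distr R N \<Phi>"] by simp
    show "(\<lambda>x. ln (enn2real (RN_deriv (distr R N \<Phi>) (distr \<gamma> N \<Phi>) x))) \<in> borel_measurable N"
      by measurable
  qed
  also have "\<dots> = ext_integral \<gamma> (\<lambda>x. ln (enn2real (RN_deriv R \<gamma> x)))"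
    by (rule ext_integral_cong_AE) (use AE in \<open>auto elim: eventually_mono\<close>)
  finally show ?thesis using ac ac' sets by (simp add: KL_def)
qed

section \<open>The Metropolis kernel\<close>

context brenier_setting
begin

abbreviation "Z\<^sub>s \<equiv> normaliser symmetric_cost"

lemmas symmetric_cost_measurable [measurable (raw)] = hessian_like_measurable[OF hessian_like_symmetric_cost]
lemmas Zs_measurable [measurable] = normaliser_measurable[OF hessian_like_symmetric_cost]

lemma symmetric_cost_commute: "symmetric_cost x z = symmetric_cost z x"
  by (simp add: symmetric_cost_def)

lemma symmetric_cost_le: "symmetric_cost x z \<le> M * (norm (x - z))\<^sup>2"
  using hessian_like_symmetric_cost by (auto simp: hessian_like_def)

text \<open>Makes \<open>rate e x * exp (- (symmetric_cost x z / e))\<close> a probability density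
  in \<open>z\<close>, the proposal of the Metropolis chain.\<close>

definition rate :: "real \<Rightarrow> real ^ 'd \<Rightarrow> real" where
  "rate e x = 1 / (sqrt e ^ CARD('d) * Z\<^sub>s e x)"

text \<open>A density with respect to \<open>\<mu> \<Otimes>\<^sub>M \<mu>\<close>, hence the
  divisions. Multiplied by \<open>\<rho> x * \<rho> z\<close>, the minimum becomes the smaller of
  the values of \<open>\<rho> * rate\<close> at the two points, which gives detailed balance. Where
  a density is 0, so is the minimum, since division by 0 gives 0.\<close>

definition kernel :: "real \<Rightarrow> (real ^ 'd) \<times> (real ^ 'd) \<Rightarrow> real" where
  "kernel e p = min (rate e (fst p) / \<rho> (snd p)) (rate e (snd p) / \<rho> (fst p))
     * exp (- (symmetric_cost (fst p) (snd p) / e))"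

text \<open>With side \<open>sqrt e\<close> the cost divided by \<open>e\<close> stays bounded in a
  cell, and the logarithm of its volume is \<open>CARD('d) / 2 * ln e\<close>, which matches the
  term in \<open>ln_rate\<close>.\<close>

definition cell :: "real \<Rightarrow> real ^ 'd \<Rightarrow> int ^ 'd" where
  "cell e x = (\<chi> i. \<lfloor>x $ i / sqrt e\<rfloor>)"

lemma rate_measurable [measurable]: "rate e \<in> borel_measurable borel"
  unfolding rate_def by measurable

lemma rate_pos: "0 < e \<Longrightarrow> 0 < rate e x"
  using normaliser_bounds(3)[OF hessian_like_symmetric_cost] by (simp add: rate_def)

lemma nn_integral_rate:
  assumes e: "0 < e"
  shows "(\<integral>\<^sup>+z. ennreal (rate e x * exp (- (symmetric_cost x z / e))) \<partial>lborel) = 1"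
proof -
  let ?t = "sqrt e ^ CARD('d) * Z\<^sub>s e x"
  have t: "0 < ?t" using e normaliser_bounds(3)[OF hessian_like_symmetric_cost e, of x] by simp
  have "(\<integral>\<^sup>+z. ennreal (rate e x * exp (- (symmetric_cost x z / e))) \<partial>lborel)
      = ennreal (rate e x) * (\<integral>\<^sup>+z. ennreal (exp (- (symmetric_cost x z / e))) \<partial>lborel)"
    using rate_pos[OF e, of x] by (simp add: ennreal_mult' nn_integral_cmult)
  also have "\<dots> = ennreal (rate e x) * ennreal ?t"
    by (simp only: nn_integral_exp_cost[OF hessian_like_symmetric_cost e])
  also have "\<dots> = ennreal (rate e x * ?t)"
    using rate_pos[OF e, of x] by (intro ennreal_mult'[symmetric]) simp
  also have "rate e x * ?t = 1"
    unfolding rate_def using t by (intro nonzero_eq_divide_eq[THEN iffD1, OF _ refl]) linarith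
  finally show ?thesis by simp
qed

lemma kernel_measurable [measurable]: "kernel e \<in> borel_measurable (\<mu> \<Otimes>\<^sub>M \<mu>)"
  unfolding kernel_def by measurable

lemma kernel_nonneg: "0 < e \<Longrightarrow> 0 \<le> kernel e p"
  unfolding kernel_def using rate_pos lebesgue_density_nonneg
  by (intro mult_nonneg_nonneg) (auto simp: less_imp_le)

lemma kernel_commute: "kernel e (x, z) = kernel e (z, x)"
  by (simp add: kernel_def symmetric_cost_commute[of x z] min.commute)

lemma density_mult_kernel:
  assumes "0 < e"
  shows "\<rho> x * (\<rho> z * kernel e (x, z)) = min (\<rho> x * rate e x) (\<rho> z * rate e z) * exp (- (symmetric_cost x z / e))"
proof (cases "\<rho> x = 0 \<or> \<rho> z = 0")
  case False
  then have "0 < \<rho> x" "0 < \<rho> z" using lebesgue_density_nonneg[of x] lebesgue_density_nonneg[of z] by auto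
  then have "\<rho> x * \<rho> z * min (rate e x / \<rho> z) (rate e z / \<rho> x) = min (\<rho> x * rate e x) (\<rho> z * rate e z)"
    by (simp add: min_mult_distrib_left mult.commute)
  then show ?thesis by (simp add: kernel_def mult.assoc[symmetric])
next
  case True
  have "0 \<le> \<rho> x * rate e x" "0 \<le> \<rho> z * rate e z"
    using rate_pos[OF assms] lebesgue_density_nonneg by (simp_all add: less_imp_le)
  with True show ?thesis by (auto simp: min_def)
qed

lemma cell_measurable [measurable]: "cell e \<in> measurable borel (count_space UNIV)"
proof (subst measurable_count_space_eq2_countable, intro conjI ballI)
  fix c :: "int ^ 'd"
  have "cell e -` {c} \<inter> space borel = {x. \<forall>i. \<lfloor>x $ i / sqrt e\<rfloor> = c $ i}"
    by (auto simp: cell_def vec_eq_iff)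
  also have "\<dots> \<in> sets borel" by measurable
  finally show "cell e -` {c} \<inter> space borel \<in> sets borel" .
qed auto

lemma symmetric_subkernel_kernel:
  assumes e: "0 < e"
  shows "symmetric_subkernel \<mu> (kernel e) (cell e)"
proof
  show "(\<integral>\<^sup>+y. ennreal (kernel e (x, y)) \<partial>\<mu>) \<le> 1" for x
  proof -
    have "(\<integral>\<^sup>+y. ennreal (kernel e (x, y)) \<partial>\<mu>) = (\<integral>\<^sup>+y. ennreal (\<rho> y) * ennreal (kernel e (x, y)) \<partial>lborel)"
      unfolding kernel_def by (subst nn_integral_eq) simp_all
    also have "\<dots> \<le> (\<integral>\<^sup>+y. ennreal (rate e x * exp (- (symmetric_cost x y / e))) \<partial>lborel)"
    proof (intro nn_integral_mono)
      fix y
      \<comment> \<open>The first entry of the minimum already leaves the normalised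
        proposal.\<close>
      have "\<rho> y * min (rate e x / \<rho> y) (rate e y / \<rho> x) \<le> \<rho> y * (rate e x / \<rho> y)"
        by (intro mult_left_mono lebesgue_density_nonneg) simp
      also have "\<dots> \<le> rate e x" using rate_pos[OF e, of x] by simp
      finally have "\<rho> y * kernel e (x, y) \<le> rate e x * exp (- (symmetric_cost x y / e))"
        by (simp add: kernel_def mult.assoc[symmetric])
      then show "ennreal (\<rho> y) * ennreal (kernel e (x, y)) \<le> ennreal (rate e x * exp (- (symmetric_cost x y / e)))"
        by (simp add: ennreal_mult'[symmetric, OF lebesgue_density_nonneg] ennreal_leI)
    qed
    finally show ?thesis by (simp add: nn_integral_rate[OF e])
  qed
qed (use kernel_nonneg[OF e] in \<open>auto intro: kernel_commute simp: measurable_cong_sets[OF sets_eq refl]\<close>)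

section \<open>The missing mass\<close>

definition loss :: "real \<Rightarrow> real ^ 'd \<Rightarrow> real" where
  "loss e = symmetric_subkernel.deficit \<mu> (kernel e)"

lemma loss_bounds: "0 < e \<Longrightarrow> 0 \<le> loss e x" "0 < e \<Longrightarrow> loss e x \<le> 1"
  unfolding loss_def
  by (simp_all add: symmetric_subkernel.deficit_nonneg[OF symmetric_subkernel_kernel]
      symmetric_subkernel.deficit_le[OF symmetric_subkernel_kernel])

lemma loss_measurable: "0 < e \<Longrightarrow> loss e \<in> borel_measurable borel"
  unfolding loss_def
  using symmetric_subkernel.deficit_measurable[OF symmetric_subkernel_kernel]
  by (simp add: measurable_cong_sets[OF sets_eq refl])

text \<open>The proposal has mass 1, and the minimum removes the positive part of the difference of
  \<open>\<rho> * rate\<close> between \<open>x\<close> and \<open>z\<close>. After rescaling, the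
  powers of \<open>sqrt e\<close> in \<open>rate\<close> and in the Jacobian cancel.\<close>

lemma density_mult_loss:
  assumes e: "0 < e"
  shows "ennreal (\<rho> x * loss e x) = (\<integral>\<^sup>+w. ennreal (\<rho> x / Z\<^sub>s e x - \<rho> (x + sqrt e *\<^sub>R w) / Z\<^sub>s e (x + sqrt e *\<^sub>R w))
     * ennreal (exp (- (symmetric_cost x (x + sqrt e *\<^sub>R w) / e))) \<partial>lborel)"
proof -
  interpret K: symmetric_subkernel \<mu> "kernel e" "cell e" by (rule symmetric_subkernel_kernel[OF e])
  let ?E = "\<lambda>z. exp (- (symmetric_cost x z / e))"
  let ?u = "\<lambda>x. \<rho> x * rate e x"
  have u: "0 \<le> ?u z" for z
    using rate_pos[OF e, of z] lebesgue_density_nonneg[of z] by simp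
  let ?I = "\<integral>\<^sup>+z. ennreal (?u x - ?u z) * ennreal (?E z) \<partial>lborel"
  have "ennreal (\<rho> x) = ennreal (\<rho> x) * (\<integral>\<^sup>+z. ennreal (rate e x * ?E z) \<partial>lborel)"
    by (simp add: nn_integral_rate[OF e])
  also have "\<dots> = (\<integral>\<^sup>+z. ennreal (?u x * ?E z) \<partial>lborel)"
    by (simp add: nn_integral_cmult[symmetric] ennreal_mult'[symmetric, OF lebesgue_density_nonneg] mult.assoc)
  also have "\<dots> = (\<integral>\<^sup>+z. ennreal (min (?u x) (?u z) * ?E z) + ennreal (?u x - ?u z) * ennreal (?E z) \<partial>lborel)"
  proof (intro nn_integral_cong)
    fix z
    show "ennreal (?u x * ?E z) = ennreal (min (?u x) (?u z) * ?E z) + ennreal (?u x - ?u z) * ennreal (?E z)"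
    proof (cases "?u z \<le> ?u x")
      case True
      then have "ennreal (min (?u x) (?u z) * ?E z) + ennreal (?u x - ?u z) * ennreal (?E z)
          = ennreal (?u z * ?E z + (?u x - ?u z) * ?E z)"
        using u[of z] by (simp add: ennreal_plus ennreal_mult'' min_absorb2 del: )
      then show ?thesis by (simp add: algebra_simps)
    next
      case False
      then show ?thesis by (simp add: ennreal_neg min_absorb1)
    qed
  qed
  also have "\<dots> = (\<integral>\<^sup>+z. ennreal (min (?u x) (?u z) * ?E z) \<partial>lborel) + ?I"
    by (subst nn_integral_add) simp_all
  also have "(\<integral>\<^sup>+z. ennreal (min (?u x) (?u z) * ?E z) \<partial>lborel) = ennreal (\<rho> x) * (\<integral>\<^sup>+z. ennreal (kernel e (x, z)) \<partial>\<mu>)"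
  proof -
    have [measurable]: "(\<lambda>z. kernel e (x, z)) \<in> borel_measurable borel"
      unfolding kernel_def fst_conv snd_conv by measurable
    show ?thesis
      by (subst nn_integral_eq)
         (simp_all add: density_mult_kernel[OF e, symmetric] nn_integral_cmult[symmetric]
           ennreal_mult'[OF lebesgue_density_nonneg])
  qed
  also have "\<dots> = ennreal (\<rho> x * (1 - loss e x))"
    using lebesgue_density_nonneg loss_bounds[OF e]
    by (subst K.nn_integral_r1) (simp add: loss_def[symmetric] ennreal_mult)
  finally have h: "ennreal (\<rho> x) = ennreal (\<rho> x * (1 - loss e x)) + ?I" .
  have "ennreal (\<rho> x) = ennreal (\<rho> x * (1 - loss e x) + \<rho> x * loss e x)"
    by (simp add: algebra_simps)
  also have "\<dots> = ennreal (\<rho> x * (1 - loss e x)) + ennreal (\<rho> x * loss e x)"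
    using lebesgue_density_nonneg[of x] loss_bounds[OF e, of x] by (intro ennreal_plus) auto
  finally have "ennreal (\<rho> x * (1 - loss e x)) + ennreal (\<rho> x * loss e x) = ennreal (\<rho> x * (1 - loss e x)) + ?I"
    by (rule trans[OF sym h])
  \<comment> \<open>The common summand is finite, so it can be cancelled in
    \<open>ennreal\<close>.\<close>
  then have "ennreal (\<rho> x * loss e x) = ?I"
    by (subst (asm) ennreal_add_left_cancel) simp
  also have "?I = ennreal (sqrt e ^ CARD('d)) * (\<integral>\<^sup>+w. ennreal (?u x - ?u (x + sqrt e *\<^sub>R w)) * ennreal (?E (x + sqrt e *\<^sub>R w)) \<partial>lborel)"
    using e by (subst nn_integral_lborel_affine[of _ "sqrt e" x]) simp_all
  also have "\<dots> = (\<integral>\<^sup>+w. ennreal (sqrt e ^ CARD('d)) * ennreal (?u x - ?u (x + sqrt e *\<^sub>R w)) * ennreal (?E (x + sqrt e *\<^sub>R w)) \<partial>lborel)"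
    by (simp add: nn_integral_cmult mult.assoc)
  also have "\<dots> = (\<integral>\<^sup>+w. ennreal (\<rho> x / Z\<^sub>s e x - \<rho> (x + sqrt e *\<^sub>R w) / Z\<^sub>s e (x + sqrt e *\<^sub>R w))
     * ennreal (?E (x + sqrt e *\<^sub>R w)) \<partial>lborel)"
  proof (intro nn_integral_cong arg_cong2[where f = "(*)"] refl)
    fix w
    have "sqrt e ^ CARD('d) * ?u z = \<rho> z / Z\<^sub>s e z" for z
      using e normaliser_bounds(3)[OF hessian_like_symmetric_cost e, of z] by (simp add: rate_def)
    then show "ennreal (sqrt e ^ CARD('d)) * ennreal (?u x - ?u (x + sqrt e *\<^sub>R w))
        = ennreal (\<rho> x / Z\<^sub>s e x - \<rho> (x + sqrt e *\<^sub>R w) / Z\<^sub>s e (x + sqrt e *\<^sub>R w))"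
      using e by (subst ennreal_mult'[symmetric]) (simp_all add: right_diff_distrib)
  qed
  finally show ?thesis .
qed

text \<open>The exponential is replaced by a Gaussian weight independent of \<open>e\<close> and
  \<open>x\<close>, as \<open>translation_defect\<close> demands.\<close>

lemma nn_integral_loss_le:
  assumes e: "0 < e"
  shows "(\<integral>\<^sup>+x. ennreal (loss e x) \<partial>\<mu>)
    \<le> translation_defect (\<lambda>w. exp (- (m * (w \<bullet> w)))) (sqrt e) (\<lambda>x. \<rho> x / Z\<^sub>s e x)"
proof -
  note [measurable] = loss_measurable[OF e]
  have "(\<integral>\<^sup>+x. ennreal (loss e x) \<partial>\<mu>) = (\<integral>\<^sup>+x. ennreal (\<rho> x * loss e x) \<partial>lborel)"
    by (subst nn_integral_eq) (simp_all add: ennreal_mult'[OF lebesgue_density_nonneg])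
  also have "\<dots> \<le> translation_defect (\<lambda>w. exp (- (m * (w \<bullet> w)))) (sqrt e) (\<lambda>x. \<rho> x / Z\<^sub>s e x)"
    unfolding density_mult_loss[OF e] translation_defect_def
    using hessian_like_rescaled_bounds(1)[OF hessian_like_symmetric_cost e]
    by (intro nn_integral_mono mult_left_mono ennreal_leI) simp_all
  finally show ?thesis .
qed

text \<open>The function \<open>\<rho> x / Z\<^sub>s e x\<close> varies with \<open>e\<close>, so
  continuity of translations is applied to its limit instead. Domination by
  \<open>\<rho> x / Z_min\<close> gives convergence in L^1, and
  \<open>translation_defect_perturb\<close> pays for the exchange.\<close>

lemma integral_loss_tendsto_0:
  assumes e: "\<And>n. 0 < e n" "e \<longlonglongrightarrow> 0"
  shows "(\<lambda>n. integral\<^sup>L \<mu> (loss (e n))) \<longlonglongrightarrow> 0"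
proof -
  let ?f = "\<lambda>n x. \<rho> x / Z\<^sub>s (e n) x" and ?g = "\<lambda>x. \<rho> x / sqrt (pi ^ CARD('d) / det (H x))"
  let ?k = "\<lambda>w :: real ^ 'd. exp (- (m * (w \<bullet> w)))"
  have L: "0 < sqrt (pi ^ CARD('d) / det (H x))" for x using det_hessian_pos[of x] by simp
  have Zge: "Z_min \<le> sqrt (pi ^ CARD('d) / det (H x))" for x
    using normaliser_bounds(1)[OF hessian_like_symmetric_cost e(1)]
    by (intro LIMSEQ_le_const[OF normaliser_tendsto[OF hessian_like_symmetric_cost e]]) auto
  have div_le: "\<rho> x / t \<le> \<rho> x / Z_min" if "Z_min \<le> t" for x t
    using that Z_min_pos lebesgue_density_nonneg[of x] by (intro divide_left_mono) auto
  have ip: "integrable lborel (\<lambda>x. \<rho> x / Z_min)"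
    using integrable_density_lborel by simp
  have g: "integrable lborel ?g"
  proof (rule Bochner_Integration.integrable_bound[OF ip])
    have "norm (?g x) \<le> norm (\<rho> x / Z_min)" for x
      using div_le[OF Zge[of x], of x] divide_nonneg_pos[OF lebesgue_density_nonneg[of x] L[of x]]
      unfolding real_norm_def by linarith
    then show "AE x in lborel. norm (?g x) \<le> norm (\<rho> x / Z_min)" by simp
  qed simp
  have K: "(\<integral>\<^sup>+w. ennreal (?k w) \<partial>lborel) = ennreal Z_max"
    using gaussian_m by (simp add: has_bochner_integral_iff nn_integral_eq_integral)
  have conv: "(\<lambda>n. \<integral>\<^sup>+x. ennreal \<bar>?f n x - ?g x\<bar> \<partial>lborel) \<longlonglongrightarrow> (\<integral>\<^sup>+x. 0 \<partial>(lborel :: (real ^ 'd) measure))"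
  proof (rule nn_integral_dominated_convergence[where u' = "\<lambda>_. 0" and w = "\<lambda>x. ennreal (\<rho> x / Z_min)"])
    show "AE x in lborel. ennreal \<bar>?f n x - ?g x\<bar> \<le> ennreal (\<rho> x / Z_min)" for n
    proof (intro AE_I2 ennreal_leI)
      fix x
      have "0 \<le> ?f n x" "?f n x \<le> \<rho> x / Z_min" "0 \<le> ?g x" "?g x \<le> \<rho> x / Z_min"
        using normaliser_bounds(1,3)[OF hessian_like_symmetric_cost e(1), of n x] Zge[of x] L[of x] lebesgue_density_nonneg[of x]
        by (auto intro!: div_le divide_nonneg_nonneg simp: less_imp_le)
      then show "\<bar>?f n x - ?g x\<bar> \<le> \<rho> x / Z_min" by linarith
    qed
    show "(\<integral>\<^sup>+x. ennreal (\<rho> x / Z_min) \<partial>lborel) < \<infinity>"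
      using ip Z_min_pos lebesgue_density_nonneg
      by (subst nn_integral_eq_integral) auto
    show "AE x in lborel. (\<lambda>n. ennreal \<bar>?f n x - ?g x\<bar>) \<longlonglongrightarrow> 0"
    proof (intro AE_I2)
      fix x
      have "(\<lambda>n. \<bar>?f n x - ?g x\<bar>) \<longlonglongrightarrow> \<bar>?g x - ?g x\<bar>"
        using L[of x] by (intro tendsto_intros normaliser_tendsto[OF hessian_like_symmetric_cost e]) auto
      then show "(\<lambda>n. ennreal \<bar>?f n x - ?g x\<bar>) \<longlonglongrightarrow> 0"
        using tendsto_ennrealI by fastforce
    qed
  qed measurable
  have s: "(\<lambda>n. sqrt (e n)) \<longlonglongrightarrow> 0"
    using tendsto_real_sqrt[OF e(2)] by simp
  have d: "(\<lambda>n. translation_defect ?k (sqrt (e n)) ?g) \<longlonglongrightarrow> 0"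
    using lebesgue_density_nonneg L K
    by (intro translation_defect_tendsto_0 g s) (auto simp: less_imp_le)
  have "(\<lambda>n. ennreal Z_max * (2 * (\<integral>\<^sup>+x. ennreal \<bar>?f n x - ?g x\<bar> \<partial>lborel))) \<longlonglongrightarrow> ennreal Z_max * (2 * 0)"
    using conv by (intro ennreal_tendsto_cmult) simp_all
  from tendsto_add[OF d this]
  have b: "(\<lambda>n. translation_defect ?k (sqrt (e n)) ?g + 2 * (\<integral>\<^sup>+x. ennreal \<bar>?f n x - ?g x\<bar> \<partial>lborel) * ennreal Z_max) \<longlonglongrightarrow> 0"
    by (simp add: mult.commute)
  have le: "(\<integral>\<^sup>+x. ennreal (loss (e n) x) \<partial>\<mu>) \<le> translation_defect ?k (sqrt (e n)) ?g
      + 2 * (\<integral>\<^sup>+x. ennreal \<bar>?f n x - ?g x\<bar> \<partial>lborel) * ennreal Z_max" for n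
    using order_trans[OF nn_integral_loss_le[OF e(1)] translation_defect_perturb[of "?f n" ?g ?k "sqrt (e n)"]]
    unfolding K by simp
  have "(\<lambda>n. \<integral>\<^sup>+x. ennreal (loss (e n) x) \<partial>\<mu>) \<longlonglongrightarrow> 0"
    by (rule tendsto_ennreal_0_le[OF b le])
  moreover have "(\<integral>\<^sup>+x. ennreal (loss (e n) x) \<partial>\<mu>) = ennreal (integral\<^sup>L \<mu> (loss (e n)))" for n
    using loss_bounds[OF e(1)] loss_measurable[OF e(1)]
    by (intro nn_integral_eq_integral integrable_const_bound[of _ 1]) auto
  ultimately have "(\<lambda>n. ennreal (integral\<^sup>L \<mu> (loss (e n)))) \<longlonglongrightarrow> ennreal 0" by simp
  then show ?thesis
    by (rule tendsto_ennrealD) (auto intro!: always_eventually integral_nonneg_AE loss_bounds[OF e(1)])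
qed

end

lemma norm_sq_le_two: "(norm y)\<^sup>2 \<le> 2 * (norm x)\<^sup>2 + 2 * (norm (x - y))\<^sup>2" for x y :: "'a::real_inner"
proof -
  have "2 * (norm x)\<^sup>2 + 2 * (norm (x - y))\<^sup>2 - (norm y)\<^sup>2 = (norm (2 *\<^sub>R x - y))\<^sup>2"
    by (simp add: power2_norm_eq_inner inner_simps inner_commute)
  then show ?thesis using zero_le_power2[of "norm (2 *\<^sub>R x - y)"] by linarith
qed

section \<open>Gaussian masses of the cells and the coupling estimate\<close>

context brenier_setting
begin

lemma same_cell_dist:
  assumes e: "0 < e" and "cell e x = cell e y"
  shows "(norm (x - y))\<^sup>2 \<le> real CARD('d) * e"
proof -
  have le: "(x $ i - y $ i)\<^sup>2 \<le> e" for i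
  proof -
    have "\<lfloor>x $ i / sqrt e\<rfloor> = \<lfloor>y $ i / sqrt e\<rfloor>"
      using assms(2) by (simp add: cell_def vec_eq_iff)
    then have "\<bar>x $ i / sqrt e - y $ i / sqrt e\<bar> \<le> 1" by linarith
    then have "\<bar>x $ i - y $ i\<bar> \<le> sqrt e"
      using e by (simp add: diff_divide_distrib[symmetric] abs_divide)
    then have "\<bar>x $ i - y $ i\<bar>\<^sup>2 \<le> (sqrt e)\<^sup>2" by (intro power_mono) auto
    then show ?thesis using e by simp
  qed
  have "(norm (x - y))\<^sup>2 = (\<Sum>i\<in>UNIV. (x $ i - y $ i)\<^sup>2)"
    by (subst power2_norm_eq_inner) (simp add: inner_vec_def power2_eq_square)
  also have "\<dots> \<le> of_nat (card (UNIV :: 'd set)) * e"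
    by (rule sum_bounded_above) (rule le)
  finally show ?thesis by simp
qed

text \<open>Reference measure for the cells: it is finite, and the negative logarithms of its cell
  masses grow at most quadratically in \<open>x\<close>, which the second moment of
  \<open>\<mu>\<close> can absorb.\<close>

abbreviation gauss :: "(real ^ 'd) measure" where
  "gauss \<equiv> density lborel (\<lambda>y. ennreal (exp (- (y \<bullet> y))))"

lemma emeasure_gauss: "emeasure gauss (space gauss) = ennreal (sqrt pi ^ CARD('d))"
  using has_bochner_integral_gaussian[where 'n = 'd]
  by (simp add: emeasure_density has_bochner_integral_iff nn_integral_eq_integral)

lemma finite_gauss: "finite_measure gauss"
  by (rule finite_measureI) (simp add: emeasure_gauss del: space_density)

lemma measure_gauss: "measure gauss (space gauss) = sqrt pi ^ CARD('d)"
  unfolding measure_def emeasure_gauss by simp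

text \<open>The cell contains an open cube of side \<open>sqrt e\<close>, and on the cell
  \<open>norm_sq_le_two\<close> with the diameter bound keeps the Gaussian density above a value
  fixed by \<open>x\<close> and \<open>e\<close>.\<close>

lemma gauss_cell_ge:
  assumes e: "0 < e"
  shows "exp (- (2 * (norm x)\<^sup>2 + 2 * real CARD('d) * e)) * sqrt e ^ CARD('d)
    \<le> measure gauss {y \<in> space \<mu>. cell e x = cell e y}"
proof -
  let ?A = "{y \<in> space \<mu>. cell e x = cell e y}"
  let ?l = "\<chi> i. real_of_int (cell e x $ i) * sqrt e" and ?u = "\<chi> i. real_of_int (cell e x $ i + 1) * sqrt e"
  let ?c = "exp (- (2 * (norm x)\<^sup>2 + 2 * real CARD('d) * e))"
  have [measurable]: "?A \<in> sets borel"
  proof -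
    have "?A = cell e -` {cell e x} \<inter> space borel" by auto
    also have "\<dots> \<in> sets borel" by (rule measurable_sets[OF cell_measurable]) simp
    finally show ?thesis .
  qed
  have sub: "box ?l ?u \<subseteq> ?A"
  proof
    fix y assume "y \<in> box ?l ?u"
    then have "real_of_int (cell e x $ i) * sqrt e < y $ i" "y $ i < real_of_int (cell e x $ i + 1) * sqrt e" for i
      by (simp_all add: mem_box_cart)
    then have "real_of_int (cell e x $ i) < y $ i / sqrt e" "y $ i / sqrt e < real_of_int (cell e x $ i) + 1" for i
      using e by (simp_all add: pos_less_divide_eq pos_divide_less_eq)
    then have "\<lfloor>y $ i / sqrt e\<rfloor> = cell e x $ i" for i
      by (intro floor_unique) (auto simp: less_imp_le)
    then show "y \<in> ?A" by (simp add: vec_eq_iff) (simp add: cell_def)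
  qed
  have vol: "emeasure lborel (box ?l ?u) = ennreal (sqrt e ^ CARD('d))"
  proof -
    have b: "(?u - ?l) \<bullet> b = sqrt e" if "b \<in> Basis" for b
    proof -
      from that obtain i where "b = axis i 1" by (auto simp: Basis_vec_def)
      then show ?thesis by (simp add: inner_axis algebra_simps)
    qed
    have "emeasure lborel (box ?l ?u) = ennreal (\<Prod>b\<in>Basis. (?u - ?l) \<bullet> b)"
    proof (rule emeasure_lborel_box)
      fix v :: "real ^ 'd" assume "v \<in> Basis"
      from b[OF this] have "?u \<bullet> v - ?l \<bullet> v = sqrt e" by (simp only: inner_diff_left)
      moreover have "0 < sqrt e" using e by simp
      ultimately show "?l \<bullet> v \<le> ?u \<bullet> v" by linarith
    qed
    also have "(\<Prod>b\<in>Basis. (?u - ?l) \<bullet> b) = (\<Prod>b\<in>(Basis :: (real ^ 'd) set). sqrt e)"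
      by (rule prod.cong[OF refl b])
    finally show ?thesis by simp
  qed
  have "ennreal (?c * sqrt e ^ CARD('d)) = ennreal ?c * emeasure lborel (box ?l ?u)"
    unfolding vol by (rule ennreal_mult) (use e in simp_all)
  also have "\<dots> = (\<integral>\<^sup>+y. ennreal ?c * indicator (box ?l ?u) y \<partial>lborel)"
    by (simp add: nn_integral_cmult)
  also have "\<dots> \<le> (\<integral>\<^sup>+y. ennreal (exp (- (y \<bullet> y))) * indicator ?A y \<partial>lborel)"
  proof (intro nn_integral_mono)
    fix y
    show "ennreal ?c * indicator (box ?l ?u) y \<le> ennreal (exp (- (y \<bullet> y))) * indicator ?A y"
    proof (cases "y \<in> box ?l ?u")
      case True
      with sub have "cell e x = cell e y" and A: "y \<in> ?A" by auto
      then have "y \<bullet> y \<le> 2 * (norm x)\<^sup>2 + 2 * real CARD('d) * e"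
        using norm_sq_le_two[of y x] same_cell_dist[OF e, of x y] by (simp add: power2_norm_eq_inner)
      with True A show ?thesis by (simp add: ennreal_leI)
    qed simp
  qed
  also have "\<dots> = emeasure gauss ?A" by (simp add: emeasure_density)
  also have "\<dots> = ennreal (measure gauss ?A)"
    by (rule finite_measure.emeasure_eq_measure[OF finite_gauss])
  finally show ?thesis by simp
qed

lemma gauss_cell:
  assumes e: "0 < e"
  shows "0 < measure gauss {y \<in> space \<mu>. cell e x = cell e y}"
    and "- ln (measure gauss {y \<in> space \<mu>. cell e x = cell e y})
      \<le> 2 * (norm x)\<^sup>2 + 2 * real CARD('d) * e - real CARD('d) / 2 * ln e"
proof -
  let ?G = "measure gauss {y \<in> space \<mu>. cell e x = cell e y}"
  let ?t = "exp (- (2 * (norm x)\<^sup>2 + 2 * real CARD('d) * e)) * sqrt e ^ CARD('d)"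
  have t: "0 < ?t" using e by simp
  with gauss_cell_ge[OF e, of x] show "0 < ?G" by linarith
  then have "ln ?t \<le> ln ?G" using t gauss_cell_ge[OF e, of x] by (simp only: ln_le_cancel_iff)
  moreover have "ln ?t = - (2 * (norm x)\<^sup>2 + 2 * real CARD('d) * e) + real CARD('d) / 2 * ln e"
    using e by (simp add: ln_mult ln_realpow ln_sqrt)
  ultimately show "- ln ?G \<le> 2 * (norm x)\<^sup>2 + 2 * real CARD('d) * e - real CARD('d) / 2 * ln e"
    by linarith
qed

text \<open>The truncation lies below \<open>ln \<rho>\<close>, so its negative may replace
  \<open>- ln \<rho>\<close> in upper bounds; together with the minorant it is integrable for every
  \<open>N\<close>.\<close>

definition trunc_ln :: "real \<Rightarrow> real ^ 'd \<Rightarrow> real" where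
  "trunc_ln N x = min (ln (\<rho> x)) N"

lemma trunc_ln_measurable [measurable]: "trunc_ln N \<in> borel_measurable borel"
  unfolding trunc_ln_def by measurable

lemma integrable_trunc_ln: "integrable \<mu> (trunc_ln N)"
proof (rule Bochner_Integration.integrable_bound[of _ "\<lambda>x. \<bar>ln_density_minorant x\<bar> + \<bar>N\<bar>"])
  show "integrable \<mu> (\<lambda>x. \<bar>ln_density_minorant x\<bar> + \<bar>N\<bar>)"
    using ln_density_bound(1) by simp
  show "AE x in \<mu>. norm (trunc_ln N x) \<le> norm (\<bar>ln_density_minorant x\<bar> + \<bar>N\<bar>)"
    using ln_density_bound(2) by eventually_elim (auto simp: trunc_ln_def min_def)
qed simp

lemma ln_rate:
  assumes e: "0 < e"
  shows "ln (rate e x) = - (real CARD('d) / 2 * ln e) - ln (Z\<^sub>s e x)"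
  using e normaliser_bounds(3)[OF hessian_like_symmetric_cost e, of x]
  by (simp add: rate_def ln_div ln_mult ln_realpow ln_sqrt less_imp_neq[symmetric])

text \<open>In the last integral \<open>2 * real CARD('d) * e\<close> stems from the Gaussian
  density on a cell and \<open>M * real CARD('d)\<close> from the cost on a cell;
  \<open>sqrt pi ^ CARD('d)\<close> is the total mass of \<open>gauss\<close>.\<close>

definition upper_value :: "real \<Rightarrow> real \<Rightarrow> real \<Rightarrow> real" where
  "upper_value e N s = - (real CARD('d) / 2 * ln e)
     + integral\<^sup>L \<mu> (\<lambda>x. (1 - loss e x) * (- ln (Z\<^sub>s e x) - trunc_ln N x)) - ln (1 - s) + s * sqrt pi ^ CARD('d)
     + integral\<^sup>L \<mu> (\<lambda>x. loss e x * (2 * (norm x)\<^sup>2 + (2 * real CARD('d) * e + M * real CARD('d) - 2 * ln s)))"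

text \<open>The completed kernel is a symmetric self-coupling of \<open>\<mu>\<close>. Applying
  \<open>T\<close> to the second coordinate makes it a coupling of \<open>\<mu>\<close> and
  \<open>\<nu>\<close> without changing its relative entropy.\<close>

theorem EOT_upper_bound:
  assumes e: "0 < e" and s: "0 < s" "s < 1"
  shows "EOT e \<mu> \<nu> \<le> ereal (OT_value + e * upper_value e N s)"
proof -
  interpret K: symmetric_subkernel \<mu> "kernel e" "cell e" by (rule symmetric_subkernel_kernel[OF e])
  interpret P: pair_prob_space \<mu> \<mu> ..
  let ?\<gamma>' = "K.completion_coupling" and ?R = "\<mu> \<Otimes>\<^sub>M \<mu>"
  let ?\<Phi> = "\<lambda>p. (fst p, T (snd p))" and ?\<Psi> = "\<lambda>p. (fst p, T' (snd p))"
  let ?\<gamma> = "distr ?\<gamma>' borel ?\<Phi>"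
  have setsR: "sets ?R = sets (borel :: ((real ^ 'd) \<times> (real ^ 'd)) measure)"
    unfolding borel_prod[symmetric] by (intro sets_pair_measure_cong) simp_all
  have sets': "sets ?\<gamma>' = sets ?R" by (simp add: K.completion_coupling_def)
  note meas_cong = measurable_cong_sets[OF sets' refl] measurable_cong_sets[OF setsR refl]
  have \<Phi>: "?\<Phi> \<in> measurable ?R borel" unfolding borel_prod[symmetric] by measurable
  then have \<Phi>': "?\<Phi> \<in> measurable ?\<gamma>' borel" by (simp add: meas_cong)
  have \<Psi>: "?\<Psi> \<in> measurable borel ?R"
    unfolding measurable_cong_sets[OF refl setsR] borel_prod[symmetric] by measurable
  have fs: "fst \<in> measurable ?\<gamma>' \<mu>" "snd \<in> measurable ?\<gamma>' \<mu>"
    by (simp_all add: meas_cong(1))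
  have fsb: "fst \<in> borel_measurable ?\<gamma>'" "snd \<in> borel_measurable ?\<gamma>'"
    using fs by (simp_all add: measurable_cong_sets[OF refl sets_eq])
  have R_\<nu>: "distr ?R borel ?\<Phi> = \<mu> \<Otimes>\<^sub>M \<nu>"
  proof -
    have "distr \<mu> borel (\<lambda>x. x) \<Otimes>\<^sub>M distr \<mu> borel T = distr ?R (borel \<Otimes>\<^sub>M borel) (\<lambda>(x, y). (x, T y))"
      by (rule pair_measure_distr)
         (use nu.prob in \<open>auto simp: push prob_space_imp_sigma_finite\<close>)
    then show ?thesis
      by (simp add: push distr_id2 borel_prod case_prod_beta')
  qed
  have marg: "distr ?\<gamma> borel fst = \<mu>" "distr ?\<gamma> borel snd = \<nu>"
  proof -
    have [measurable]: "(fst :: (real ^ 'd) \<times> (real ^ 'd) \<Rightarrow> real ^ 'd) \<in> borel_measurable borel"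
      "(snd :: (real ^ 'd) \<times> (real ^ 'd) \<Rightarrow> real ^ 'd) \<in> borel_measurable borel"
      unfolding borel_prod[symmetric] by measurable
    have "distr ?\<gamma> borel fst = distr ?\<gamma>' \<mu> fst"
      by (subst distr_distr[OF _ \<Phi>']) (auto simp: comp_def intro!: distr_cong)
    then show "distr ?\<gamma> borel fst = \<mu>" by (simp add: K.completion_coupling_marginals)
    have "distr ?\<gamma> borel snd = distr (distr ?\<gamma>' \<mu> snd) borel T"
      by (subst distr_distr[OF _ \<Phi>'], simp, subst distr_distr[OF _ fs(2)]) (auto simp: comp_def)
    then show "distr ?\<gamma> borel snd = \<nu>" by (simp add: K.completion_coupling_marginals push)
  qed
  have \<gamma>: "?\<gamma> \<in> couplings \<mu> \<nu>"
    unfolding couplings_def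
    using marg prob_space.prob_space_distr[OF K.completion_coupling_prob \<Phi>'] by simp
  have "absolutely_continuous ?R ?\<gamma>'"
    unfolding K.completion_coupling_def by (rule absolutely_continuousI_density) simp
  then have KL: "KL ?\<gamma> (\<mu> \<Otimes>\<^sub>M \<nu>) = KL ?\<gamma>' ?R"
    unfolding R_\<nu>[symmetric]
    by (intro KL_distr[OF P.sigma_finite_measure_axioms \<Phi> \<Psi>] sets') simp_all
  have bm: "(\<lambda>p :: (real ^ 'd) \<times> (real ^ 'd). bregman (fst p) (snd p)) \<in> borel_measurable ?R"
    by measurable
  have bi: "integrable ?\<gamma>' (\<lambda>p. bregman (fst p) (snd p))"
    "integral\<^sup>L ?\<gamma> (\<lambda>z. bregman (fst z) (T' (snd z))) = integral\<^sup>L ?\<gamma>' (\<lambda>p. bregman (fst p) (snd p))"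
  proof -
    have [measurable]: "(\<lambda>z :: (real ^ 'd) \<times> (real ^ 'd). bregman (fst z) (T' (snd z))) \<in> borel_measurable borel"
      unfolding borel_prod[symmetric] by measurable
    show "integrable ?\<gamma>' (\<lambda>p. bregman (fst p) (snd p))"
      using quadratic_cost_coupling(1)[OF \<gamma>] by (subst (asm) integrable_distr_eq[OF \<Phi>']) simp_all
    show "integral\<^sup>L ?\<gamma> (\<lambda>z. bregman (fst z) (T' (snd z))) = integral\<^sup>L ?\<gamma>' (\<lambda>p. bregman (fst p) (snd p))"
      by (subst integral_distr[OF \<Phi>']) simp_all
  qed
  \<comment> \<open>Exchanging the coordinates preserves the symmetric density, so both orders of
    the Bregman divergence have the same integral, and twice that value is the integral of
    \<open>symmetric_cost\<close>.\<close>
  have swap: "has_bochner_integral ?\<gamma>' (\<lambda>p. bregman (snd p) (fst p)) (integral\<^sup>L ?\<gamma>' (\<lambda>p. bregman (fst p) (snd p)))"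
  proof -
    let ?r = "\<lambda>z. kernel e z + K.r\<^sub>2 z"
    have r: "0 \<le> ?r z" "?r (x, y) = ?r (y, x)" for z x y
      using K.r1_nonneg[of z] K.r2_nonneg[of z] K.r1_sym[of x y] K.r2_sym[of x y] by simp_all
    have "has_bochner_integral ?R (\<lambda>z. ?r z * bregman (fst z) (snd z)) (integral\<^sup>L ?\<gamma>' (\<lambda>p. bregman (fst p) (snd p)))"
      using bi(1) r(1) bm
      by (simp add: K.completion_coupling_def has_bochner_integral_iff integrable_density integral_density del: ennreal_plus)
    then have "has_bochner_integral ?R (\<lambda>(x, y). ?r (y, x) * bregman y x) (integral\<^sup>L ?\<gamma>' (\<lambda>p. bregman (fst p) (snd p)))"
      using P.integrable_product_swap[of "\<lambda>z. ?r z * bregman (fst z) (snd z)"]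
        P.integral_product_swap[of "\<lambda>z. ?r z * bregman (fst z) (snd z)"]
      by (simp add: has_bochner_integral_iff)
    then have "has_bochner_integral ?R (\<lambda>z. ?r z * bregman (snd z) (fst z)) (integral\<^sup>L ?\<gamma>' (\<lambda>p. bregman (fst p) (snd p)))"
      by (simp add: case_prod_beta' r(2)[of "snd z" "fst z" for z])
    then show ?thesis
      using r(1)
      by (simp add: K.completion_coupling_def has_bochner_integral_iff integrable_density integral_density del: ennreal_plus)
  qed
  let ?c = "\<lambda>p. symmetric_cost (fst p) (snd p) / e"
  have c: "integrable ?\<gamma>' ?c" "e * integral\<^sup>L ?\<gamma>' ?c = 2 * integral\<^sup>L ?\<gamma>' (\<lambda>p. bregman (fst p) (snd p))"
  proof -
    have "has_bochner_integral ?\<gamma>' (\<lambda>p. symmetric_cost (fst p) (snd p)) (integral\<^sup>L ?\<gamma>' (\<lambda>p. bregman (fst p) (snd p))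
        + integral\<^sup>L ?\<gamma>' (\<lambda>p. bregman (fst p) (snd p)))"
      unfolding symmetric_cost_def
      using bi(1) swap by (intro has_bochner_integral_add) (simp_all add: has_bochner_integral_iff)
    then show "integrable ?\<gamma>' ?c" "e * integral\<^sup>L ?\<gamma>' ?c = 2 * integral\<^sup>L ?\<gamma>' (\<lambda>p. bregman (fst p) (snd p))"
      using e by (simp_all add: has_bochner_integral_iff)
  qed
  let ?F = "\<lambda>x. ln (rate e x) - trunc_ln N x"
  let ?V = "\<lambda>x. 2 * (norm x)\<^sup>2 + 2 * real CARD('d) * e - real CARD('d) / 2 * ln e"
  have F: "integrable \<mu> ?F"
    unfolding ln_rate[OF e]
    by (intro Bochner_Integration.integrable_diff integrable_trunc_ln integrable_ln_normaliser[OF hessian_like_symmetric_cost e]) simp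
  have V: "integrable \<mu> ?V"
    by (intro Bochner_Integration.integrable_diff Bochner_Integration.integrable_add integrable_mult_right integrable_norm_sq) simp_all
  have bound: "KL ?\<gamma>' ?R + ereal (integral\<^sup>L ?\<gamma>' ?c) \<le>
    ereal (integral\<^sup>L \<mu> (\<lambda>x. (1 - K.deficit x) * ?F x) - ln (1 - s) + s * measure gauss (space gauss)
      + integral\<^sup>L \<mu> (\<lambda>x. K.deficit x * (?V x + M * real CARD('d) - 2 * ln s)))"
  proof (rule K.completion_coupling_bound[OF s F V c(1) _ _ finite_gauss])
    fix x y
    show "kernel e (x, y) * (ln (kernel e (x, y)) + symmetric_cost (fst (x, y)) (snd (x, y)) / e)
        \<le> kernel e (x, y) * ((?F x + ?F y) / 2)"
    proof (cases "\<rho> x = 0 \<or> \<rho> y = 0")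
      case True
      then have "kernel e (x, y) = 0"
        using rate_pos[OF e, of x] rate_pos[OF e, of y] lebesgue_density_nonneg[of x] lebesgue_density_nonneg[of y]
        by (auto simp: kernel_def min_def divide_le_0_iff dest: order_antisym)
      then show ?thesis by simp
    next
      case False
      then have pos: "0 < \<rho> x" "0 < \<rho> y"
        using lebesgue_density_nonneg[of x] lebesgue_density_nonneg[of y] by auto
      let ?a = "rate e x / \<rho> y" and ?b = "rate e y / \<rho> x"
      have ab: "0 < ?a" "0 < ?b" using pos rate_pos[OF e] by simp_all
      have "ln (kernel e (x, y)) + symmetric_cost x y / e = ln (min ?a ?b)"
      proof -
        have "ln (c * exp t) = ln c + t" if "0 < c" for c t :: real
          using that by (subst ln_mult) auto
        from this[of "min ?a ?b" "- (symmetric_cost x y / e)"] ab show ?thesis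
          by (simp only: kernel_def fst_conv snd_conv min_less_iff_conj)
      qed
      also have "\<dots> \<le> (ln ?a + ln ?b) / 2"
        using ab by (cases "?a \<le> ?b") (simp_all add: min_def)
      also have "ln ?a + ln ?b = (ln (rate e x) - ln (\<rho> x)) + (ln (rate e y) - ln (\<rho> y))"
        using pos rate_pos[OF e, of x] rate_pos[OF e, of y] by (simp add: ln_div less_imp_neq[symmetric])
      also have "\<dots> / 2 \<le> (?F x + ?F y) / 2"
        by (simp add: trunc_ln_def)
      finally show ?thesis
        using kernel_nonneg[OF e, of "(x, y)"] by (intro mult_left_mono) simp_all
    qed
  next
    fix x y assume "cell e x = cell e y"
    from same_cell_dist[OF e this] have "M * (norm (x - y))\<^sup>2 \<le> M * (real CARD('d) * e)"
      using M_pos by (intro mult_left_mono) auto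
    with symmetric_cost_le[of x y] have "symmetric_cost x y \<le> M * real CARD('d) * e" by simp
    then show "symmetric_cost (fst (x, y)) (snd (x, y)) / e \<le> M * real CARD('d)"
      using e by (simp add: divide_le_eq)
  next
    show "sets gauss = sets \<mu>" by simp
    show "0 < measure gauss {y \<in> space \<mu>. cell e x = cell e y}" for x
      by (rule gauss_cell(1)[OF e])
    show "- ln (measure gauss {y \<in> space \<mu>. cell e x = cell e y}) \<le> ?V x" for x
      by (rule gauss_cell(2)[OF e])
  qed
  also have "integral\<^sup>L \<mu> (\<lambda>x. (1 - K.deficit x) * ?F x) - ln (1 - s) + s * measure gauss (space gauss)
      + integral\<^sup>L \<mu> (\<lambda>x. K.deficit x * (?V x + M * real CARD('d) - 2 * ln s)) = upper_value e N s"
  proof -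
    note [measurable] = loss_measurable[OF e]
    let ?A = "\<lambda>x. - ln (Z\<^sub>s e x) - trunc_ln N x"
    let ?B = "\<lambda>x. 2 * (norm x)\<^sup>2 + (2 * real CARD('d) * e + M * real CARD('d) - 2 * ln s)"
    let ?L = "real CARD('d) / 2 * ln e"
    have iA: "integrable \<mu> (\<lambda>x. (1 - loss e x) * ?A x)"
    proof (rule Bochner_Integration.integrable_bound[of _ ?A])
      show "integrable \<mu> ?A"
        by (intro Bochner_Integration.integrable_diff integrable_trunc_ln Bochner_Integration.integrable_minus
            integrable_ln_normaliser[OF hessian_like_symmetric_cost e])
    qed (use loss_bounds[OF e] in \<open>auto simp: abs_mult intro!: mult_left_le_one_le\<close>)
    have iB: "integrable \<mu> (\<lambda>x. loss e x * ?B x)"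
    proof (rule Bochner_Integration.integrable_bound[of _ ?B])
      show "integrable \<mu> ?B"
        by (intro Bochner_Integration.integrable_add integrable_mult_right integrable_norm_sq) simp
    qed (use loss_bounds[OF e] in \<open>auto simp: abs_mult intro!: mult_left_le_one_le\<close>)
    have il: "integrable \<mu> (loss e)"
      by (rule integrable_const_bound[of _ 1]) (use loss_bounds[OF e] in auto)
    \<comment> \<open>The terms \<open>L * l\<close> in \<open>alg1\<close> and
      \<open>- L * l\<close> in \<open>alg2\<close> cancel: in the total, \<open>ln e\<close> never
      multiplies the missing mass, for whose decay no rate is at hand.\<close>
    have alg1: "(1 - l) * (- L - a - b) = (1 - l) * (- a - b) - L + L * l" for l L a b :: real
      by (simp add: algebra_simps)
    have alg2: "l * (v + d - L + k - r) = l * (v + (d + k - r)) - L * l" for l v d L k r :: real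
      by (simp add: algebra_simps)
    have "integral\<^sup>L \<mu> (\<lambda>x. (1 - loss e x) * ?F x) = integral\<^sup>L \<mu> (\<lambda>x. (1 - loss e x) * ?A x - ?L + ?L * loss e x)"
      unfolding ln_rate[OF e] by (intro Bochner_Integration.integral_cong refl alg1)
    also have "\<dots> = integral\<^sup>L \<mu> (\<lambda>x. (1 - loss e x) * ?A x) - ?L + ?L * integral\<^sup>L \<mu> (loss e)"
      using iA il by (simp add: prob_UNIV)
    finally have 1: "integral\<^sup>L \<mu> (\<lambda>x. (1 - loss e x) * ?F x)
        = integral\<^sup>L \<mu> (\<lambda>x. (1 - loss e x) * ?A x) - ?L + ?L * integral\<^sup>L \<mu> (loss e)" .
    have "integral\<^sup>L \<mu> (\<lambda>x. loss e x * (?V x + M * real CARD('d) - 2 * ln s))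
        = integral\<^sup>L \<mu> (\<lambda>x. loss e x * ?B x - ?L * loss e x)"
      by (intro Bochner_Integration.integral_cong refl alg2)
    also have "\<dots> = integral\<^sup>L \<mu> (\<lambda>x. loss e x * ?B x) - ?L * integral\<^sup>L \<mu> (loss e)"
      using iB il by simp
    finally have 2: "integral\<^sup>L \<mu> (\<lambda>x. loss e x * (?V x + M * real CARD('d) - 2 * ln s))
        = integral\<^sup>L \<mu> (\<lambda>x. loss e x * ?B x) - ?L * integral\<^sup>L \<mu> (loss e)" .
    show ?thesis
      unfolding loss_def[symmetric] 1 2 upper_value_def measure_gauss by simp
  qed
  finally have em: "ereal e * (KL ?\<gamma>' ?R + ereal (integral\<^sup>L ?\<gamma>' ?c)) \<le> ereal e * ereal (upper_value e N s)"
    using e by (intro ereal_mult_left_mono) auto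
  have main: "ereal e * KL ?\<gamma>' ?R + ereal (2 * integral\<^sup>L ?\<gamma>' (\<lambda>p. bregman (fst p) (snd p))) \<le> ereal (e * upper_value e N s)"
  proof -
    have "ereal e * (k + ereal r) = ereal e * k + ereal (e * r)" for k r
      using e by (cases k) (simp_all add: distrib_left)
    with em show ?thesis by (simp add: c(2)[symmetric])
  qed
  have "EOT e \<mu> \<nu> \<le> quadratic_cost ?\<gamma> + ereal e * KL ?\<gamma> (\<mu> \<Otimes>\<^sub>M \<nu>)"
    unfolding EOT_def by (rule INF_lower[OF \<gamma>])
  also have "\<dots> = ereal OT_value + (ereal e * KL ?\<gamma>' ?R + ereal (2 * integral\<^sup>L ?\<gamma>' (\<lambda>p. bregman (fst p) (snd p))))"
    unfolding quadratic_cost_coupling(2)[OF \<gamma>] KL bi(2) plus_ereal.simps(1)[symmetric] by (simp only: ac_simps)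
  also have "\<dots> \<le> ereal OT_value + ereal (e * upper_value e N s)"
    by (intro add_left_mono main)
  finally show ?thesis by simp
qed

end

section \<open>The limit\<close>

context brenier_setting
begin

lemma integrable_loss_mult:
  assumes e: "0 < e" and W: "integrable \<mu> W"
  shows "integrable \<mu> (\<lambda>x. loss e x * W x)"
proof -
  note [measurable] = loss_measurable[OF e]
  show ?thesis
    by (rule Bochner_Integration.integrable_bound[OF W])
       (use W loss_bounds[OF e] in \<open>auto simp: abs_mult intro!: mult_left_le_one_le\<close>)
qed

lemma integrable_loss: "0 < e \<Longrightarrow> integrable \<mu> (loss e)"
  using integrable_loss_mult[of e "\<lambda>_. 1"] by simp

text \<open>\<open>loss\<close> is at most 1 and is known to tend to 0 only in mean. Cutting
  \<open>\<bar>W x\<bar>\<close> at a level \<open>k\<close> leaves a tail that is small in mean,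
  and the bounded part contributes at most \<open>k\<close> times the mean loss.\<close>

lemma integral_loss_mult_tendsto_0:
  assumes e: "\<And>n. 0 < e n" "e \<longlonglongrightarrow> 0" and W: "integrable \<mu> W"
  shows "(\<lambda>n. integral\<^sup>L \<mu> (\<lambda>x. loss (e n) x * W x)) \<longlonglongrightarrow> 0"
proof (rule LIMSEQ_I)
  fix r :: real assume r: "0 < r"
  let ?t = "\<lambda>(k::nat) x. min \<bar>W x\<bar> (real k)"
  have W': "integrable \<mu> (\<lambda>x. \<bar>W x\<bar>)" using W by simp
  have [measurable]: "W \<in> borel_measurable \<mu>" using W by simp
  have t: "integrable \<mu> (?t k)" for k
    by (rule Bochner_Integration.integrable_bound[OF W']) auto
  have "(\<lambda>k. integral\<^sup>L \<mu> (?t k)) \<longlonglongrightarrow> integral\<^sup>L \<mu> (\<lambda>x. \<bar>W x\<bar>)"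
  proof (rule integral_dominated_convergence[OF _ _ W'])
    show "AE x in \<mu>. (\<lambda>k. ?t k x) \<longlonglongrightarrow> \<bar>W x\<bar>"
    proof (intro AE_I2 tendsto_eventually)
      fix x
      obtain k0 where "\<bar>W x\<bar> \<le> real k0" using real_arch_simple by blast
      then show "\<forall>\<^sub>F k in sequentially. ?t k x = \<bar>W x\<bar>"
        by (intro eventually_sequentiallyI[of k0]) (simp add: min_def)
    qed
  qed auto
  then have "\<forall>\<^sub>F k in sequentially. integral\<^sup>L \<mu> (\<lambda>x. \<bar>W x\<bar>) - r / 2 < integral\<^sup>L \<mu> (?t k)"
    by (rule order_tendstoD) (use r in simp)
  then obtain k where "integral\<^sup>L \<mu> (\<lambda>x. \<bar>W x\<bar>) - r / 2 < integral\<^sup>L \<mu> (?t k)"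
    by (meson eventually_sequentially order_refl)
  then have k: "integral\<^sup>L \<mu> (\<lambda>x. \<bar>W x\<bar>) - integral\<^sup>L \<mu> (?t k) < r / 2"
    by linarith
  have "(\<lambda>n. real k * integral\<^sup>L \<mu> (loss (e n))) \<longlonglongrightarrow> real k * 0"
    by (intro tendsto_intros integral_loss_tendsto_0 e)
  then have "\<forall>\<^sub>F n in sequentially. real k * integral\<^sup>L \<mu> (loss (e n)) < r / 2"
    by (rule order_tendstoD) (use r in simp)
  then obtain n0 where n0: "\<And>n. n0 \<le> n \<Longrightarrow> real k * integral\<^sup>L \<mu> (loss (e n)) < r / 2"
    by (auto simp: eventually_sequentially)
  show "\<exists>n0. \<forall>n\<ge>n0. norm (integral\<^sup>L \<mu> (\<lambda>x. loss (e n) x * W x) - 0) < r"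
  proof (intro exI[of _ n0] allI impI)
    fix n assume n: "n0 \<le> n"
    have "norm (integral\<^sup>L \<mu> (\<lambda>x. loss (e n) x * W x)) \<le> integral\<^sup>L \<mu> (\<lambda>x. norm (loss (e n) x * W x))"
      by (rule integral_norm_bound)
    also have "\<dots> \<le> integral\<^sup>L \<mu> (\<lambda>x. real k * loss (e n) x + (\<bar>W x\<bar> - ?t k x))"
    proof (rule integral_mono)
      show "integrable \<mu> (\<lambda>x. norm (loss (e n) x * W x))"
        using integrable_loss_mult[OF e(1) W] by (rule Bochner_Integration.integrable_norm)
      show "integrable \<mu> (\<lambda>x. real k * loss (e n) x + (\<bar>W x\<bar> - ?t k x))"
        using integrable_loss[OF e(1)] W' t by simp
      fix x
      have "loss (e n) x * \<bar>W x\<bar> = loss (e n) x * ?t k x + loss (e n) x * (\<bar>W x\<bar> - ?t k x)"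
        by (simp add: algebra_simps)
      also have "\<dots> \<le> loss (e n) x * real k + 1 * (\<bar>W x\<bar> - ?t k x)"
        using loss_bounds[OF e(1)] by (intro add_mono mult_left_mono mult_right_mono) auto
      finally show "norm (loss (e n) x * W x) \<le> real k * loss (e n) x + (\<bar>W x\<bar> - ?t k x)"
        using loss_bounds[OF e(1)] by (simp add: abs_mult mult.commute)
    qed
    also have "\<dots> = real k * integral\<^sup>L \<mu> (loss (e n)) + (integral\<^sup>L \<mu> (\<lambda>x. \<bar>W x\<bar>) - integral\<^sup>L \<mu> (?t k))"
      using integrable_loss[OF e(1)] W' t by simp
    also have "\<dots> < r" using n0[OF n] k by simp
    finally show "norm (integral\<^sup>L \<mu> (\<lambda>x. loss (e n) x * W x) - 0) < r" by simp
  qed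
qed

definition upper_limit :: "real \<Rightarrow> real \<Rightarrow> real" where
  "upper_limit N s = mean_log_det / 2 - integral\<^sup>L \<mu> (trunc_ln N) - ln (1 - s) + s * sqrt pi ^ CARD('d)"

text \<open>Every term weighted by \<open>loss\<close> vanishes in the limit. The added logarithm
  cancels the divergent \<open>ln (e n)\<close> and supplies the \<open>ln pi\<close> that cancels
  the one in \<open>ln_normaliser_limit\<close>.\<close>

lemma upper_value_tendsto:
  assumes e: "\<And>n. 0 < e n" "e \<longlonglongrightarrow> 0"
  shows "(\<lambda>n. upper_value (e n) N s + real CARD('d) / 2 * ln (pi * e n)) \<longlonglongrightarrow> upper_limit N s"
proof -
  let ?d = "real CARD('d)"
  let ?lZ = "\<lambda>n x. ln (Z\<^sub>s (e n) x)"
  note lZ = integrable_ln_normaliser[OF hessian_like_symmetric_cost e(1)]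
  let ?k = "M * ?d - 2 * ln s"
  have A: "integral\<^sup>L \<mu> (\<lambda>x. (1 - loss (e n) x) * (- ?lZ n x - trunc_ln N x))
      = - integral\<^sup>L \<mu> (?lZ n) - integral\<^sup>L \<mu> (trunc_ln N) + integral\<^sup>L \<mu> (\<lambda>x. loss (e n) x * ?lZ n x)
        + integral\<^sup>L \<mu> (\<lambda>x. loss (e n) x * trunc_ln N x)" for n
  proof -
    have "integral\<^sup>L \<mu> (\<lambda>x. (1 - loss (e n) x) * (- ?lZ n x - trunc_ln N x))
        = integral\<^sup>L \<mu> (\<lambda>x. - ?lZ n x - trunc_ln N x + loss (e n) x * ?lZ n x + loss (e n) x * trunc_ln N x)"
      by (intro Bochner_Integration.integral_cong refl) (simp add: algebra_simps)
    also have "\<dots> = - integral\<^sup>L \<mu> (?lZ n) - integral\<^sup>L \<mu> (trunc_ln N) + integral\<^sup>L \<mu> (\<lambda>x. loss (e n) x * ?lZ n x)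
        + integral\<^sup>L \<mu> (\<lambda>x. loss (e n) x * trunc_ln N x)"
      using lZ[of n] integrable_trunc_ln[of N] integrable_loss_mult[OF e(1)[of n] lZ[of n]]
        integrable_loss_mult[OF e(1)[of n] integrable_trunc_ln[of N]] by simp
    finally show ?thesis .
  qed
  have B: "integral\<^sup>L \<mu> (\<lambda>x. loss (e n) x * (2 * (norm x)\<^sup>2 + (2 * ?d * e n + M * ?d - 2 * ln s)))
      = integral\<^sup>L \<mu> (\<lambda>x. loss (e n) x * (2 * (norm x)\<^sup>2)) + (2 * ?d * e n + ?k) * integral\<^sup>L \<mu> (loss (e n))" for n
  proof -
    have "integral\<^sup>L \<mu> (\<lambda>x. loss (e n) x * (2 * (norm x)\<^sup>2 + (2 * ?d * e n + M * ?d - 2 * ln s)))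
        = integral\<^sup>L \<mu> (\<lambda>x. loss (e n) x * (2 * (norm x)\<^sup>2) + (2 * ?d * e n + ?k) * loss (e n) x)"
      by (intro Bochner_Integration.integral_cong refl) (simp add: algebra_simps)
    also have "\<dots> = integral\<^sup>L \<mu> (\<lambda>x. loss (e n) x * (2 * (norm x)\<^sup>2)) + integral\<^sup>L \<mu> (\<lambda>x. (2 * ?d * e n + ?k) * loss (e n) x)"
      by (intro Bochner_Integration.integral_add integrable_loss_mult e integrable_mult_right integrable_norm_sq integrable_loss)
    finally show ?thesis by simp
  qed
  \<comment> \<open>Here the factor beside \<open>loss\<close> changes with \<open>n\<close>, so the
    uniform bound on the logarithm of the normaliser takes the place of
    \<open>integral_loss_mult_tendsto_0\<close>.\<close>
  have C: "(\<lambda>n. integral\<^sup>L \<mu> (\<lambda>x. loss (e n) x * ?lZ n x)) \<longlonglongrightarrow> 0"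
  proof (rule Lim_null_comparison)
    show "\<forall>\<^sub>F n in sequentially. norm (integral\<^sup>L \<mu> (\<lambda>x. loss (e n) x * ?lZ n x)) \<le> integral\<^sup>L \<mu> (loss (e n)) * ln_Z_bound"
    proof (intro always_eventually allI)
      fix n
      have "norm (integral\<^sup>L \<mu> (\<lambda>x. loss (e n) x * ?lZ n x)) \<le> integral\<^sup>L \<mu> (\<lambda>x. norm (loss (e n) x * ?lZ n x))"
        by (rule integral_norm_bound)
      also have "\<dots> \<le> integral\<^sup>L \<mu> (\<lambda>x. loss (e n) x * ln_Z_bound)"
      proof (rule integral_mono)
        show "integrable \<mu> (\<lambda>x. norm (loss (e n) x * ?lZ n x))"
          using integrable_loss_mult[OF e(1) lZ] by (rule Bochner_Integration.integrable_norm)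
        show "integrable \<mu> (\<lambda>x. loss (e n) x * ln_Z_bound)"
          using integrable_loss[OF e(1)] by simp
        show "norm (loss (e n) x * ?lZ n x) \<le> loss (e n) x * ln_Z_bound" for x
          using loss_bounds(1)[OF e(1)] ln_normaliser_bound[OF hessian_like_symmetric_cost e(1), of n x]
          by (simp add: abs_mult mult_left_mono)
      qed
      finally show "norm (integral\<^sup>L \<mu> (\<lambda>x. loss (e n) x * ?lZ n x)) \<le> integral\<^sup>L \<mu> (loss (e n)) * ln_Z_bound"
        by simp
    qed
    have "(\<lambda>n. integral\<^sup>L \<mu> (loss (e n)) * ln_Z_bound) \<longlonglongrightarrow> 0 * ln_Z_bound"
      by (intro tendsto_intros integral_loss_tendsto_0 e)
    then show "(\<lambda>n. integral\<^sup>L \<mu> (loss (e n)) * ln_Z_bound) \<longlonglongrightarrow> 0" by simp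
  qed
  have ln: "ln (pi * e n) = ln pi + ln (e n)" for n
    using e(1)[of n] by (subst ln_mult) auto
  have eq: "upper_value (e n) N s + ?d / 2 * ln (pi * e n)
      = - integral\<^sup>L \<mu> (?lZ n) - integral\<^sup>L \<mu> (trunc_ln N) + integral\<^sup>L \<mu> (\<lambda>x. loss (e n) x * ?lZ n x)
        + integral\<^sup>L \<mu> (\<lambda>x. loss (e n) x * trunc_ln N x) - ln (1 - s) + s * sqrt pi ^ CARD('d)
        + (integral\<^sup>L \<mu> (\<lambda>x. loss (e n) x * (2 * (norm x)\<^sup>2)) + (2 * ?d * e n + ?k) * integral\<^sup>L \<mu> (loss (e n)))
        + ?d / 2 * ln pi" for n
    unfolding upper_value_def A B ln by (simp add: distrib_left)
  have "(\<lambda>n. upper_value (e n) N s + ?d / 2 * ln (pi * e n)) \<longlonglongrightarrow>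
      - integral\<^sup>L \<mu> ln_normaliser_limit - integral\<^sup>L \<mu> (trunc_ln N) + 0 + 0 - ln (1 - s) + s * sqrt pi ^ CARD('d)
        + (0 + (2 * ?d * 0 + ?k) * 0) + ?d / 2 * ln pi"
    unfolding eq
    by (intro tendsto_intros integral_ln_normaliser_tendsto[OF hessian_like_symmetric_cost e] C integral_loss_mult_tendsto_0 e
        integrable_trunc_ln integrable_mult_right integrable_norm_sq integral_loss_tendsto_0)
  also have "- integral\<^sup>L \<mu> ln_normaliser_limit - integral\<^sup>L \<mu> (trunc_ln N) + 0 + 0 - ln (1 - s) + s * sqrt pi ^ CARD('d)
        + (0 + (2 * ?d * 0 + ?k) * 0) + ?d / 2 * ln pi = upper_limit N s"
    by (simp add: integral_ln_normaliser_limit upper_limit_def diff_divide_distrib)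
  finally show ?thesis .
qed

lemma lower_value_tendsto:
  assumes e: "\<And>n. 0 < e n" "e \<longlonglongrightarrow> 0"
  shows "(\<lambda>n. lower_value (e n) + real CARD('d) / 2 * ln (pi * e n))
    \<longlonglongrightarrow> mean_log_det / 2 - integral\<^sup>L \<mu> (\<lambda>x. ln (\<rho> x))"
proof -
  let ?d = "real CARD('d)"
  have ln: "ln (pi * e n) = ln pi + ln (e n)" for n
    using e(1)[of n] by (subst ln_mult) auto
  have eq: "lower_value (e n) + ?d / 2 * ln (pi * e n)
      = - integral\<^sup>L \<mu> (\<lambda>x. ln (\<rho> x)) - integral\<^sup>L \<mu> (\<lambda>x. ln (normaliser c\<^sub>1 (e n) x)) / 2
        - integral\<^sup>L \<mu> (\<lambda>x. ln (normaliser c\<^sub>2 (e n) x)) / 2 + ?d / 2 * ln pi" for n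
    unfolding lower_value_def ln by (simp add: distrib_left)
  have "(\<lambda>n. lower_value (e n) + ?d / 2 * ln (pi * e n)) \<longlonglongrightarrow>
      - integral\<^sup>L \<mu> (\<lambda>x. ln (\<rho> x)) - integral\<^sup>L \<mu> ln_normaliser_limit / 2
        - integral\<^sup>L \<mu> ln_normaliser_limit / 2 + ?d / 2 * ln pi"
    unfolding eq
    by (intro tendsto_intros integral_ln_normaliser_tendsto[OF hessian_like_bregman e]
        integral_ln_normaliser_tendsto[OF hessian_like_bregman_swap e]) simp_all
  also have "- integral\<^sup>L \<mu> (\<lambda>x. ln (\<rho> x)) - integral\<^sup>L \<mu> ln_normaliser_limit / 2
        - integral\<^sup>L \<mu> ln_normaliser_limit / 2 + ?d / 2 * ln pi = mean_log_det / 2 - integral\<^sup>L \<mu> (\<lambda>x. ln (\<rho> x))"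
    by (simp add: integral_ln_normaliser_limit diff_divide_distrib)
  finally show ?thesis .
qed

lemma K_EOT_finite:
  assumes "integrable \<mu> (\<lambda>x. ln (\<rho> x))"
  shows "K_EOT \<phi> \<mu> \<nu> = ereal (mean_log_det / 2 - integral\<^sup>L \<mu> (\<lambda>x. ln (\<rho> x)))"
  unfolding K_EOT_eq using assms by (cases rule: Ent_cases) (simp_all add: field_simps)

lemma K_EOT_infinite:
  assumes "\<not> integrable \<mu> (\<lambda>x. ln (\<rho> x))"
  shows "K_EOT \<phi> \<mu> \<nu> = -\<infinity>"
  unfolding K_EOT_eq using assms by (cases rule: Ent_cases) simp_all

text \<open>If the truncated integrals stayed bounded, monotone convergence would make
  \<open>ln \<rho>\<close> integrable.\<close>

lemma integral_trunc_ln_unbounded: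
  assumes "\<not> integrable \<mu> (\<lambda>x. ln (\<rho> x))"
  shows "\<exists>k::nat. a < integral\<^sup>L \<mu> (trunc_ln (real k))"
proof (rule ccontr)
  assume "\<not> ?thesis"
  then have le: "integral\<^sup>L \<mu> (trunc_ln (real k)) \<le> a" for k :: nat by (simp add: not_less)
  have "incseq (\<lambda>k::nat. integral\<^sup>L \<mu> (trunc_ln (real k)))"
    by (intro monoI integral_mono integrable_trunc_ln) (auto simp: trunc_ln_def)
  then obtain l where l: "(\<lambda>k::nat. integral\<^sup>L \<mu> (trunc_ln (real k))) \<longlonglongrightarrow> l"
    using incseq_convergent[of "\<lambda>k::nat. integral\<^sup>L \<mu> (trunc_ln (real k))" a] le by blast
  have "integrable \<mu> (\<lambda>x. ln (\<rho> x))"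
  proof (rule integrable_monotone_convergence[OF _ _ _ l])
    show "AE x in \<mu>. mono (\<lambda>k::nat. trunc_ln (real k) x)"
      by (intro AE_I2 monoI) (auto simp: trunc_ln_def)
    show "AE x in \<mu>. (\<lambda>k::nat. trunc_ln (real k) x) \<longlonglongrightarrow> ln (\<rho> x)"
    proof (intro AE_I2 tendsto_eventually)
      fix x
      obtain k0 where "ln (\<rho> x) \<le> real k0" using real_arch_simple by blast
      then show "\<forall>\<^sub>F k in sequentially. trunc_ln (real k) x = ln (\<rho> x)"
        by (intro eventually_sequentiallyI[of k0]) (simp add: trunc_ln_def min_def)
    qed
  qed (auto intro: integrable_trunc_ln)
  with assms show False by simp
qed

lemma integral_trunc_ln_tendsto:
  assumes ent: "integrable \<mu> (\<lambda>x. ln (\<rho> x))"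
  shows "(\<lambda>k::nat. integral\<^sup>L \<mu> (trunc_ln (real k))) \<longlonglongrightarrow> integral\<^sup>L \<mu> (\<lambda>x. ln (\<rho> x))"
proof (rule integral_dominated_convergence[where w = "\<lambda>x. \<bar>ln (\<rho> x)\<bar>"])
  show "AE x in \<mu>. (\<lambda>k::nat. trunc_ln (real k) x) \<longlonglongrightarrow> ln (\<rho> x)"
  proof (intro AE_I2 tendsto_eventually)
    fix x
    obtain k0 where "ln (\<rho> x) \<le> real k0" using real_arch_simple by blast
    then show "\<forall>\<^sub>F k in sequentially. trunc_ln (real k) x = ln (\<rho> x)"
      by (intro eventually_sequentiallyI[of k0]) (simp add: trunc_ln_def min_def)
  qed
  show "AE x in \<mu>. norm (trunc_ln (real k) x) \<le> \<bar>ln (\<rho> x)\<bar>" for k :: nat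
    by (intro AE_I2) (auto simp: trunc_ln_def min_def)
qed (use ent in auto)

text \<open>The limit in \<open>e\<close> was taken for fixed \<open>N\<close> and \<open>s\<close>,
  which are now optimised. For integrable \<open>ln \<rho>\<close> they tend to infinity and 0
  together; otherwise \<open>s\<close> can stay at 1/2, because the truncated integrals alone drive
  the bound down without limit.\<close>

lemma upper_limit_approximates:
  assumes "K_EOT \<phi> \<mu> \<nu> < a"
  shows "\<exists>N s. 0 < s \<and> s < 1 \<and> ereal (upper_limit N s) < a"
proof (cases "integrable \<mu> (\<lambda>x. ln (\<rho> x))")
  case True
  \<comment> \<open>The double successor keeps \<open>s\<close> strictly below 1 from the first
    index on.\<close>
  let ?s = "\<lambda>k::nat. inverse (real (Suc (Suc k)))"
  have s: "?s \<longlonglongrightarrow> 0"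
    using LIMSEQ_Suc[OF LIMSEQ_inverse_real_of_nat] .
  have "(\<lambda>k::nat. upper_limit (real k) (?s k)) \<longlonglongrightarrow>
      mean_log_det / 2 - integral\<^sup>L \<mu> (\<lambda>x. ln (\<rho> x)) - ln (1 - 0) + 0 * sqrt pi ^ CARD('d)"
    unfolding upper_limit_def
    by (intro tendsto_intros integral_trunc_ln_tendsto[OF True] s) simp_all
  then have "(\<lambda>k::nat. ereal (upper_limit (real k) (?s k))) \<longlonglongrightarrow> K_EOT \<phi> \<mu> \<nu>"
    by (simp add: K_EOT_finite[OF True])
  then have "\<forall>\<^sub>F k::nat in sequentially. ereal (upper_limit (real k) (?s k)) < a"
    using assms by (rule order_tendstoD)
  then obtain k :: nat where "ereal (upper_limit (real k) (?s k)) < a"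
    by (auto simp: eventually_sequentially)
  moreover have "0 < ?s k" "?s k < 1" by (simp_all add: field_simps)
  ultimately show ?thesis by blast
next
  case False
  have "-\<infinity> < a" using assms by (simp add: K_EOT_infinite[OF False])
  then obtain b where b: "ereal b < a"
    by (metis ereal_dense2 less_ereal.simps(3) ereal_less(5) ereal_dense3 ereal_cases)
  obtain k :: nat where "mean_log_det / 2 - ln (1 - 1 / 2) + 1 / 2 * sqrt pi ^ CARD('d) - b < integral\<^sup>L \<mu> (trunc_ln (real k))"
    using integral_trunc_ln_unbounded[OF False] by blast
  then have "upper_limit (real k) (1 / 2) < b" by (simp add: upper_limit_def)
  then have "ereal (upper_limit (real k) (1 / 2)) < ereal b" by simp
  from less_trans[OF this b] have "ereal (upper_limit (real k) (1 / 2)) < a" .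
  then show ?thesis by (intro exI[of _ "real k"] exI[of _ "1 / 2"]) simp
qed

section \<open>Matching the two bounds\<close>

definition expansion :: "real \<Rightarrow> ereal" where
  "expansion e = (EOT e \<mu> \<nu> - OT \<mu> \<nu> + ereal (real CARD('d) / 2 * e * ln (pi * e))) / ereal e"

lemma expansion_le:
  assumes "0 < e" "0 < s" "s < 1"
  shows "expansion e \<le> ereal (upper_value e N s + real CARD('d) / 2 * ln (pi * e))"
proof -
  \<comment> \<open>\<open>X\<close> stands for \<open>EOT e \<mu> \<nu>\<close>, which is not known
    to be finite at this point.\<close>
  have "(X - ereal J + ereal (a * e * b)) / ereal e \<le> ereal (U + a * b)"
    if "X \<le> ereal (J + e * U)" for X J U a b
    using that assms(1) by (cases X) (auto simp: divide_simps algebra_simps)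
  from this[OF EOT_upper_bound[OF assms, of N], of "real CARD('d) / 2" "ln (pi * e)"] show ?thesis
    by (simp only: expansion_def OT_eq)
qed

lemma expansion_ge:
  assumes "0 < e" "integrable \<mu> (\<lambda>x. ln (\<rho> x))"
  shows "ereal (lower_value e + real CARD('d) / 2 * ln (pi * e)) \<le> expansion e"
proof -
  have "ereal (U + a * b) \<le> (X - ereal J + ereal (a * e * b)) / ereal e"
    if "ereal (J + e * U) \<le> X" for X J U a b
    using that assms(1) by (cases X) (auto simp: divide_simps algebra_simps)
  from this[OF EOT_lower_bound[OF assms], of "real CARD('d) / 2" "ln (pi * e)"] show ?thesis
    by (simp only: expansion_def OT_eq)
qed

text \<open>The order topology on the extended reals uses the two one-sided estimates separately, so
  finite limits and minus infinity are treated alike.\<close>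

theorem expansion_tendsto: "(expansion \<longlongrightarrow> K_EOT \<phi> \<mu> \<nu>) (at_right 0)"
  unfolding tendsto_at_iff_sequentially comp_def
proof (intro allI impI)
  fix e :: "nat \<Rightarrow> real"
  assume "\<forall>i. e i \<in> {0<..} - {0}" and e0: "e \<longlonglongrightarrow> 0"
  then have e: "0 < e n" for n by auto
  show "(\<lambda>n. expansion (e n)) \<longlonglongrightarrow> K_EOT \<phi> \<mu> \<nu>"
  proof (rule order_tendstoI)
    fix a assume "K_EOT \<phi> \<mu> \<nu> < a"
    then obtain N s where s: "0 < s" "s < 1" "ereal (upper_limit N s) < a"
      using upper_limit_approximates by blast
    have "(\<lambda>n. ereal (upper_value (e n) N s + real CARD('d) / 2 * ln (pi * e n))) \<longlonglongrightarrow> ereal (upper_limit N s)"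
      using upper_value_tendsto[OF e e0] by (simp only: lim_ereal)
    then have "\<forall>\<^sub>F n in sequentially. ereal (upper_value (e n) N s + real CARD('d) / 2 * ln (pi * e n)) < a"
      using s(3) by (rule order_tendstoD)
    then show "\<forall>\<^sub>F n in sequentially. expansion (e n) < a"
      by eventually_elim (rule le_less_trans[OF expansion_le[OF e s(1,2)]])
  next
    fix a assume a: "a < K_EOT \<phi> \<mu> \<nu>"
    \<comment> \<open>A value below the limit exists only if the limit exceeds minus infinity, that
      is, for finite entropy, which the lower bound presupposes.\<close>
    then have ent: "integrable \<mu> (\<lambda>x. ln (\<rho> x))"
      using K_EOT_infinite by (cases "integrable \<mu> (\<lambda>x. ln (\<rho> x))") simp_all
    have "(\<lambda>n. ereal (lower_value (e n) + real CARD('d) / 2 * ln (pi * e n))) \<longlonglongrightarrow> K_EOT \<phi> \<mu> \<nu>"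
      using lower_value_tendsto[OF e e0] by (simp only: lim_ereal K_EOT_finite[OF ent])
    then have "\<forall>\<^sub>F n in sequentially. a < ereal (lower_value (e n) + real CARD('d) / 2 * ln (pi * e n))"
      using a by (rule order_tendstoD)
    then show "\<forall>\<^sub>F n in sequentially. a < expansion (e n)"
      by eventually_elim (rule less_le_trans[OF _ expansion_ge[OF e ent]])
  qed
qed

end

theorem theorem2p2:
  fixes \<mu> \<nu> :: "(real ^ 'd) measure"
    and \<phi> :: "real ^ 'd \<Rightarrow> real"
    and \<sigma>\<^sub>m \<sigma>\<^sub>M \<beta> :: real
  assumes "\<mu> \<in> prob_moment_ac 2" and "\<nu> \<in> prob_moment_ac 2"
    and "convex_on UNIV \<phi>" and "C2 \<phi>"
    and "0 < \<sigma>\<^sub>m" and "\<sigma>\<^sub>m \<le> \<sigma>\<^sub>M"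
    and "distr \<mu> borel (gradient \<phi>) = \<nu>"
    and "\<And>y. loewner_le (\<sigma>\<^sub>m *\<^sub>R mat 1) (hessian \<phi> y)"
    and "\<And>y. loewner_le (hessian \<phi> y) (\<sigma>\<^sub>M *\<^sub>R mat 1)"
    and "\<beta> > 0"
    and "\<mu> \<in> prob_moment (2 + \<beta>)" and "\<nu> \<in> prob_moment (2 + \<beta>)"
  shows "((\<lambda>\<epsilon>. (EOT \<epsilon> \<mu> \<nu> - OT \<mu> \<nu>
              + ereal (real CARD('d) / 2 * \<epsilon> * ln (pi * \<epsilon>))) / ereal \<epsilon>)
            \<longlongrightarrow> K_EOT \<phi> \<mu> \<nu>) (at_right 0)
         \<and> K_EOT \<phi> \<mu> \<nu> = - (Ent \<mu> + Ent \<nu>) / 2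
         \<and> K_EOT \<phi> \<mu> \<nu> < \<infinity>"
proof -
  interpret brenier_setting \<phi> \<sigma>\<^sub>m \<sigma>\<^sub>M \<mu> \<nu>
    by unfold_locales (fact assms)+
  show ?thesis
    using expansion_tendsto K_EOT_Ent by (simp add: expansion_def[abs_def])
qed

end
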